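(* There exist positive constants $C$ and $C_s$, where $C_s$ depends on $s$, such that for all $\sigma$ sufficiently large and all $n\ge1$, the restricted maximum likelihood estimator $\tilde\theta_n$ based on $n$ i.i.d. samples from $P_\theta$ satisfies $$\mathbb E\big[\rho(\tilde\theta_n,\theta)\big]\ \le\ C\,\frac{\sigma^2}{\sqrt n}+C\,\frac{\sigma^3\log n}{s\,n}+C_s\,\frac{\sigma^{11}}{n}$$ uniformly over all choices of $\theta\in\mathcal T$, where $s=|\mathrm{supp}(\theta)|$.
   Context: Fix a dimension $L\ge1$ and identify $\mathbb R^L$ with functions $\mathbb Z/L\mathbb Z\to\mathbb R$. Let $\mathcal R=\{R^{(\ell)}:1\le \ell\le L\}$ be the group of cyclic shifts, $(R^{(\ell)}\theta)(i)=\theta(i+\ell)$. For $\theta,\phi\in\mathbb R^L$ let $\rho(\theta,\phi)=\min_{G\in\mathcal R}\|\theta-G\phi\|$ (Euclidean norm). For noise level $\sigma>0$, $P_\theta$ is the law of $X=G\theta+\sigma\xi$, where $G$ is uniform on $\mathcal R$ and $\xi\sim\mathcal N(0,I_L)$ is independent of $G$. A vector $\theta\in\mathbb R^L$ is collision-free if every element of the multiset $\mathcal D(\theta)=\{i-j \ (\mathrm{mod}\ L): i,j\in\mathrm{supp}(\theta),\ i\ne j\}$ has multiplicity exactly $1$. Fix positive constants $m,M,\epsilon$. $\mathcal T$ is the set of $\theta\in\mathbb R^L$ such that (i) $\theta$ is collision-free; (ii) $\sigma\ge\|\theta\|$; (iii) $m\le|\theta(i)|\le M$ for all $i\in\mathrm{supp}(\theta)$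 and $s:=|\mathrm{supp}(\theta)|\ge\max\{7,(2+\epsilon)M^2/m^2\}$. The quantities $L,m,M,\epsilon$ are fixed throughout; constants may depend on them but not on $\sigma$, $n$ or $\theta$ (except through $s$ where indicated). Given i.i.d. samples $X_1,\dots,X_n$ from $P_\theta$, the restricted MLE $\tilde\theta_n$ is a maximizer over $\phi\in\mathcal T$ of $\sum_{i=1}^n\log\mathbb E_G\big[\exp\big(-\tfrac1{2\sigma^2}\|X_i-G\phi\|^2\big)\big]$, where $\mathbb E_G$ averages over $G$ uniform on $\mathcal R$. *)

theory Defs
  imports
    "HOL-Probability.Probability"
    "Berlekamp_Zassenhaus.Finite_Field"
begin

text \<open>
  The type \<open>'l mod_ring\<close> is the ring of integers modulo \<open>CARD('l)\<close>, so vectors of type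
  \<open>real ^ 'l mod_ring\<close> are functions from Z/LZ to the reals with \<open>L = CARD('l)\<close>; their \<^const>\<open>norm\<close>
  is the Euclidean norm. Every \<open>L \<ge> 1\<close> arises in this way.
\<close>

definition cyclic_shift :: "'l::finite mod_ring \<Rightarrow> real ^ 'l mod_ring \<Rightarrow> real ^ 'l mod_ring" where
  "cyclic_shift l \<theta> = (\<chi> i. \<theta> $ (i + l))"

definition orbit_dist :: "real ^ 'l::finite mod_ring \<Rightarrow> real ^ 'l mod_ring \<Rightarrow> real" where
  "orbit_dist \<theta> \<phi> = Min (range (\<lambda>l. norm (\<theta> - cyclic_shift l \<phi>)))"

definition std_gaussian :: "(real ^ 'l::finite mod_ring) measure" where
  "std_gaussian =
     distr (\<Pi>\<^sub>M i\<in>UNIV. std_normal_distribution) borel (\<lambda>f. \<chi> i. f i)"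

text \<open>
  The law of \<open>G \<theta> + \<sigma> \<xi>\<close>; the uniform shift \<open>G\<close> is represented by its uniformly distributed
  index in Z/LZ.
\<close>
definition mra_law :: "real \<Rightarrow> real ^ 'l::finite mod_ring \<Rightarrow> (real ^ 'l mod_ring) measure" where
  "mra_law \<sigma> \<theta> =
     distr (measure_pmf (pmf_of_set UNIV) \<Otimes>\<^sub>M std_gaussian) borel
       (\<lambda>(l, \<xi>). cyclic_shift l \<theta> + \<sigma> *\<^sub>R \<xi>)"

definition supp :: "real ^ 'l::finite mod_ring \<Rightarrow> 'l mod_ring set" where
  "supp \<theta> = {i. \<theta> $ i \<noteq> 0}"

definition differences :: "real ^ 'l::finite mod_ring \<Rightarrow> 'l mod_ring multiset" where
  "differences \<theta> =
     image_mset (\<lambda>(i, j). i - j) (mset_set {(i, j). i \<in> supp \<theta> \<and> j \<in> supp \<theta> \<and> i \<noteq> j})"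

definition collision_free :: "real ^ 'l::finite mod_ring \<Rightarrow> bool" where
  "collision_free \<theta> \<longleftrightarrow> (\<forall>d \<in># differences \<theta>. count (differences \<theta>) d = 1)"

definition signal_class :: "real \<Rightarrow> real \<Rightarrow> real \<Rightarrow> real \<Rightarrow> (real ^ 'l::finite mod_ring) set" where
  "signal_class m M \<epsilon> \<sigma> =
     {\<theta>. collision_free \<theta> \<and>
         \<sigma> \<ge> norm \<theta> \<and>
         (\<forall>i \<in> supp \<theta>. m \<le> \<bar>\<theta> $ i\<bar> \<and> \<bar>\<theta> $ i\<bar> \<le> M) \<and>
         real (card (supp \<theta>)) \<ge> max 7 ((2 + \<epsilon>) * M\<^sup>2 / m\<^sup>2)}"

text \<open>The samples are \<open>X 1, \<dots>, X n\<close>.\<close>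
definition log_likelihood ::
    "real \<Rightarrow> nat \<Rightarrow> (nat \<Rightarrow> real ^ 'l::finite mod_ring) \<Rightarrow> real ^ 'l mod_ring \<Rightarrow> real" where
  "log_likelihood \<sigma> n X \<phi> =
     (\<Sum>i = 1..n. ln (measure_pmf.expectation (pmf_of_set UNIV)
        (\<lambda>l. exp (- (1 / (2 * \<sigma>\<^sup>2)) * (norm (X i - cyclic_shift l \<phi>))\<^sup>2))))"

text \<open>
  Maximizers are never unique, since the log-likelihood and the signal class are invariant under
  shifts. An estimator is therefore any measurable selection of a maximizer.
\<close>
definition restricted_mle ::
    "real \<Rightarrow> real \<Rightarrow> real \<Rightarrow> real \<Rightarrow> nat \<Rightarrow> ((nat \<Rightarrow> real ^ 'l::finite mod_ring) \<Rightarrow> real ^ 'l mod_ring) \<Rightarrow> bool"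
  where
  "restricted_mle m M \<epsilon> \<sigma> n est \<longleftrightarrow>
     est \<in> (\<Pi>\<^sub>M i\<in>{1..n}. borel) \<rightarrow>\<^sub>M borel \<and>
     (\<forall>X \<in> space (\<Pi>\<^sub>M i\<in>{1..n}. borel).
        is_arg_max (log_likelihood \<sigma> n X) (\<lambda>\<phi>. \<phi> \<in> signal_class m M \<epsilon> \<sigma>) (est X))"

end

theory Submission
  imports Defs
begin

text \<open>
  After rescaling by \<open>1 / \<sigma>\<close> the sample has the density \<open>dens v\<close> with \<open>v = \<theta> / \<sigma>\<close> with respect to the standard
  Gaussian, and the maximizer \<open>\<phi>\<close> has \<open>u = \<phi> / \<sigma>\<close>. With \<open>g = dens u / dens v - 1\<close>, empirical mean \<open>P\<^sub>n\<close> and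
  \<open>ln (1 + g) \<le> g - g\<^sup>2 / 2 + g ^ 3 / 3\<close>, optimality gives \<open>0 \<le> P\<^sub>n g - P\<^sub>n g\<^sup>2 / 2 + P\<^sub>n g ^ 3 / 3\<close>.
  Let \<open>T\<close> be the largest difference between the shift-averaged moments of \<open>u\<close> and \<open>v\<close> of order at most 3.
  Expanding the exponentials in \<open>dens u\<close> into monomials, all orders are controlled by \<open>T\<close>, since for
  collision-free signals the moments of order 2 and 3 determine the orbit:
  \<open>\<Sum>l. \<theta> l * \<theta> (l + a)\<close> has a single nonzero term. Hence \<open>\<bar>g\<bar> \<le> const * T\<close> up to an exponential
  weight, and, uniformly in \<open>\<phi>\<close>, the empirical mean of \<open>g\<close> times a monomial of degree at most 3 is within \<open>const * T * N\<close>
  of its expectation, where \<open>N\<close> is a random variable that does not involve \<open>\<phi>\<close> and satisfies \<open>E N\<^sup>2 \<le> const / n\<close>.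
  These expectations are moment differences, so one of them has size at least \<open>const * T\<close>, and by
  Cauchy-Schwarz \<open>P\<^sub>n g\<^sup>2 \<ge> const * T\<^sup>2\<close>. Altogether \<open>T \<le> const * N\<close> unless \<open>N\<close> is bounded below.
  Second moments alone determine the signal near \<open>\<theta>\<close>, where therefore \<open>\<rho> \<le> const * \<sigma>\<^sup>2 * T\<close>, while
  globally third moments are needed and \<open>\<rho> \<le> const * \<sigma> ^ 3 * T\<close>; both combine to
  \<open>\<rho> \<le> const * (\<sigma>\<^sup>2 * N + \<sigma> ^ 6 * N\<^sup>2)\<close>.
\<close>

subsection \<open>Words and shift-averaged moments\<close>

text \<open>Monomials are indexed by words, that is, by ordered lists of indices, so that powers of
  sums expand without multinomial coefficients.\<close>

definition words :: "nat \<Rightarrow> 'a list set" where "words k = {w. length w = k}"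

definition wprod :: "'a list \<Rightarrow> real ^ 'a \<Rightarrow> real" where "wprod w z = (\<Prod>i\<leftarrow>w. z $ i)"

definition l1 :: "real ^ 'a::finite \<Rightarrow> real" where "l1 z = (\<Sum>i\<in>UNIV. \<bar>z $ i\<bar>)"

lemma wprod_Nil [simp]: "wprod [] z = 1"
  and wprod_Cons [simp]: "wprod (i # w) z = z $ i * wprod w z"
  by (simp_all add: wprod_def)

lemma wprod_append: "wprod (w @ w') z = wprod w z * wprod w' z"
  by (induction w) auto

lemma in_words_length: "w \<in> words (length w)"
  by (simp add: words_def)

lemma words_0 [simp]: "words 0 = {[]}"
  by (auto simp: words_def)

lemma words_eq: "words k = {w :: 'a list. set w \<subseteq> UNIV \<and> length w = k}"
  by (simp add: words_def)

lemma finite_words [simp]: "finite (words k :: 'a::finite list set)"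
  unfolding words_eq by (rule finite_lists_length_eq) simp

lemma card_words: "card (words k :: 'a::finite list set) = CARD('a) ^ k"
  unfolding words_eq by (rule card_lists_length_eq) simp

lemma sum_words_Suc:
  fixes f :: "'a::finite list \<Rightarrow> real"
  shows "(\<Sum>w\<in>words (Suc k). f w) = (\<Sum>i\<in>UNIV. \<Sum>w\<in>words k. f (i # w))"
proof -
  have "words (Suc k) = (\<lambda>(i, w). i # w) ` (UNIV \<times> words k :: ('a \<times> 'a list) set)"
    by (auto simp: words_def image_iff length_Suc_conv)
  moreover have "inj_on (\<lambda>(i, w). i # w) (UNIV \<times> words k :: ('a \<times> 'a list) set)"
    by (auto simp: inj_on_def)
  ultimately show ?thesis
    by (simp add: sum.reindex sum.cartesian_product o_def case_prod_unfold)
qed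

lemma sum_power_words:
  fixes a :: "'a::finite \<Rightarrow> real"
  shows "(\<Sum>i\<in>UNIV. a i) ^ k = (\<Sum>w\<in>words k. \<Prod>i\<leftarrow>w. a i)"
  by (induction k) (simp_all add: sum_words_Suc sum_product)

lemma inner_power: "(z \<bullet> u) ^ k = (\<Sum>w\<in>words k. wprod w z * wprod w u)"
  for z u :: "real ^ 'a::finite"
proof -
  have "(\<Prod>i\<leftarrow>w. z $ i * u $ i) = wprod w z * wprod w u" for w
    by (induction w) auto
  then show ?thesis
    by (simp add: inner_vec_def sum_power_words)
qed

lemma l1_power: "l1 z ^ k = (\<Sum>w\<in>words k. \<bar>wprod w z\<bar>)"
proof -
  have "(\<Prod>i\<leftarrow>w. \<bar>z $ i\<bar>) = \<bar>wprod w z\<bar>" for w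
    by (induction w) (auto simp: abs_mult)
  then show ?thesis
    by (simp add: l1_def sum_power_words)
qed

lemma l1_nonneg [simp]: "0 \<le> l1 z"
  by (simp add: l1_def sum_nonneg)

lemma component_le_l1: "\<bar>z $ i\<bar> \<le> l1 z"
  unfolding l1_def by (rule member_le_sum) auto

lemma abs_wprod_le: "\<bar>wprod w z\<bar> \<le> l1 z ^ length w"
  unfolding l1_power
  by (rule member_le_sum[of w "words (length w)" "\<lambda>w. \<bar>wprod w z\<bar>"]) (simp_all add: in_words_length)

lemma norm_le_l1: "norm z \<le> l1 z"
  unfolding l1_def using norm_le_l1_cart[of z] by simp

lemma abs_inner_le_l1:
  assumes "\<And>i. \<bar>u $ i\<bar> \<le> r"
  shows "\<bar>z \<bullet> u\<bar> \<le> r * l1 z"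
proof -
  have "\<bar>z \<bullet> u\<bar> \<le> (\<Sum>i\<in>UNIV. \<bar>z $ i * u $ i\<bar>)"
    unfolding inner_vec_def by (simp add: sum_abs)
  also have "\<dots> \<le> (\<Sum>i\<in>UNIV. r * \<bar>z $ i\<bar>)"
    using assms by (intro sum_mono) (simp add: abs_mult mult.commute[of "\<bar>z $ _\<bar>"] mult_right_mono)
  finally show ?thesis by (simp add: l1_def sum_distrib_left)
qed

lemma abs_wprod_bound:
  fixes r :: real
  assumes "\<And>i. \<bar>u $ i\<bar> \<le> r"
  shows "\<bar>wprod w u\<bar> \<le> r ^ length w"
proof (induction w)
  case (Cons i w)
  have "0 \<le> r" using assms[of i] by linarith
  then show ?case using Cons assms[of i] by (auto simp: abs_mult intro!: mult_mono)
qed simp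

text \<open>Telescoping: the letters are switched from \<open>v\<close> to \<open>u\<close> one at a
  time. Each switch costs a factor \<open>d\<close> and leaves \<open>length w - 1\<close> factors
  bounded by \<open>r\<close>.\<close>

lemma wprod_diff_le:
  fixes r d :: real
  assumes u: "\<And>i. \<bar>u $ i\<bar> \<le> r" and v: "\<And>i. \<bar>v $ i\<bar> \<le> r" and d: "\<And>i. \<bar>u $ i - v $ i\<bar> \<le> d"
  shows "\<bar>wprod w u - wprod w v\<bar> \<le> length w * r ^ (length w - 1) * d"
proof (induction w)
  case (Cons i w)
  have r: "0 \<le> r" using u[of i] by linarith
  have d0: "0 \<le> d" using d[of i] by linarith
  have "wprod (i # w) u - wprod (i # w) v
    = (u $ i - v $ i) * wprod w u + v $ i * (wprod w u - wprod w v)"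
    by (simp add: algebra_simps)
  also have "\<bar>\<dots>\<bar> \<le> d * r ^ length w + r * (length w * r ^ (length w - 1) * d)"
    using Cons d[of i] v[of i] abs_wprod_bound[OF u, of w] r d0
    by (intro order.trans[OF abs_triangle_ineq] add_mono) (auto simp: abs_mult intro!: mult_mono)
  \<comment> \<open>The case split deals with the truncated subtraction \<open>length w - 1\<close>
    at the empty word, where the prefactor \<open>length w\<close> vanishes.\<close>
  also have "\<dots> = length (i # w) * r ^ (length (i # w) - 1) * d"
    by (cases w) (auto simp: algebra_simps)
  finally show ?case .
qed simp

section \<open>Monomials and exponentials averaged over the cyclic shifts\<close>

definition moment :: "'l::finite mod_ring list \<Rightarrow> real ^ 'l mod_ring \<Rightarrow> real" where
  "moment w u = (\<Sum>l\<in>UNIV. wprod w (cyclic_shift l u)) / CARD('l)"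

definition shift_mgf :: "real ^ 'l::finite mod_ring \<Rightarrow> real ^ 'l mod_ring \<Rightarrow> real" where
  "shift_mgf u z = (\<Sum>l\<in>UNIV. exp (z \<bullet> cyclic_shift l u)) / CARD('l)"

lemma cyclic_shift_nth [simp]: "cyclic_shift l u $ i = u $ (i + l)"
  by (simp add: cyclic_shift_def)

lemma bij_plus_mod_ring: "bij (\<lambda>i. i + l :: 'l::finite mod_ring)"
  by (rule o_bij[of "\<lambda>i. i - l"]) (auto simp: fun_eq_iff)

lemma sum_plus_mod_ring: "(\<Sum>i\<in>UNIV. f (i + l :: 'l::finite mod_ring)) = (\<Sum>i\<in>UNIV. f i)"
  using sum.reindex_bij_betw[OF bij_plus_mod_ring[of l], of f] by simp

lemma cyclic_shift_shift: "cyclic_shift k (cyclic_shift l u) = cyclic_shift (k + l) u"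
  by (simp add: vec_eq_iff add.assoc)

lemma norm_cyclic_shift [simp]: "norm (cyclic_shift l u) = norm u"
  by (simp add: norm_vec_def L2_set_def sum_plus_mod_ring[of "\<lambda>i. (u $ i)\<^sup>2"])

lemma cyclic_shift_scaleR: "cyclic_shift l (c *\<^sub>R u) = c *\<^sub>R cyclic_shift l u"
  by (simp add: vec_eq_iff)

lemma moment_shift [simp]: "moment w (cyclic_shift l u) = moment w u"
  unfolding moment_def
  by (simp add: cyclic_shift_shift sum_plus_mod_ring[of "\<lambda>k. wprod w (cyclic_shift k u)" l])

text \<open>This is the exponential series with each power of the inner product expanded into words.
  The part of degree k sees \<open>u\<close> only through its moments of order k, so moment
  differences control differences of likelihoods.\<close>

lemma shift_mgf_sums:
  "(\<lambda>k. (\<Sum>w\<in>words k. wprod w z * moment w u) / fact k) sums shift_mgf u z"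
proof -
  have "(\<lambda>k. \<Sum>l\<in>UNIV. (z \<bullet> cyclic_shift l u) ^ k / fact k) sums (\<Sum>l\<in>UNIV. exp (z \<bullet> cyclic_shift l u))"
  proof (rule sums_sum)
    fix l
    show "(\<lambda>k. (z \<bullet> cyclic_shift l u) ^ k / fact k) sums exp (z \<bullet> cyclic_shift l u)"
      using exp_converges[of "z \<bullet> cyclic_shift l u"] by (simp add: divide_inverse mult.commute)
  qed
  then have "(\<lambda>k. (\<Sum>l\<in>UNIV. (z \<bullet> cyclic_shift l u) ^ k / fact k) / CARD('a)) sums shift_mgf u z"
    unfolding shift_mgf_def by (rule sums_divide)
  moreover have "(\<Sum>l\<in>UNIV. (z \<bullet> cyclic_shift l u) ^ k / fact k) / CARD('a)
     = (\<Sum>w\<in>words k. wprod w z * moment w u) / fact k" for k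
    unfolding inner_power moment_def
    by (simp add: sum_divide_distrib sum_distrib_left sum.swap[of _ "words k" UNIV] mult.commute)
  ultimately show ?thesis by simp
qed

lemma wprod_scaleR: "wprod w (c *\<^sub>R u) = c ^ length w * wprod w u"
  by (induction w) auto

lemma moment_scaleR: "moment w (c *\<^sub>R u) = c ^ length w * moment w u"
  by (simp add: moment_def cyclic_shift_scaleR wprod_scaleR sum_distrib_left)

lemma abs_moment_le:
  fixes u :: "real ^ 'l::finite mod_ring"
  assumes "\<And>i. \<bar>u $ i\<bar> \<le> r"
  shows "\<bar>moment w u\<bar> \<le> r ^ length w"
proof -
  have "\<bar>\<Sum>l\<in>UNIV. wprod w (cyclic_shift l u)\<bar> \<le> (\<Sum>l\<in>(UNIV::'l mod_ring set). r ^ length w)"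
    by (rule order.trans[OF sum_abs]) (intro sum_mono abs_wprod_bound, simp add: assms)
  then show ?thesis by (simp add: moment_def field_simps)
qed

lemma moment_diff_le:
  fixes u v :: "real ^ 'l::finite mod_ring" and r d :: real
  assumes u: "\<And>i. \<bar>u $ i\<bar> \<le> r" and v: "\<And>i. \<bar>v $ i\<bar> \<le> r" and d: "\<And>i. \<bar>u $ i - v $ i\<bar> \<le> d"
  shows "\<bar>moment w u - moment w v\<bar> \<le> length w * r ^ (length w - 1) * d"
proof -
  have "\<bar>\<Sum>l\<in>UNIV. wprod w (cyclic_shift l u) - wprod w (cyclic_shift l v)\<bar>
    \<le> (\<Sum>l\<in>(UNIV::'l mod_ring set). length w * r ^ (length w - 1) * d)"
    by (rule order.trans[OF sum_abs]) (intro sum_mono wprod_diff_le, auto simp: assms)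
  then show ?thesis by (simp add: moment_def field_simps sum_subtractf)
qed

subsection \<open>Moments of collision-free signals\<close>

text \<open>The part of \<open>signal_class\<close> that does not mention \<sigma>, except for the
  lower bound on the support size, which is carried as a separate hypothesis on
  \<open>card (supp \<theta>)\<close>.\<close>

definition admissible :: "real \<Rightarrow> real \<Rightarrow> real ^ 'l::finite mod_ring \<Rightarrow> bool" where
  "admissible m M \<theta> \<longleftrightarrow> collision_free \<theta> \<and> (\<forall>i\<in>supp \<theta>. m \<le> \<bar>\<theta> $ i\<bar> \<and> \<bar>\<theta> $ i\<bar> \<le> M)"

text \<open>The ordered pairs of distinct support points with a given difference form a set whose
  cardinality is the multiplicity of that difference, hence a singleton.\<close>

lemma collision_free_unique:
  assumes "collision_free \<theta>" and "{i, j, i', j'} \<subseteq> supp \<theta>" and "i \<noteq> j" and "i - j = i' - j'"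
  shows "i = i'" and "j = j'"
proof -
  define P where "P = {(i, j). i \<in> supp \<theta> \<and> j \<in> supp \<theta> \<and> i \<noteq> j}"
  have "i' \<noteq> j'" using assms(3,4) by auto
  then have in_P: "(i, j) \<in> P" "(i', j') \<in> P"
    using assms by (auto simp: P_def)
  have diffs: "differences \<theta> = image_mset (\<lambda>(i, j). i - j) (mset_set P)"
    by (simp add: differences_def P_def)
  have "i - j \<in># differences \<theta>"
    unfolding diffs using in_P by (force simp: finite_set_mset_mset_set)
  then have "count (differences \<theta>) (i - j) = 1"
    using assms(1) by (auto simp: collision_free_def)
  moreover define A where "A = {p \<in> P. (case p of (i, j) \<Rightarrow> i - j) = i - j}"
  ultimately have "card A = 1"
    unfolding diffs by (simp add: count_image_mset' count_mset_set' sum.If_cases Int_def conj_commute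
        eq_commute[of "i - j"])
  then obtain p where "A = {p}" by (rule card_1_singletonE)
  moreover have "(i, j) \<in> A" "(i', j') \<in> A"
    using in_P assms(4) by (auto simp: A_def)
  ultimately have "(i, j) = (i', j')" by simp
  then show "i = i'" "j = j'" by auto
qed

text \<open>A second nonzero product at distance \<open>a\<close> would repeat the difference
  \<open>a\<close> already realised by \<open>i + a\<close> and \<open>i\<close>.\<close>

lemma collision_free_prod_eq_0:
  assumes "collision_free \<theta>" "i \<in> supp \<theta>" "i + a \<in> supp \<theta>" "a \<noteq> 0" "l \<noteq> i"
  shows "\<theta> $ l * \<theta> $ (l + a) = 0"
proof (rule ccontr)
  assume "\<not> ?thesis"
  then have "{l + a, l, i + a, i} \<subseteq> supp \<theta>" using assms by (auto simp: supp_def)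
  then show False
    using collision_free_unique(2)[OF assms(1), of "l + a" l "i + a" i] assms(4,5) by simp
qed

lemma moment2_collision_free:
  fixes \<theta> :: "real ^ 'l::finite mod_ring"
  assumes "collision_free \<theta>" "i \<in> supp \<theta>" "i + a \<in> supp \<theta>" "a \<noteq> 0"
  shows "CARD('l) * moment [0, a] \<theta> = \<theta> $ i * \<theta> $ (i + a)"
proof -
  have "CARD('l) * moment [0, a] \<theta> = (\<Sum>l\<in>UNIV. \<theta> $ l * \<theta> $ (l + a))"
    by (simp add: moment_def add.commute)
  also have "\<dots> = (\<Sum>l\<in>{i}. \<theta> $ l * \<theta> $ (l + a))"
    using collision_free_prod_eq_0[OF assms] by (intro sum.mono_neutral_right) auto
  finally show ?thesis by simp
qed

text \<open>The first two letters already single out the summand \<open>l = i\<close>, so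
  \<open>b\<close> is arbitrary: the third factor reads off every entry of \<theta> relative to the
  base point \<open>i\<close>.\<close>

lemma moment3_collision_free:
  fixes \<theta> :: "real ^ 'l::finite mod_ring"
  assumes "collision_free \<theta>" "i \<in> supp \<theta>" "i + a \<in> supp \<theta>" "a \<noteq> 0"
  shows "CARD('l) * moment [0, a, b] \<theta> = \<theta> $ i * \<theta> $ (i + a) * \<theta> $ (i + b)"
proof -
  have "CARD('l) * moment [0, a, b] \<theta> = (\<Sum>l\<in>UNIV. \<theta> $ l * \<theta> $ (l + a) * \<theta> $ (l + b))"
    by (simp add: moment_def add.commute mult.assoc)
  also have "\<dots> = (\<Sum>l\<in>{i}. \<theta> $ l * \<theta> $ (l + a) * \<theta> $ (l + b))"
    using collision_free_prod_eq_0[OF assms] by (intro sum.mono_neutral_right) auto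
  finally show ?thesis by simp
qed

lemma admissible_abs_le: "admissible m M \<theta> \<Longrightarrow> 0 \<le> M \<Longrightarrow> \<bar>\<theta> $ i\<bar> \<le> M"
  by (cases "i \<in> supp \<theta>") (auto simp: admissible_def supp_def)

lemma admissible_prod_ge:
  assumes "admissible m M \<theta>" "i \<in> supp \<theta>" "j \<in> supp \<theta>" "0 < m"
  shows "m\<^sup>2 \<le> \<bar>\<theta> $ i * \<theta> $ j\<bar>"
  unfolding abs_mult power2_eq_square using assms
  by (intro mult_mono) (auto simp: admissible_def)

text \<open>If both signals realise the difference \<open>a\<close>, the quotient of the moments of
  \<open>[0, a, b]\<close> and \<open>[0, a]\<close> is the entry \<open>b\<close> places past the
  base point. Aligning the two base points gives the shift. The division is stable because the
  second moment times L is at least \<open>m\<^sup>2\<close> in absolute value.\<close>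

lemma moments_determine_orbit:
  fixes m M \<kappa> :: real and \<theta> \<phi> :: "real ^ 'l::finite mod_ring"
  assumes \<theta>: "admissible m M \<theta>" and \<phi>: "admissible m M \<phi>" and "0 < m" "0 < M"
    and card: "2 \<le> card (supp \<theta>)"
    and \<kappa>: "\<And>w. length w \<le> 3 \<Longrightarrow> \<bar>moment w \<phi> - moment w \<theta>\<bar> \<le> \<kappa>"
  shows "\<exists>l. \<forall>j. \<bar>\<phi> $ j - cyclic_shift l \<theta> $ j\<bar> \<le> CARD('l) * (4 * M + 1) / m\<^sup>2 * \<kappa>"
proof -
  define L where "L = real CARD('l)"
  have L: "0 < L" by (simp add: L_def)
  have \<kappa>0: "0 \<le> \<kappa>" using \<kappa>[of "[]"] by simp
  obtain i k where ik: "i \<in> supp \<theta>" "k \<in> supp \<theta>" "i \<noteq> k"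
    using card by (metis card_2_iff' card_le_Suc0_iff_eq finite not_less_eq_eq numeral_2_eq_2)
  define a where "a = k - i"
  have a: "i + a \<in> supp \<theta>" "a \<noteq> 0" using ik by (auto simp: a_def)
  have cf: "collision_free \<theta>" "collision_free \<phi>" using \<theta> \<phi> by (auto simp: admissible_def)
  note m2 = moment2_collision_free[OF cf(1) ik(1) a, folded L_def]
  note m3 = moment3_collision_free[OF cf(1) ik(1) a, folded L_def]
  have big: "m\<^sup>2 \<le> \<bar>L * moment [0, a] \<theta>\<bar>"
    unfolding m2 by (rule admissible_prod_ge[OF \<theta> ik(1) a(1) \<open>0 < m\<close>])
  have d: "\<bar>L * moment w \<phi> - L * moment w \<theta>\<bar> \<le> L * \<kappa>" if "length w \<le> 3" for w
    using \<kappa>[OF that] L by (simp flip: right_diff_distrib add: abs_mult)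
  show ?thesis
  proof (cases "m\<^sup>2 \<le> 2 * (L * \<kappa>)")
    \<comment> \<open>When \<kappa> is not small compared with \<open>m\<^sup>2\<close>, the trivial
      bound \<open>2 * M\<close> on the difference of entries suffices; this case produces the
      summand \<open>4 * M\<close> of the constant.\<close>
    case True
    have "\<bar>\<phi> $ j - cyclic_shift 0 \<theta> $ j\<bar> \<le> L * (4 * M + 1) / m\<^sup>2 * \<kappa>" for j
    proof -
      have "\<bar>\<phi> $ j - cyclic_shift 0 \<theta> $ j\<bar> \<le> 2 * M"
        using admissible_abs_le[OF \<theta>, of j] admissible_abs_le[OF \<phi>, of j] \<open>0 < M\<close> by simp
      also have "\<dots> \<le> 2 * M * (2 * (L * \<kappa>) / m\<^sup>2)"
        using mult_left_mono[of 1 "2 * (L * \<kappa>) / m\<^sup>2" "2 * M"] True \<open>0 < m\<close> \<open>0 < M\<close> by simp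
      also have "\<dots> \<le> L * (4 * M + 1) / m\<^sup>2 * \<kappa>"
        using \<kappa>0 L \<open>0 < m\<close> by (simp add: field_simps)
      finally show ?thesis .
    qed
    then show ?thesis unfolding L_def by blast
  next
    case False
    \<comment> \<open>The second moment of \<phi> at \<open>a\<close> cannot vanish, so \<phi> also
      realises the difference \<open>a\<close>, at some \<open>i'\<close>. Admissibility then lifts
      its size back to \<open>m\<^sup>2\<close>.\<close>
    then have "L * moment [0, a] \<phi> \<noteq> 0"
      using d[of "[0, a]"] big \<open>0 < m\<close> L \<kappa>0 by (auto simp: algebra_simps)
    then have "(\<Sum>l\<in>UNIV. \<phi> $ l * \<phi> $ (l + a)) \<noteq> 0"
      by (auto simp: moment_def L_def add.commute)
    then obtain i' where "\<phi> $ i' * \<phi> $ (i' + a) \<noteq> 0"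
      by (meson sum.neutral)
    then have i': "i' \<in> supp \<phi>" "i' + a \<in> supp \<phi>" by (auto simp: supp_def)
    note n2 = moment2_collision_free[OF cf(2) i' a(2), folded L_def]
    note n3 = moment3_collision_free[OF cf(2) i' a(2), folded L_def]
    have big': "m\<^sup>2 \<le> \<bar>L * moment [0, a] \<phi>\<bar>"
      unfolding n2 by (rule admissible_prod_ge[OF \<phi> i' \<open>0 < m\<close>])
    \<comment> \<open>Shifting by \<open>i - i'\<close> aligns the base point \<open>i\<close> of
      \<theta> with the base point \<open>i'\<close> of \<phi>.\<close>
    have "\<bar>\<phi> $ j - cyclic_shift (i - i') \<theta> $ j\<bar> \<le> L * (4 * M + 1) / m\<^sup>2 * \<kappa>" for j
    proof -
      define b where "b = j - i'"
      define p where "p = L * moment [0, a] \<phi>"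
      define q where "q = L * moment [0, a] \<theta>"
      have j: "j = i' + b" "j + (i - i') = i + b" by (auto simp: b_def)
      have P: "p * \<phi> $ j = L * moment [0, a, b] \<phi>" and Q: "q * \<theta> $ (i + b) = L * moment [0, a, b] \<theta>"
        unfolding p_def q_def n2 n3 m2 m3 j by auto
      \<comment> \<open>Quotients are compared after multiplying by \<open>p\<close>: the error
        splits into a difference of third moments and a difference \<open>p - q\<close> of second
        moments times a bounded entry.\<close>
      have "m\<^sup>2 * \<bar>\<phi> $ j - \<theta> $ (i + b)\<bar> \<le> \<bar>p\<bar> * \<bar>\<phi> $ j - \<theta> $ (i + b)\<bar>"
        using big' by (intro mult_right_mono) (auto simp: p_def)
      also have "\<dots> = \<bar>(p * \<phi> $ j - q * \<theta> $ (i + b)) - (p - q) * \<theta> $ (i + b)\<bar>"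
        by (simp add: abs_mult[symmetric] algebra_simps)
      also have "\<dots> \<le> L * \<kappa> + L * \<kappa> * M"
      proof (rule order.trans[OF abs_triangle_ineq4 add_mono])
        show "\<bar>p * \<phi> $ j - q * \<theta> $ (i + b)\<bar> \<le> L * \<kappa>"
          unfolding P Q by (rule d) simp
        show "\<bar>(p - q) * \<theta> $ (i + b)\<bar> \<le> L * \<kappa> * M"
          unfolding abs_mult p_def q_def using d[of "[0, a]"] L \<kappa>0 \<open>0 < M\<close>
          by (intro mult_mono admissible_abs_le[OF \<theta>]) auto
      qed
      also have "\<dots> \<le> L * (4 * M + 1) * \<kappa>"
        using L \<kappa>0 \<open>0 < M\<close> by (simp add: algebra_simps)
      finally have "\<bar>\<phi> $ j - \<theta> $ (i + b)\<bar> \<le> L * (4 * M + 1) * \<kappa> / m\<^sup>2"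
        using \<open>0 < m\<close> by (simp add: pos_le_divide_eq mult.commute)
      then show ?thesis
        unfolding cyclic_shift_nth j(2) by simp
    qed
    then show ?thesis unfolding L_def by blast
  qed
qed

text \<open>With two further support points \<open>i\<close>, \<open>k\<close>, the square of entry
  \<open>j\<close> is the product of the pairs (j, i) and (j, k) divided by the pair (i, k), and all
  three pair products are second moments. Closeness below \<open>m\<close> fixes supports and signs,
  so the squares determine the entries.\<close>

lemma second_moments_determine_locally:
  fixes m M \<kappa> :: real and \<theta> \<phi> :: "real ^ 'l::finite mod_ring"
  assumes \<theta>: "admissible m M \<theta>" and \<phi>: "admissible m M \<phi>" and "0 < m" "0 < M"
    and card: "3 \<le> card (supp \<theta>)"
    and near: "\<And>j. \<bar>\<phi> $ j - \<theta> $ j\<bar> < m"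
    and \<kappa>: "\<And>a. \<bar>moment [0, a] \<phi> - moment [0, a] \<theta>\<bar> \<le> \<kappa>"
  shows "\<bar>\<phi> $ j - \<theta> $ j\<bar> \<le> 3 * M\<^sup>2 * CARD('l) / m ^ 3 * \<kappa>"
proof -
  define L where "L = real CARD('l)"
  have L: "0 < L" by (simp add: L_def)
  have \<kappa>0: "0 \<le> \<kappa>" using \<kappa>[of 0] by simp
  have bnd: "m \<le> \<bar>\<theta> $ i\<bar>" if "i \<in> supp \<theta>" for i using that \<theta> by (auto simp: admissible_def)
  have bnd': "m \<le> \<bar>\<phi> $ i\<bar>" if "i \<in> supp \<phi>" for i using that \<phi> by (auto simp: admissible_def)
  \<comment> \<open>An entry that is nonzero in only one of the signals would differ by at least
    \<open>m\<close>.\<close>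
  have supp: "supp \<theta> = supp \<phi>"
  proof (intro equalityI subsetI)
    show "i \<in> supp \<phi>" if "i \<in> supp \<theta>" for i
      using bnd[OF that] near[of i] by (auto simp: supp_def)
    show "i \<in> supp \<theta>" if "i \<in> supp \<phi>" for i
      using bnd'[OF that] near[of i] by (auto simp: supp_def)
  qed
  have pair: "\<bar>\<phi> $ i * \<phi> $ k - \<theta> $ i * \<theta> $ k\<bar> \<le> L * \<kappa>"
    if "i \<in> supp \<theta>" "k \<in> supp \<theta>" "i \<noteq> k" for i k
  proof -
    have cf: "collision_free \<theta>" "collision_free \<phi>" using \<theta> \<phi> by (auto simp: admissible_def)
    have "L * moment [0, k - i] \<theta> = \<theta> $ i * \<theta> $ k" "L * moment [0, k - i] \<phi> = \<phi> $ i * \<phi> $ k"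
      using moment2_collision_free[OF cf(1), of i "k - i"] moment2_collision_free[OF cf(2), of i "k - i"]
        that supp by (auto simp: L_def)
    moreover have "L * \<bar>moment [0, k - i] \<phi> - moment [0, k - i] \<theta>\<bar> \<le> L * \<kappa>"
      using \<kappa> L by (intro mult_left_mono) auto
    ultimately show ?thesis
      using L by (metis (no_types) abs_mult abs_of_pos right_diff_distrib)
  qed
  show ?thesis
  proof (cases "j \<in> supp \<theta>")
    case False
    then have "\<phi> $ j = 0" "\<theta> $ j = 0" using supp by (auto simp: supp_def)
    then show ?thesis using \<kappa>0 \<open>0 < m\<close> by simp
  next
    case True
    have "2 \<le> card (supp \<theta> - {j})" using card True by simp
    then obtain i k where ik: "i \<in> supp \<theta> - {j}" "k \<in> supp \<theta> - {j}" "i \<noteq> k"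
      by (metis card_le_Suc0_iff_eq finite not_less_eq_eq numeral_2_eq_2)
    let ?p = "\<lambda>i k. \<phi> $ i * \<phi> $ k" and ?t = "\<lambda>i k. \<theta> $ i * \<theta> $ k"
    have le: "\<bar>?p i k\<bar> \<le> M\<^sup>2" "\<bar>?t i k\<bar> \<le> M\<^sup>2" for i k
      unfolding power2_eq_square abs_mult using \<open>0 < M\<close>
      by (intro mult_mono admissible_abs_le[OF \<phi>] admissible_abs_le[OF \<theta>]; simp)+
    have "m\<^sup>2 * \<bar>(\<phi> $ j)\<^sup>2 - (\<theta> $ j)\<^sup>2\<bar> \<le> \<bar>?p i k\<bar> * \<bar>(\<phi> $ j)\<^sup>2 - (\<theta> $ j)\<^sup>2\<bar>"
      using admissible_prod_ge[OF \<phi>, of i k] ik supp \<open>0 < m\<close> by (intro mult_right_mono) auto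
    \<comment> \<open>Since \<open>?p j j * ?p i k = ?p j i * ?p j k\<close>, and likewise for
      \<open>?t\<close>, the expression telescopes into three differences of pair products.\<close>
    also have "\<dots> = \<bar>?p j i * (?p j k - ?t j k) + ?t j k * (?p j i - ?t j i) - ?t j j * (?p i k - ?t i k)\<bar>"
      by (simp flip: abs_mult) (simp add: algebra_simps power2_eq_square)
    also have "\<dots> \<le> M\<^sup>2 * (L * \<kappa>) + M\<^sup>2 * (L * \<kappa>) + M\<^sup>2 * (L * \<kappa>)"
      using ik True
      by (intro order.trans[OF abs_triangle_ineq4] order.trans[OF abs_triangle_ineq] add_mono)
        (auto simp only: abs_mult[of "_ * _" "_ - _"] intro!: mult_mono le pair zero_le_power2)
    finally have sq: "m\<^sup>2 * \<bar>(\<phi> $ j)\<^sup>2 - (\<theta> $ j)\<^sup>2\<bar> \<le> 3 * M\<^sup>2 * L * \<kappa>"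
      by (simp add: mult_ac)
    \<comment> \<open>Opposite signs would place the entries at least \<open>2 * m\<close> apart, so
      the signs agree and the sum stays away from zero.\<close>
    have "m \<le> \<bar>\<phi> $ j + \<theta> $ j\<bar>"
      using bnd[OF True] bnd'[of j] near[of j] True supp by linarith
    then have "m * \<bar>\<phi> $ j - \<theta> $ j\<bar> \<le> \<bar>\<phi> $ j + \<theta> $ j\<bar> * \<bar>\<phi> $ j - \<theta> $ j\<bar>"
      by (intro mult_right_mono) auto
    also have "\<dots> = \<bar>(\<phi> $ j)\<^sup>2 - (\<theta> $ j)\<^sup>2\<bar>"
      by (simp flip: abs_mult add: algebra_simps power2_eq_square)
    finally have "m\<^sup>2 * (m * \<bar>\<phi> $ j - \<theta> $ j\<bar>) \<le> 3 * M\<^sup>2 * L * \<kappa>"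
      using sq \<open>0 < m\<close> by (meson mult_left_mono order.trans zero_le_power2)
    then show ?thesis
      using \<open>0 < m\<close> by (simp add: L_def field_simps power2_eq_square power3_eq_cube)
  qed
qed

subsection \<open>The law of the observations\<close>

lemma borel_measurable_vec_lambda:
  "(\<lambda>f. \<chi> i. f i) \<in> borel_measurable (\<Pi>\<^sub>M i\<in>(UNIV::'n::finite set). (borel :: real measure))"
  by (auto simp: borel_measurable_euclidean_space[of "\<lambda>f. \<chi> i. f i"] Basis_vec_def inner_axis)

text \<open>Lebesgue measure is determined by its values on boxes. The identification transports the
  coordinatewise definition of \<open>std_gaussian\<close> to a density on the vector space.\<close>

lemma lborel_vec:
  "distr (\<Pi>\<^sub>M i\<in>(UNIV::'n::finite set). lborel) borel (\<lambda>f. \<chi> i. f i) = (lborel :: (real ^ 'n) measure)"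
proof (rule lborel_eqI[symmetric])
  interpret product_sigma_finite "\<lambda>i::'n. lborel :: real measure" ..
  fix l u :: "real ^ 'n"
  assume le: "\<And>b. b \<in> Basis \<Longrightarrow> l \<bullet> b \<le> u \<bullet> b"
  have le': "l $ i \<le> u $ i" for i
    using le[of "axis i 1"] by (auto simp: Basis_vec_def inner_axis)
  have meas: "(\<lambda>f. \<chi> i. f i) \<in> borel_measurable (\<Pi>\<^sub>M i\<in>(UNIV::'n set). (lborel :: real measure))"
    using borel_measurable_vec_lambda by (simp cong: measurable_cong_sets sets_PiM_cong)
  have "(\<lambda>f. \<chi> i. f i) -` box l u \<inter> space (\<Pi>\<^sub>M i\<in>(UNIV::'n set). (lborel :: real measure))
    = (\<Pi>\<^sub>E i\<in>UNIV. {l $ i <..< u $ i})"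
    by (auto simp: space_PiM mem_box_cart PiE_def Pi_iff)
  then have "emeasure (distr (\<Pi>\<^sub>M i\<in>(UNIV::'n set). lborel) borel (\<lambda>f. \<chi> i. f i)) (box l u)
    = (\<Prod>i\<in>UNIV. ennreal (u $ i - l $ i))"
    using le' by (simp add: emeasure_distr[OF meas] emeasure_PiM)
  also have "\<dots> = (\<Prod>b\<in>Basis. ennreal ((u - l) \<bullet> b))"
    by (simp add: Basis_vec_def UNION_singleton_eq_range prod.reindex inj_on_def axis_eq_axis inner_axis)
  finally show "emeasure (distr (\<Pi>\<^sub>M i\<in>(UNIV::'n set). lborel) borel (\<lambda>f. \<chi> i. f i)) (box l u)
    = ennreal (\<Prod>b\<in>Basis. (u - l) \<bullet> b)"
    using le by (simp add: prod_ennreal inner_diff_left)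
qed simp

lemma PiM_density_lborel:
  fixes g :: "real \<Rightarrow> ennreal"
  assumes [measurable]: "g \<in> borel_measurable borel" and "prob_space (density lborel g)"
  shows "(\<Pi>\<^sub>M i\<in>(UNIV::'n::finite set). density lborel g)
    = density (\<Pi>\<^sub>M i\<in>UNIV. lborel) (\<lambda>f. \<Prod>i\<in>UNIV. g (f i))"
proof -
  interpret D: product_prob_space "\<lambda>i::'n. density lborel g"
    by (rule product_prob_spaceI) (rule assms)
  interpret product_sigma_finite "\<lambda>i::'n. lborel :: real measure" ..
  show ?thesis
  proof (rule D.PiM_eqI[symmetric])
    show "sets (density (\<Pi>\<^sub>M i\<in>(UNIV::'n set). lborel) (\<lambda>f. \<Prod>i\<in>UNIV. g (f i)))
      = sets (\<Pi>\<^sub>M i\<in>(UNIV::'n set). density lborel g)"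
      by (simp cong: sets_PiM_cong)
    fix A :: "'n \<Rightarrow> real set"
    assume A: "\<And>i. i \<in> UNIV \<Longrightarrow> A i \<in> sets (density lborel g)"
    then have [measurable]: "A i \<in> sets borel" for i by simp
    have "emeasure (density (\<Pi>\<^sub>M i\<in>(UNIV::'n set). lborel) (\<lambda>f. \<Prod>i\<in>UNIV. g (f i))) (Pi\<^sub>E UNIV A)
      = (\<integral>\<^sup>+f. (\<Prod>i\<in>UNIV. g (f i)) * indicator (Pi\<^sub>E UNIV A) f \<partial>(\<Pi>\<^sub>M i\<in>(UNIV::'n set). lborel))"
      by (rule emeasure_density) (auto intro!: sets_PiM_I_finite)
    also have "\<dots> = (\<integral>\<^sup>+f. (\<Prod>i\<in>UNIV. g (f i) * indicator (A i) (f i)) \<partial>(\<Pi>\<^sub>M i\<in>(UNIV::'n set). lborel))"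
      by (intro nn_integral_cong)
        (auto simp: prod.distrib indicator_def PiE_def Pi_iff)
    also have "\<dots> = (\<Prod>i\<in>UNIV. \<integral>\<^sup>+x. g x * indicator (A i) x \<partial>lborel)"
      by (rule product_nn_integral_prod) auto
    also have "\<dots> = (\<Prod>i\<in>UNIV. emeasure (density lborel g) (A i))"
      by (simp add: emeasure_density)
    finally show "emeasure (density (\<Pi>\<^sub>M i\<in>(UNIV::'n set). lborel) (\<lambda>f. \<Prod>i\<in>UNIV. g (f i))) (Pi\<^sub>E UNIV A)
      = (\<Prod>i\<in>UNIV. emeasure (density lborel g) (A i))" .
  qed simp
qed

section \<open>The standard Gaussian density, change of mean and exponential integrability\<close>

definition gauss_density :: "real ^ 'n::finite \<Rightarrow> real" where
  "gauss_density z = (\<Prod>i\<in>UNIV. std_normal_density (z $ i))"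

lemma borel_measurable_gauss_density [measurable]: "gauss_density \<in> borel_measurable borel"
  unfolding gauss_density_def by measurable

lemma std_gaussian_density:
  "(std_gaussian :: (real ^ 'l::finite mod_ring) measure) = density lborel (\<lambda>z. ennreal (gauss_density z))"
proof -
  have meas: "(\<lambda>f. \<chi> i. f i) \<in> (\<Pi>\<^sub>M i\<in>(UNIV::'l mod_ring set). (lborel :: real measure)) \<rightarrow>\<^sub>M borel"
    using borel_measurable_vec_lambda by (simp cong: measurable_cong_sets sets_PiM_cong)
  have "std_gaussian = distr (density (\<Pi>\<^sub>M i\<in>(UNIV::'l mod_ring set). lborel)
      (\<lambda>f. \<Prod>i\<in>UNIV. ennreal (std_normal_density (f i)))) borel (\<lambda>f. \<chi> i. f i)"
    unfolding std_gaussian_def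
    by (subst PiM_density_lborel) (auto intro: prob_space_normal_density)
  also have "\<dots> = distr (density (\<Pi>\<^sub>M i\<in>(UNIV::'l mod_ring set). lborel)
      (\<lambda>f. ennreal (gauss_density (\<chi> i. f i)))) borel (\<lambda>f. \<chi> i. f i)"
    by (simp add: gauss_density_def prod_ennreal)
  also have "\<dots> = density lborel (\<lambda>z. ennreal (gauss_density z))"
    unfolding lborel_vec[symmetric] by (subst density_distr[OF _ meas]) auto
  finally show ?thesis .
qed

lemma sets_std_gaussian [measurable_cong, simp]: "sets std_gaussian = sets borel"
  by (simp add: std_gaussian_density)

lemma space_std_gaussian [simp]: "space std_gaussian = UNIV"
  by (simp add: std_gaussian_density)

lemma prob_space_std_gaussian: "prob_space (std_gaussian :: (real ^ 'l::finite mod_ring) measure)"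
proof -
  interpret P: prob_space "\<Pi>\<^sub>M i\<in>(UNIV::'l mod_ring set). std_normal_distribution"
    by (rule prob_space_PiM) (auto intro: prob_space_normal_density)
  have "(\<lambda>f. \<chi> i. f i) \<in> (\<Pi>\<^sub>M i\<in>(UNIV::'l mod_ring set). std_normal_distribution) \<rightarrow>\<^sub>M borel"
    using borel_measurable_vec_lambda by (simp cong: measurable_cong_sets sets_PiM_cong)
  then show ?thesis
    unfolding std_gaussian_def by (rule P.prob_space_distr)
qed

lemma gauss_density_nonneg [simp]: "0 \<le> gauss_density z"
  by (simp add: gauss_density_def prod_nonneg)

text \<open>The Cameron-Martin factor, obtained by completing the square in every
  coordinate.\<close>

lemma gauss_density_shift:
  "gauss_density (z - \<mu>) = gauss_density z * exp (z \<bullet> \<mu> - (norm \<mu>)\<^sup>2 / 2)"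
proof -
  have "std_normal_density (x - m) = std_normal_density x * exp (x * m - m\<^sup>2 / 2)" for x m :: real
    unfolding std_normal_density_def
    by (simp add: mult.assoc flip: exp_add) (simp add: power2_eq_square field_simps)
  then have "gauss_density (z - \<mu>) = gauss_density z * exp (\<Sum>i\<in>UNIV. z $ i * \<mu> $ i - (\<mu> $ i)\<^sup>2 / 2)"
    by (simp add: gauss_density_def prod.distrib exp_sum)
  also have "(\<Sum>i\<in>UNIV. z $ i * \<mu> $ i - (\<mu> $ i)\<^sup>2 / 2) = z \<bullet> \<mu> - (norm \<mu>)\<^sup>2 / 2"
    unfolding power2_norm_eq_inner
    by (simp add: inner_vec_def sum_subtractf sum_divide_distrib power2_eq_square)
  finally show ?thesis .
qed

lemma nn_integral_std_gaussian_shift: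
  fixes F :: "real ^ 'l::finite mod_ring \<Rightarrow> ennreal"
  assumes [measurable]: "F \<in> borel_measurable borel"
  shows "(\<integral>\<^sup>+z. F (z + \<mu>) \<partial>std_gaussian)
    = (\<integral>\<^sup>+z. F z * ennreal (exp (z \<bullet> \<mu> - (norm \<mu>)\<^sup>2 / 2)) \<partial>std_gaussian)"
proof -
  have "(\<integral>\<^sup>+z. F (z + \<mu>) \<partial>std_gaussian) = (\<integral>\<^sup>+z. ennreal (gauss_density z) * F (z + \<mu>) \<partial>lborel)"
    unfolding std_gaussian_density by (subst nn_integral_density) auto
  also have "\<dots> = (\<integral>\<^sup>+z. ennreal (gauss_density (z - \<mu>)) * F z \<partial>distr lborel borel (\<lambda>z. \<mu> + z))"
    by (subst nn_integral_distr) (auto simp: add.commute)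
  also have "\<dots> = (\<integral>\<^sup>+z. ennreal (gauss_density (z - \<mu>)) * F z \<partial>lborel)"
    by (simp add: lborel_distr_plus)
  also have "\<dots> = (\<integral>\<^sup>+z. F z * ennreal (exp (z \<bullet> \<mu> - (norm \<mu>)\<^sup>2 / 2)) \<partial>std_gaussian)"
    unfolding std_gaussian_density
    by (subst nn_integral_density) (auto simp: gauss_density_shift ennreal_mult mult_ac)
  finally show ?thesis .
qed

text \<open>\<open>exp (c * \<bar>x\<bar>)\<close> is at most
  \<open>exp (c * x) + exp (- c * x)\<close>, and against the normal density each summand is
  \<open>exp (c\<^sup>2 / 2)\<close> times a normal density with shifted mean.\<close>

lemma nn_integral_std_normal_exp_abs:
  "(\<integral>\<^sup>+x. ennreal (exp (c * \<bar>x\<bar>)) \<partial>std_normal_distribution) \<le> ennreal (2 * exp (c\<^sup>2 / 2))"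
proof -
  have eq: "std_normal_density x * exp (c * x) = exp (c\<^sup>2 / 2) * normal_density c 1 x" for c x :: real
    unfolding normal_density_def
    by (simp flip: exp_add) (simp add: power2_eq_square field_simps)
  have nd: "(\<integral>\<^sup>+x. ennreal (normal_density c 1 x) \<partial>lborel) = 1" for c
    by (subst nn_integral_eq_integral) auto
  have "exp (c * \<bar>x\<bar>) \<le> exp (c * x) + exp (- c * x)" for x
    by (cases "0 \<le> x") auto
  then have "(\<integral>\<^sup>+x. ennreal (exp (c * \<bar>x\<bar>)) \<partial>std_normal_distribution)
    \<le> (\<integral>\<^sup>+x. ennreal (exp (c * x) + exp (- c * x)) \<partial>std_normal_distribution)"
    by (intro nn_integral_mono ennreal_leI)
  also have "\<dots> = (\<integral>\<^sup>+x. ennreal (exp (c\<^sup>2 / 2) * normal_density c 1 x)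
      + ennreal (exp (c\<^sup>2 / 2) * normal_density (- c) 1 x) \<partial>lborel)"
    using eq[of _ c] eq[of _ "- c"]
    by (subst nn_integral_density)
      (auto intro!: nn_integral_cong simp: ennreal_mult[symmetric] distrib_left simp flip: ennreal_plus)
  also have "\<dots> = ennreal (2 * exp (c\<^sup>2 / 2))"
    by (subst nn_integral_add) (auto simp: ennreal_mult nn_integral_cmult nd simp flip: ennreal_plus)
  finally show ?thesis .
qed

lemma borel_measurable_l1 [measurable]: "l1 \<in> borel_measurable borel"
  unfolding l1_def by measurable

lemma borel_measurable_wprod [measurable]: "wprod w \<in> borel_measurable borel"
proof (induction w)
  case Nil
  then show ?case by simp
next
  case (Cons i w)
  have "wprod (i # w) = (\<lambda>z. z $ i * wprod w z)" by auto
  then show ?case using Cons by simp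
qed

text \<open>Because \<open>l1\<close> is additive over coordinates, the weight factorises over the
  product measure. All later domination arguments use weights of this form.\<close>

lemma integrable_exp_l1: "integrable (std_gaussian :: (real ^ 'l::finite mod_ring) measure) (\<lambda>z. exp (c * l1 z))"
proof (rule integrableI_bounded)
  interpret product_prob_space "\<lambda>i::'l mod_ring. std_normal_distribution"
    by (rule product_prob_spaceI) (auto intro: prob_space_normal_density)
  have meas: "(\<lambda>f. \<chi> i. f i) \<in> (\<Pi>\<^sub>M i\<in>(UNIV::'l mod_ring set). std_normal_distribution) \<rightarrow>\<^sub>M borel"
    using borel_measurable_vec_lambda by (simp cong: measurable_cong_sets sets_PiM_cong)
  have "(\<integral>\<^sup>+z. ennreal (norm (exp (c * l1 z))) \<partial>(std_gaussian :: (real ^ 'l mod_ring) measure))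
    = (\<integral>\<^sup>+f. (\<Prod>i\<in>UNIV. ennreal (exp (c * \<bar>f i\<bar>))) \<partial>(\<Pi>\<^sub>M i\<in>(UNIV::'l mod_ring set). std_normal_distribution))"
    unfolding std_gaussian_def
    by (subst nn_integral_distr[OF meas])
      (auto simp: l1_def sum_distrib_left exp_sum prod_ennreal abs_prod)
  also have "\<dots> = (\<Prod>i\<in>(UNIV::'l mod_ring set). \<integral>\<^sup>+x. ennreal (exp (c * \<bar>x\<bar>)) \<partial>std_normal_distribution)"
    by (rule product_nn_integral_prod) auto
  also have "\<dots> \<le> (\<Prod>i\<in>(UNIV::'l mod_ring set). ennreal (2 * exp (c\<^sup>2 / 2)))"
    using nn_integral_std_normal_exp_abs[of c] by (simp add: power_mono_ennreal)
  also have "\<dots> < \<infinity>"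
    by (simp add: power_less_top_ennreal)
  finally show "(\<integral>\<^sup>+z. ennreal (norm (exp (c * l1 z))) \<partial>(std_gaussian :: (real ^ 'l mod_ring) measure)) < \<infinity>" .
qed measurable

section \<open>Density of the rescaled observation with respect to the standard Gaussian\<close>

definition dens :: "real ^ 'l::finite mod_ring \<Rightarrow> real ^ 'l mod_ring \<Rightarrow> real" where
  "dens u z = exp (- (norm u)\<^sup>2 / 2) * shift_mgf u z"

lemma dens_eq: "dens u z = (\<Sum>l\<in>UNIV. exp (z \<bullet> cyclic_shift l u - (norm u)\<^sup>2 / 2)) / CARD('l)"
  for u :: "real ^ 'l::finite mod_ring"
  by (simp add: dens_def shift_mgf_def sum_distrib_right diff_conv_add_uminus exp_add mult.commute
      del: add_uminus_conv_diff)

lemma borel_measurable_dens [measurable]: "dens u \<in> borel_measurable borel"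
  unfolding dens_def shift_mgf_def by measurable

lemma shift_mgf_pos: "0 < shift_mgf u z"
  unfolding shift_mgf_def by (intro divide_pos_pos sum_pos) auto

lemma dens_pos: "0 < dens u z"
  by (simp add: dens_def shift_mgf_pos)

text \<open>The change-of-mean formula is applied at every shift of
  \<open>\<theta> / \<sigma>\<close> and averaged. All shifts have the same norm, so the normalising
  factor is common to them.\<close>

lemma nn_integral_mra_law:
  fixes \<theta> :: "real ^ 'l::finite mod_ring"
  assumes F [measurable]: "F \<in> borel_measurable borel" and "\<sigma> > 0"
  shows "(\<integral>\<^sup>+x. F x \<partial>mra_law \<sigma> \<theta>)
    = (\<integral>\<^sup>+z. F (\<sigma> *\<^sub>R z) * ennreal (dens ((1 / \<sigma>) *\<^sub>R \<theta>) z) \<partial>std_gaussian)"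
proof -
  let ?G = "std_gaussian :: (real ^ 'l mod_ring) measure"
  let ?U = "measure_pmf (pmf_of_set (UNIV :: 'l mod_ring set))"
  let ?u = "(1 / \<sigma>) *\<^sub>R \<theta>"
  interpret G: prob_space ?G by (rule prob_space_std_gaussian)
  have "(\<lambda>p. cyclic_shift (fst p) \<theta>) \<in> ?U \<Otimes>\<^sub>M ?G \<rightarrow>\<^sub>M borel"
    by (rule measurable_compose[OF measurable_fst]) simp
  then have [measurable]: "(\<lambda>(l, \<xi>). cyclic_shift l \<theta> + \<sigma> *\<^sub>R \<xi>) \<in> ?U \<Otimes>\<^sub>M ?G \<rightarrow>\<^sub>M borel"
    unfolding case_prod_unfold by (intro borel_measurable_add) auto
  have "(\<integral>\<^sup>+x. F x \<partial>mra_law \<sigma> \<theta>) = (\<integral>\<^sup>+l. \<integral>\<^sup>+\<xi>. F (cyclic_shift l \<theta> + \<sigma> *\<^sub>R \<xi>) \<partial>?G \<partial>?U)"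
    unfolding mra_law_def by (simp add: nn_integral_distr G.nn_integral_fst[symmetric])
  also have "\<dots> = (\<Sum>l\<in>UNIV. \<integral>\<^sup>+\<xi>. F (cyclic_shift l \<theta> + \<sigma> *\<^sub>R \<xi>) \<partial>?G) / CARD('l)"
    by (simp add: nn_integral_pmf_of_set)
  also have "\<dots> = (\<Sum>l\<in>UNIV. \<integral>\<^sup>+z. F (\<sigma> *\<^sub>R z) * ennreal (exp (z \<bullet> cyclic_shift l ?u - (norm ?u)\<^sup>2 / 2)) \<partial>?G) / CARD('l)"
  proof -
    have "(\<integral>\<^sup>+\<xi>. F (cyclic_shift l \<theta> + \<sigma> *\<^sub>R \<xi>) \<partial>?G) = (\<integral>\<^sup>+\<xi>. F (\<sigma> *\<^sub>R (\<xi> + cyclic_shift l ?u)) \<partial>?G)" for l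
      using \<open>\<sigma> > 0\<close> by (simp add: cyclic_shift_scaleR scaleR_add_right add.commute)
    moreover have "(\<integral>\<^sup>+\<xi>. F (\<sigma> *\<^sub>R (\<xi> + cyclic_shift l ?u)) \<partial>?G)
      = (\<integral>\<^sup>+z. F (\<sigma> *\<^sub>R z) * ennreal (exp (z \<bullet> cyclic_shift l ?u - (norm ?u)\<^sup>2 / 2)) \<partial>?G)" for l
      using nn_integral_std_gaussian_shift[of "\<lambda>z. F (\<sigma> *\<^sub>R z)" "cyclic_shift l ?u"]
      by (simp only: norm_cyclic_shift) measurable
    ultimately show ?thesis by simp
  qed
  also have "\<dots> = (\<integral>\<^sup>+z. F (\<sigma> *\<^sub>R z) * ennreal (dens ?u z) \<partial>?G)"
    by (simp add: dens_eq divide_ennreal[symmetric] sum_nonneg nn_integral_sum[symmetric] sum_distrib_left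
        ennreal_times_divide ennreal_of_nat_eq_real_of_nat nn_integral_divide flip: sum_ennreal)
  finally show ?thesis .
qed

lemma mra_law_eq:
  assumes "\<sigma> > 0"
  shows "mra_law \<sigma> \<theta>
    = distr (density std_gaussian (\<lambda>z. ennreal (dens ((1 / \<sigma>) *\<^sub>R \<theta>) z))) borel (\<lambda>z. \<sigma> *\<^sub>R z)"
proof (rule measure_eqI)
  fix A assume "A \<in> sets (mra_law \<sigma> \<theta>)"
  then have [measurable]: "A \<in> sets borel" by (simp add: mra_law_def)
  have "emeasure (mra_law \<sigma> \<theta>) A = (\<integral>\<^sup>+x. indicator A x \<partial>mra_law \<sigma> \<theta>)"
    by (simp add: mra_law_def)
  also have "\<dots> = (\<integral>\<^sup>+x. indicator A x \<partial>distr (density std_gaussian (\<lambda>z. ennreal (dens ((1 / \<sigma>) *\<^sub>R \<theta>) z))) borel (\<lambda>z. \<sigma> *\<^sub>R z))"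
    using assms by (simp add: nn_integral_mra_law nn_integral_distr nn_integral_density mult.commute
        del: nn_integral_indicator)
  finally show "emeasure (mra_law \<sigma> \<theta>) A = emeasure (distr (density std_gaussian (\<lambda>z. ennreal (dens ((1 / \<sigma>) *\<^sub>R \<theta>) z))) borel (\<lambda>z. \<sigma> *\<^sub>R z)) A"
    by simp
qed (simp add: mra_law_def)

lemma prob_space_mra_law: "prob_space (mra_law \<sigma> \<theta>)"
  for \<theta> :: "real ^ 'l::finite mod_ring"
proof -
  let ?G = "std_gaussian :: (real ^ 'l mod_ring) measure"
  let ?U = "measure_pmf (pmf_of_set (UNIV :: 'l mod_ring set))"
  interpret G: prob_space ?G by (rule prob_space_std_gaussian)
  interpret U: prob_space ?U by (rule measure_pmf.prob_space_axioms)
  interpret pair_prob_space ?U ?G ..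
  have "(\<lambda>p. cyclic_shift (fst p) \<theta>) \<in> ?U \<Otimes>\<^sub>M ?G \<rightarrow>\<^sub>M borel"
    by (rule measurable_compose[OF measurable_fst]) simp
  then have [measurable]: "(\<lambda>(l, \<xi>). cyclic_shift l \<theta> + \<sigma> *\<^sub>R \<xi>) \<in> ?U \<Otimes>\<^sub>M ?G \<rightarrow>\<^sub>M borel"
    unfolding case_prod_unfold by (intro borel_measurable_add) auto
  show ?thesis unfolding mra_law_def by (rule prob_space_distr) measurable
qed

text \<open>Expanding the square, the off-diagonal products of centred independent variables have
  mean zero, and the diagonal gives the variance over \<open>n\<close>. When the second moment is
  infinite the right-hand side is infinite.\<close>

lemma nn_integral_empirical_deviation:
  fixes F :: "'a \<Rightarrow> real" and n :: nat
  assumes "prob_space P" and [measurable]: "F \<in> borel_measurable P" and n: "0 < n"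
  shows "(\<integral>\<^sup>+X. ennreal (((\<Sum>i=1..n. F (X i)) / n - (\<integral>x. F x \<partial>P))\<^sup>2) \<partial>(\<Pi>\<^sub>M i\<in>{1..n}. P))
    \<le> (\<integral>\<^sup>+x. ennreal ((F x)\<^sup>2) \<partial>P) / ennreal n"
proof (cases "(\<integral>\<^sup>+x. ennreal ((F x)\<^sup>2) \<partial>P) = \<infinity>")
  case True
  then show ?thesis by (simp add: ennreal_top_divide)
next
  case False
  interpret P: prob_space P by fact
  interpret PP: product_prob_space "\<lambda>i::nat. P" by (rule product_prob_spaceI) fact
  let ?I = "{1..n} :: nat set"
  let ?PM = "\<Pi>\<^sub>M i\<in>?I. P"
  have F2: "integrable P (\<lambda>x. (F x)\<^sup>2)"
    using False by (intro integrableI_bounded) (auto simp: less_top)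
  have F1: "integrable P F"
    by (rule P.square_integrable_imp_integrable[OF _ F2]) measurable
  define G where "G x = F x - (\<integral>x. F x \<partial>P)" for x
  have [measurable]: "G \<in> borel_measurable P" unfolding G_def by measurable
  have G1: "integrable P G" "(\<integral>x. G x \<partial>P) = 0"
    unfolding G_def using F1 by (auto simp: P.prob_space)
  have Gsq: "(G x)\<^sup>2 = (F x)\<^sup>2 - 2 * (\<integral>x. F x \<partial>P) * F x + (\<integral>x. F x \<partial>P)\<^sup>2" for x
    by (simp add: G_def power2_diff)
  have G2: "integrable P (\<lambda>x. (G x)\<^sup>2)"
    unfolding Gsq using F1 F2 by auto
  have var: "(\<integral>x. (G x)\<^sup>2 \<partial>P) \<le> (\<integral>x. (F x)\<^sup>2 \<partial>P)"
    unfolding G_def using P.variance_eq[OF F1 F2] by simp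
  \<comment> \<open>The product over \<open>k\<close> of \<open>h i j k (X k)\<close> is
    \<open>G (X i) * G (X j)\<close>, including the case \<open>i = j\<close>; thus the Fubini
    theorem for products of one-coordinate functions takes the place of an independence
    argument.\<close>
  define h where "h i j k x = (if k = i then G x else 1) * (if k = j then G x else 1)" for i j k :: nat and x
  have h_int: "integrable P (\<lambda>x. h i j k x)" for i j k
    using G1 G2 by (cases "k = i"; cases "k = j") (auto simp: h_def power2_eq_square)
  have h_prod: "(\<Prod>k\<in>?I. h i j k (X k)) = G (X i) * G (X j)" if "i \<in> ?I" "j \<in> ?I" for i j X
    using that by (simp add: h_def prod.distrib)
  have GG_int: "integrable ?PM (\<lambda>X. G (X i) * G (X j))" if "i \<in> ?I" "j \<in> ?I" for i j
    unfolding h_prod[OF that, symmetric] by (rule PP.product_integrable_prod) (use h_int in auto)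
  have GG: "(\<integral>X. G (X i) * G (X j) \<partial>?PM) = (if i = j then (\<integral>x. (G x)\<^sup>2 \<partial>P) else 0)"
    if "i \<in> ?I" "j \<in> ?I" for i j
  proof -
    have "(\<integral>X. G (X i) * G (X j) \<partial>?PM) = (\<Prod>k\<in>?I. \<integral>x. h i j k x \<partial>P)"
      unfolding h_prod[OF that, symmetric] by (rule PP.product_integral_prod) (use h_int in auto)
    also have "\<dots> = (if i = j then (\<integral>x. (G x)\<^sup>2 \<partial>P) else 0)"
    proof (cases "i = j")
      case True
      have "(\<integral>x. h i j k x \<partial>P) = (if k = i then (\<integral>x. (G x)\<^sup>2 \<partial>P) else 1)" for k
        using True by (simp add: h_def power2_eq_square P.prob_space)
      then show ?thesis using True that by simp
    next
      case False
      then have "(\<integral>x. h i j i x \<partial>P) = 0" using G1 by (simp add: h_def)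
      then show ?thesis using False that by (auto intro!: prod_zero)
    qed
    finally show ?thesis .
  qed
  have dev: "((\<Sum>i\<in>?I. F (X i)) / n - (\<integral>x. F x \<partial>P))\<^sup>2 = (\<Sum>i\<in>?I. \<Sum>j\<in>?I. G (X i) * G (X j)) / n\<^sup>2" for X
  proof -
    have "(\<Sum>i\<in>?I. F (X i)) / n - (\<integral>x. F x \<partial>P) = (\<Sum>i\<in>?I. G (X i)) / n"
      using n by (simp add: G_def sum_subtractf field_simps)
    then show ?thesis
      by (simp add: power_divide power2_eq_square sum_product)
  qed
  have int: "integrable ?PM (\<lambda>X. (\<Sum>i\<in>?I. \<Sum>j\<in>?I. G (X i) * G (X j)) / n\<^sup>2)"
    using GG_int by (intro integrable_divide Bochner_Integration.integrable_sum) auto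
  have "(\<integral>\<^sup>+X. ennreal (((\<Sum>i\<in>?I. F (X i)) / n - (\<integral>x. F x \<partial>P))\<^sup>2) \<partial>?PM)
    = ennreal (\<integral>X. (\<Sum>i\<in>?I. \<Sum>j\<in>?I. G (X i) * G (X j)) / n\<^sup>2 \<partial>?PM)"
    unfolding dev by (rule nn_integral_eq_integral[OF int]) (simp only: dev[symmetric], simp)
  also have "(\<integral>X. (\<Sum>i\<in>?I. \<Sum>j\<in>?I. G (X i) * G (X j)) / n\<^sup>2 \<partial>?PM) = (\<integral>x. (G x)\<^sup>2 \<partial>P) / n"
  proof -
    have "(\<integral>X. (\<Sum>i\<in>?I. \<Sum>j\<in>?I. G (X i) * G (X j)) \<partial>?PM)
      = (\<Sum>i\<in>?I. \<integral>X. (\<Sum>j\<in>?I. G (X i) * G (X j)) \<partial>?PM)"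
      by (rule Bochner_Integration.integral_sum) (intro Bochner_Integration.integrable_sum GG_int)
    also have "\<dots> = (\<Sum>i\<in>?I. \<Sum>j\<in>?I. \<integral>X. G (X i) * G (X j) \<partial>?PM)"
      by (intro sum.cong refl Bochner_Integration.integral_sum GG_int)
    also have "\<dots> = (\<Sum>i\<in>?I. \<integral>x. (G x)\<^sup>2 \<partial>P)"
      by (intro sum.cong refl) (simp add: GG sum.delta del: One_nat_def)
    finally show ?thesis
      using n by (simp add: power2_eq_square)
  qed
  also have "ennreal \<dots> \<le> ennreal ((\<integral>x. (F x)\<^sup>2 \<partial>P) / n)"
    using var n by (intro ennreal_leI divide_right_mono) auto
  also have "\<dots> = (\<integral>\<^sup>+x. ennreal ((F x)\<^sup>2) \<partial>P) / ennreal n"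
    using n by (simp add: nn_integral_eq_integral[OF F2] divide_ennreal)
  finally show ?thesis .
qed

section \<open>Integrals of polynomials against the sample density\<close>

lemma power_le_fact_exp:
  assumes "0 \<le> (x::real)"
  shows "x ^ k \<le> fact k * exp x"
proof -
  have "(\<Sum>j\<in>{k}. x ^ j /\<^sub>R fact j) \<le> exp x"
    unfolding exp_def using assms
    by (intro sum_le_suminf summable_exp_generic) (auto simp: divide_inverse)
  then show ?thesis by (simp add: field_simps)
qed

lemma integrable_std_gaussian:
  fixes F :: "real ^ 'l::finite mod_ring \<Rightarrow> real"
  assumes [measurable]: "F \<in> borel_measurable borel" and "\<And>z. \<bar>F z\<bar> \<le> K * exp (c * l1 z)"
  shows "integrable std_gaussian F"
proof (rule Bochner_Integration.integrable_bound)
  show "integrable (std_gaussian :: (real ^ 'l mod_ring) measure) (\<lambda>z. K * exp (c * l1 z))"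
    by (simp add: integrable_exp_l1)
  show "AE z in std_gaussian. norm (F z) \<le> norm (K * exp (c * l1 z))"
    using assms(2) by (intro AE_I2) (simp, meson abs_ge_self order.trans)
qed measurable

lemma l1_triangle: "l1 (x + y) \<le> l1 x + l1 y"
  unfolding l1_def sum.distrib[symmetric] by (intro sum_mono) (simp add: abs_triangle_ineq)

lemma abs_wprod_le_exp: "\<bar>wprod w z\<bar> \<le> fact (length w) * exp (l1 z)"
  using abs_wprod_le power_le_fact_exp[OF l1_nonneg] by (rule order.trans)

lemma integrable_wprod_shift:
  fixes \<mu> :: "real ^ 'l::finite mod_ring"
  shows "integrable std_gaussian (\<lambda>z. wprod w (z + \<mu>))"
proof (rule integrable_std_gaussian)
  fix z :: "real ^ 'l mod_ring"
  have "\<bar>wprod w (z + \<mu>)\<bar> \<le> fact (length w) * exp (l1 (z + \<mu>))"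
    by (rule abs_wprod_le_exp)
  also have "\<dots> \<le> fact (length w) * exp (l1 z + l1 \<mu>)"
    using l1_triangle[of z \<mu>] by simp
  finally show "\<bar>wprod w (z + \<mu>)\<bar> \<le> fact (length w) * exp (l1 \<mu>) * exp (1 * l1 z)"
    by (simp add: exp_add mult_ac)
qed measurable

lemma std_gaussian_shift:
  fixes \<mu> :: "real ^ 'l::finite mod_ring"
  shows "distr std_gaussian borel (\<lambda>z. z + \<mu>)
    = density std_gaussian (\<lambda>z. ennreal (exp (z \<bullet> \<mu> - (norm \<mu>)\<^sup>2 / 2)))"
proof (rule measure_eqI)
  fix A assume "A \<in> sets (distr std_gaussian borel (\<lambda>z. z + \<mu>))"
  then have [measurable]: "A \<in> sets borel" by simp
  have "emeasure (distr std_gaussian borel (\<lambda>z. z + \<mu>)) A = (\<integral>\<^sup>+z. indicator A (z + \<mu>) \<partial>std_gaussian)"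
    by (subst nn_integral_indicator[symmetric]) (auto simp: nn_integral_distr simp del: nn_integral_indicator)
  also have "\<dots> = emeasure (density std_gaussian (\<lambda>z. ennreal (exp (z \<bullet> \<mu> - (norm \<mu>)\<^sup>2 / 2)))) A"
    by (simp add: nn_integral_std_gaussian_shift emeasure_density mult.commute)
  finally show "emeasure (distr std_gaussian borel (\<lambda>z. z + \<mu>)) A
    = emeasure (density std_gaussian (\<lambda>z. ennreal (exp (z \<bullet> \<mu> - (norm \<mu>)\<^sup>2 / 2)))) A" .
qed simp

text \<open>Each summand of \<open>dens u\<close> is the density of a Gaussian centred at a shift of
  \<open>u\<close>. Integrability is assumed at every centre so that the summands can be integrated
  separately.\<close>

lemma integral_dens:
  fixes u :: "real ^ 'l::finite mod_ring" and F :: "real ^ 'l mod_ring \<Rightarrow> real"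
  assumes [measurable]: "F \<in> borel_measurable borel"
    and int: "\<And>\<mu>. integrable std_gaussian (\<lambda>z. F (z + \<mu>))"
  shows "integrable std_gaussian (\<lambda>z. F z * dens u z)"
    and "(\<integral>z. F z * dens u z \<partial>std_gaussian)
      = (\<Sum>l\<in>UNIV. \<integral>z. F (z + cyclic_shift l u) \<partial>std_gaussian) / CARD('l)"
proof -
  let ?e = "\<lambda>\<mu> z. exp (z \<bullet> \<mu> - (norm \<mu>)\<^sup>2 / 2) :: real"
  have i: "integrable std_gaussian (\<lambda>z. F z * ?e \<mu> z)" for \<mu> :: "real ^ 'l mod_ring"
  proof -
    have "integrable (distr std_gaussian borel (\<lambda>z. z + \<mu>)) F"
      using int[of \<mu>] by (simp add: integrable_distr_eq)
    then show ?thesis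
      unfolding std_gaussian_shift by (simp add: integrable_density mult.commute)
  qed
  have e: "(\<integral>z. F z * ?e \<mu> z \<partial>std_gaussian) = (\<integral>z. F (z + \<mu>) \<partial>std_gaussian)" for \<mu> :: "real ^ 'l mod_ring"
  proof -
    have "(\<integral>z. F (z + \<mu>) \<partial>std_gaussian) = (\<integral>z. F z \<partial>distr std_gaussian borel (\<lambda>z. z + \<mu>))"
      by (simp add: integral_distr)
    also have "\<dots> = (\<integral>z. F z * ?e \<mu> z \<partial>std_gaussian)"
      unfolding std_gaussian_shift by (simp add: integral_density mult.commute)
    finally show ?thesis by simp
  qed
  have eq: "F z * dens u z = (\<Sum>l\<in>UNIV. F z * ?e (cyclic_shift l u) z) / CARD('l)" for z
    unfolding dens_eq by (simp add: sum_distrib_left)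
  show "integrable std_gaussian (\<lambda>z. F z * dens u z)"
    unfolding eq by (intro integrable_divide Bochner_Integration.integrable_sum i)
  show "(\<integral>z. F z * dens u z \<partial>std_gaussian)
      = (\<Sum>l\<in>UNIV. \<integral>z. F (z + cyclic_shift l u) \<partial>std_gaussian) / CARD('l)"
    unfolding eq integral_divide_zero by (subst Bochner_Integration.integral_sum) (rule i, simp only: e)
qed

lemmas integral_wprod_dens = integral_dens[OF borel_measurable_wprod integrable_wprod_shift]

text \<open>These stay symbolic constants; their sizes enter through
  \<open>moment_stability\<close>.\<close>

definition gauss_moment :: "'l::finite mod_ring list \<Rightarrow> real" where
  "gauss_moment w = (\<integral>z. wprod w z \<partial>std_gaussian)"

lemma
  fixes i j k :: "'l::finite mod_ring"
  shows integrable_component: "integrable std_gaussian (\<lambda>z. z $ i)"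
    and integrable_component2: "integrable std_gaussian (\<lambda>z. z $ i * z $ j)"
    and integrable_component3: "integrable std_gaussian (\<lambda>z. z $ i * (z $ j * z $ k))"
  using integrable_wprod_shift[of "[i]" 0] integrable_wprod_shift[of "[i, j]" 0]
    integrable_wprod_shift[of "[i, j, k]" 0] by simp_all

text \<open>Here and for orders two and three, the monomial is expanded at \<open>z\<close> plus a
  shift of \<open>u\<close> and then averaged. The result is the moment of the same word plus
  moments of shorter words with Gaussian coefficients, so the relations are triangular.\<close>

lemma dens_moment1:
  fixes u :: "real ^ 'l::finite mod_ring"
  shows "(\<integral>z. wprod [i] z * dens u z \<partial>std_gaussian) = moment [i] u + gauss_moment [i]"
proof -
  interpret prob_space "std_gaussian :: (real ^ 'l mod_ring) measure" by (rule prob_space_std_gaussian)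
  note int = integrable_component
  show ?thesis
    by (subst integral_wprod_dens)
      (simp add: int prob_space[simplified] gauss_moment_def moment_def sum.distrib add_divide_distrib)
qed

lemma dens_moment2:
  fixes u :: "real ^ 'l::finite mod_ring"
  shows "(\<integral>z. wprod [i, j] z * dens u z \<partial>std_gaussian) = moment [i, j] u
    + gauss_moment [i] * moment [j] u + gauss_moment [j] * moment [i] u + gauss_moment [i, j]"
proof -
  interpret prob_space "std_gaussian :: (real ^ 'l mod_ring) measure" by (rule prob_space_std_gaussian)
  note int = integrable_component integrable_component2
  have eq: "wprod [i, j] (z + \<mu>) = z $ i * z $ j + (\<mu> $ j * z $ i + \<mu> $ i * z $ j) + \<mu> $ i * \<mu> $ j"
    for z \<mu> :: "real ^ 'l mod_ring" by (simp add: algebra_simps)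
  show ?thesis
    by (subst integral_wprod_dens, unfold eq)
      (simp add: int prob_space[simplified] gauss_moment_def moment_def sum.distrib add_divide_distrib
        sum_distrib_left sum_distrib_right mult.commute)
qed

lemma dens_moment3:
  fixes u :: "real ^ 'l::finite mod_ring"
  shows "(\<integral>z. wprod [i, j, k] z * dens u z \<partial>std_gaussian) = moment [i, j, k] u
    + (gauss_moment [i] * moment [j, k] u + gauss_moment [j] * moment [i, k] u + gauss_moment [k] * moment [i, j] u)
    + (gauss_moment [i, j] * moment [k] u + gauss_moment [i, k] * moment [j] u + gauss_moment [j, k] * moment [i] u)
    + gauss_moment [i, j, k]"
proof -
  interpret prob_space "std_gaussian :: (real ^ 'l mod_ring) measure" by (rule prob_space_std_gaussian)
  note int = integrable_component integrable_component2 integrable_component3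
  have eq: "wprod [i, j, k] (z + \<mu>) = z $ i * (z $ j * z $ k)
    + ((\<mu> $ j * \<mu> $ k) * z $ i + (\<mu> $ i * \<mu> $ k) * z $ j + (\<mu> $ i * \<mu> $ j) * z $ k)
    + (\<mu> $ k * (z $ i * z $ j) + \<mu> $ j * (z $ i * z $ k) + \<mu> $ i * (z $ j * z $ k))
    + \<mu> $ i * (\<mu> $ j * \<mu> $ k)"
    for z \<mu> :: "real ^ 'l mod_ring" by (simp add: algebra_simps)
  show ?thesis
    by (subst integral_wprod_dens, unfold eq)
      (simp add: int prob_space[simplified] gauss_moment_def moment_def sum.distrib add_divide_distrib
        sum_distrib_left sum_distrib_right mult.commute)
qed

section \<open>Recovering the moments of a signal from those of its density\<close>

definition short_words :: "'a list set" where "short_words = {w. length w \<le> 3}"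

lemma short_words_eq: "short_words = (\<Union>k\<le>3. words k)"
  by (auto simp: short_words_def words_def)

lemma finite_short_words [simp]: "finite (short_words :: 'a::finite list set)"
  by (simp add: short_words_eq)

lemma short_word_cases:
  assumes "w \<in> short_words"
  obtains "w = []" | i where "w = [i]" | i j where "w = [i, j]" | i j k where "w = [i, j, k]"
proof -
  have "length w \<le> 3" using assms by (simp add: short_words_def)
  then have "length w = 0 \<or> length w = Suc 0 \<or> length w = Suc (Suc 0) \<or> length w = Suc (Suc (Suc 0))"
    by linarith
  then show ?thesis using that by (auto simp: length_Suc_conv)
qed

text \<open>With \<open>b\<close> bounding all Gaussian moments of order at most 3, this is the
  error factor of back substitution in the triangular relations, attained at order 3.\<close>

definition moment_stability :: "'l::finite itself \<Rightarrow> real" where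
  "moment_stability _ = (let b = (\<Sum>w\<in>(short_words :: 'l mod_ring list set). \<bar>gauss_moment w\<bar>)
     in 1 + 6 * b + 6 * b\<^sup>2)"

lemma moment_stability_ge_1: "1 \<le> moment_stability TYPE('l::finite)"
  by (simp add: moment_stability_def Let_def sum_nonneg)

text \<open>Back substitution: order one loses nothing, order two picks up two products with order
  one, and order three picks up three products with each lower order, giving
  \<open>H + 3 * (b * (H + 2 * (b * H))) + 3 * (b * H)\<close>.\<close>

lemma moment_diff_le_dens_moment_diff:
  fixes u v :: "real ^ 'l::finite mod_ring"
  assumes H: "\<And>w. w \<in> short_words \<Longrightarrow>
      \<bar>(\<integral>z. wprod w z * dens u z \<partial>std_gaussian) - (\<integral>z. wprod w z * dens v z \<partial>std_gaussian)\<bar> \<le> H"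
    and w: "w \<in> short_words"
  shows "\<bar>moment w u - moment w v\<bar> \<le> moment_stability TYPE('l) * H"
proof -
  define b where "b = (\<Sum>w\<in>(short_words :: 'l mod_ring list set). \<bar>gauss_moment w\<bar>)"
  have b0: "0 \<le> b" by (simp add: b_def sum_nonneg)
  have g: "\<bar>gauss_moment w\<bar> \<le> b" if "w \<in> short_words" for w :: "'l mod_ring list"
    unfolding b_def by (rule member_le_sum) (use that in auto)
  have H0: "0 \<le> H" using H[OF w] by linarith
  define d where "d w = moment w u - moment w v" for w
  have d1: "\<bar>d [i]\<bar> \<le> H" for i
    using H[of "[i]"] by (simp only: dens_moment1) (simp add: d_def short_words_def)
  have gd1: "\<bar>gauss_moment w * d [i]\<bar> \<le> b * H" if "w \<in> short_words" for w :: "'l mod_ring list" and i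
    unfolding abs_mult using g[OF that] d1[of i] b0 by (intro mult_mono) auto
  have d2: "\<bar>d [i, j]\<bar> \<le> H + 2 * (b * H)" for i j
  proof -
    have "\<bar>d [i, j] + gauss_moment [i] * d [j] + gauss_moment [j] * d [i]\<bar> \<le> H"
      using H[of "[i, j]"] by (simp only: dens_moment2) (simp add: d_def short_words_def algebra_simps)
    then show ?thesis
      using gd1[of "[i]" j] gd1[of "[j]" i] by (simp add: short_words_def)
  qed
  have gd2: "\<bar>gauss_moment [k] * d [i, j]\<bar> \<le> b * (H + 2 * (b * H))" for i j k :: "'l mod_ring"
    unfolding abs_mult using g[of "[k]"] d2[of i j] b0 by (intro mult_mono) (auto simp: short_words_def)
  have d3: "\<bar>d [i, j, k]\<bar> \<le> H + 3 * (b * (H + 2 * (b * H))) + 3 * (b * H)" for i j k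
  proof -
    have "\<bar>d [i, j, k] + (gauss_moment [i] * d [j, k] + gauss_moment [j] * d [i, k] + gauss_moment [k] * d [i, j])
      + (gauss_moment [i, j] * d [k] + gauss_moment [i, k] * d [j] + gauss_moment [j, k] * d [i])\<bar> \<le> H"
      using H[of "[i, j, k]"]
      by (simp only: dens_moment3) (simp add: d_def short_words_def algebra_simps)
    moreover have "\<bar>x + y + z\<bar> \<le> 3 * c" if "\<bar>x\<bar> \<le> c" "\<bar>y\<bar> \<le> c" "\<bar>z\<bar> \<le> c" for x y z c :: real
      using that by linarith
    from this[OF gd2 gd2 gd2, of i j k j i k k i j]
      this[OF gd1 gd1 gd1, of "[i, j]" "[i, k]" "[j, k]" k j i]
    have "\<bar>gauss_moment [i] * d [j, k] + gauss_moment [j] * d [i, k] + gauss_moment [k] * d [i, j]\<bar>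
        \<le> 3 * (b * (H + 2 * (b * H)))"
      "\<bar>gauss_moment [i, j] * d [k] + gauss_moment [i, k] * d [j] + gauss_moment [j, k] * d [i]\<bar> \<le> 3 * (b * H)"
      by (simp_all add: short_words_def)
    ultimately show ?thesis by linarith
  qed
  have eq: "moment_stability TYPE('l) * H = H + 6 * (b * H) + 6 * (b * (b * H))"
    by (simp add: moment_stability_def Let_def b_def[symmetric] algebra_simps power2_eq_square)
  have "0 \<le> b * H" "0 \<le> b * (b * H)" using b0 H0 by simp_all
  with w show ?thesis
  proof (cases w rule: short_word_cases)
    case 1
    then show ?thesis
      using H0 b0 by (simp add: moment_def moment_stability_def Let_def sum_nonneg)
  next
    case (2 i)
    then show ?thesis using d1[of i] \<open>0 \<le> b * H\<close> \<open>0 \<le> b * (b * H)\<close> by (simp add: eq d_def)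
  next
    case (3 i j)
    then show ?thesis using d2[of i j] \<open>0 \<le> b * H\<close> \<open>0 \<le> b * (b * H)\<close> by (simp add: eq d_def)
  next
    case (4 i j k)
    then show ?thesis using d3[of i j k] unfolding eq by (simp add: d_def algebra_simps)
  qed
qed

section \<open>A cubic bound on the logarithm and pointwise bounds on the density\<close>

lemma ln_1_plus_le_cubic:
  assumes "-1 < (x::real)"
  shows "ln (1 + x) \<le> x - x\<^sup>2 / 2 + x ^ 3 / 3"
proof -
  define f where "f t = t - t\<^sup>2 / 2 + t ^ 3 / 3 - ln (1 + t)" for t :: real
  \<comment> \<open>The derivative has the sign of \<open>t\<close>, so \<open>f\<close> is minimal
    at 0, where it vanishes.\<close>
  have d: "(f has_real_derivative (t ^ 3 / (1 + t))) (at t)" if "-1 < t" for t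
    unfolding f_def using that
    by (auto intro!: derivative_eq_intros simp: field_simps power2_eq_square power3_eq_cube)
  have "f 0 \<le> f x"
  proof (cases "0 \<le> x")
    case True
    show ?thesis
    proof (rule DERIV_nonneg_imp_nondecreasing[OF True])
      fix t :: real assume "0 \<le> t" "t \<le> x"
      then show "\<exists>y. (f has_real_derivative y) (at t) \<and> 0 \<le> y"
        by (intro exI[of _ "t ^ 3 / (1 + t)"] conjI d) auto
    qed
  next
    case False
    show ?thesis
    proof (rule DERIV_nonpos_imp_nonincreasing[where f = f])
      fix t assume t: "x \<le> t" "t \<le> 0"
      then have "t ^ 3 \<le> 0" by (simp add: power_le_zero_eq)
      then have "t ^ 3 / (1 + t) \<le> 0" using t assms by (intro divide_nonpos_pos) auto
      then show "\<exists>y. (f has_real_derivative y) (at t) \<and> y \<le> 0"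
        using d[of t] t assms by auto
    qed (use False in simp)
  qed
  then show ?thesis by (simp add: f_def)
qed

text \<open>If \<open>l1 u \<le> 1\<close>, all entries of \<open>u\<close> are at most 1 in
  absolute value, so every exponent lies between \<open>- l1 z\<close> and \<open>l1 z\<close>; the
  normalising factor lies between \<open>exp (- 1)\<close> and 1.\<close>

lemma
  fixes u :: "real ^ 'l::finite mod_ring"
  assumes "l1 u \<le> 1"
  shows shift_mgf_ge: "exp (- l1 z) \<le> shift_mgf u z"
    and shift_mgf_le: "shift_mgf u z \<le> exp (l1 z)"
    and dens_ge: "exp (- l1 z - 1) \<le> dens u z"
    and dens_le: "dens u z \<le> exp (l1 z)"
proof -
  have "\<bar>z \<bullet> cyclic_shift l u\<bar> \<le> l1 z" for l
    using abs_inner_le_l1[of "cyclic_shift l u" 1 z] component_le_l1[of u] assms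
    by (metis cyclic_shift_nth mult_1 order.trans)
  then have b: "- l1 z \<le> z \<bullet> cyclic_shift l u" "z \<bullet> cyclic_shift l u \<le> l1 z" for l
    by (auto simp: abs_le_iff minus_le_iff)
  have "(\<Sum>l\<in>(UNIV::'l mod_ring set). exp (- l1 z)) \<le> (\<Sum>l\<in>UNIV. exp (z \<bullet> cyclic_shift l u))"
    using b by (intro sum_mono) simp
  then show 1: "exp (- l1 z) \<le> shift_mgf u z"
    by (simp add: shift_mgf_def field_simps)
  have "(\<Sum>l\<in>UNIV. exp (z \<bullet> cyclic_shift l u)) \<le> (\<Sum>l\<in>(UNIV::'l mod_ring set). exp (l1 z))"
    using b by (intro sum_mono) simp
  then show 2: "shift_mgf u z \<le> exp (l1 z)"
    by (simp add: shift_mgf_def field_simps)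
  have "(norm u)\<^sup>2 \<le> 1"
    using norm_le_l1[of u] assms by (simp add: power_le_one)
  then have "exp (- 1) \<le> exp (- (norm u)\<^sup>2 / 2)" "exp (- (norm u)\<^sup>2 / 2) \<le> 1" by auto
  then have "exp (- 1) * exp (- l1 z) \<le> dens u z" "dens u z \<le> 1 * exp (l1 z)"
    unfolding dens_def using 1 2 shift_mgf_pos[of u z] by (intro mult_mono; simp)+
  then show "exp (- l1 z - 1) \<le> dens u z" "dens u z \<le> exp (l1 z)"
    by (simp_all flip: exp_add) (simp only: diff_conv_add_uminus add.commute)
qed

lemma one_div_dens_le:
  assumes "l1 v \<le> 1"
  shows "1 / dens v z \<le> 3 * exp (l1 z)"
proof -
  have "exp (- l1 z) * (1 / 3) \<le> exp (- l1 z) * exp (- 1)"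
    using exp_le by (intro mult_left_mono) (auto simp: exp_minus field_simps)
  then have "exp (- l1 z) / 3 \<le> dens v z"
    using dens_ge[OF assms, of z] by (simp flip: exp_add)
  then show ?thesis using dens_pos[of v z] by (simp add: exp_minus field_simps)
qed

subsection \<open>Deviations of the likelihood ratio\<close>

definition deviation :: "(nat \<Rightarrow> 'a) \<Rightarrow> nat \<Rightarrow> 'a measure \<Rightarrow> ('a \<Rightarrow> real) \<Rightarrow> real" where
  "deviation Z n Q F = (\<Sum>i=1..n. F (Z i)) / n - (\<integral>x. F x \<partial>Q)"

lemma deviation_add:
  "integrable Q F \<Longrightarrow> integrable Q G \<Longrightarrow>
    deviation Z n Q (\<lambda>x. F x + G x) = deviation Z n Q F + deviation Z n Q G"
  by (simp add: deviation_def sum.distrib add_divide_distrib)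

lemma deviation_cmult: "deviation Z n Q (\<lambda>x. c * F x) = c * deviation Z n Q F"
  by (simp add: deviation_def sum_distrib_left[symmetric] right_diff_distrib)

lemma deviation_sum:
  "(\<And>i. i \<in> I \<Longrightarrow> integrable Q (F i)) \<Longrightarrow>
    deviation Z n Q (\<lambda>x. \<Sum>i\<in>I. F i x) = (\<Sum>i\<in>I. deviation Z n Q (F i))"
  unfolding deviation_def
  by (subst Bochner_Integration.integral_sum, assumption, subst sum.swap)
    (simp add: sum_subtractf sum_divide_distrib)

text \<open>The law of an observation divided by \<sigma> when the signal is
  \<open>\<sigma> *\<^sub>R v\<close>; see \<open>mra_law_tilt\<close>.\<close>

definition tilt :: "real ^ 'l::finite mod_ring \<Rightarrow> (real ^ 'l mod_ring) measure" where
  "tilt v = density std_gaussian (\<lambda>z. ennreal (dens v z))"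

lemma sets_tilt [simp, measurable_cong]: "sets (tilt v) = sets borel"
  by (simp add: tilt_def)

lemma integrable_tilt_iff:
  fixes F :: "real ^ 'l::finite mod_ring \<Rightarrow> real"
  shows "F \<in> borel_measurable borel \<Longrightarrow>
    integrable (tilt v) F \<longleftrightarrow> integrable std_gaussian (\<lambda>z. F z * dens v z)"
  unfolding tilt_def by (subst integrable_density) (auto simp: mult.commute less_imp_le[OF dens_pos])

lemma integral_tilt:
  fixes F :: "real ^ 'l::finite mod_ring \<Rightarrow> real"
  shows "F \<in> borel_measurable borel \<Longrightarrow> (\<integral>z. F z \<partial>tilt v) = (\<integral>z. F z * dens v z \<partial>std_gaussian)"
  unfolding tilt_def by (subst integral_density) (auto simp: mult.commute less_imp_le[OF dens_pos])

lemma integrable_tilt: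
  fixes F :: "real ^ 'l::finite mod_ring \<Rightarrow> real"
  assumes [measurable]: "F \<in> borel_measurable borel" and "l1 v \<le> 1" and F: "\<And>z. \<bar>F z\<bar> \<le> K * exp (c * l1 z)"
  shows "integrable (tilt v) F"
proof -
  have "integrable std_gaussian (\<lambda>z. F z * dens v z)"
  proof (rule integrable_std_gaussian)
    fix z
    have "\<bar>F z * dens v z\<bar> \<le> (K * exp (c * l1 z)) * exp (l1 z)"
      unfolding abs_mult using dens_le[OF assms(2), of z] dens_pos[of v z] F[of z]
      by (intro mult_mono) auto
    then show "\<bar>F z * dens v z\<bar> \<le> K * exp ((c + 1) * l1 z)"
      by (simp add: exp_add distrib_right)
  qed measurable
  then show ?thesis by (simp add: integrable_tilt_iff)
qed

section \<open>Exponential moments and the radius of convergence of the word expansion\<close>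

definition exp_moment :: "'l::finite itself \<Rightarrow> real \<Rightarrow> real" where
  "exp_moment _ c = (\<integral>z. exp (c * l1 z) \<partial>(std_gaussian :: (real ^ 'l mod_ring) measure))"

lemma exp_moment_nonneg: "0 \<le> exp_moment TYPE('l::finite) c"
  by (simp add: exp_moment_def)

lemma integral_std_gaussian_le:
  fixes F :: "real ^ 'l::finite mod_ring \<Rightarrow> real"
  assumes [measurable]: "F \<in> borel_measurable borel" and F: "\<And>z. \<bar>F z\<bar> \<le> K * exp (c * l1 z)"
  shows "\<bar>\<integral>z. F z \<partial>std_gaussian\<bar> \<le> K * exp_moment TYPE('l) c"
proof -
  have "\<bar>\<integral>z. F z \<partial>std_gaussian\<bar> \<le> (\<integral>z. \<bar>F z\<bar> \<partial>std_gaussian)"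
    using integral_norm_bound[of std_gaussian F] by simp
  also have "\<dots> \<le> (\<integral>z. K * exp (c * l1 z) \<partial>(std_gaussian :: (real ^ 'l mod_ring) measure))"
    using integrable_std_gaussian[OF assms] integrable_exp_l1[of c] F
    by (intro integral_mono) auto
  finally show ?thesis by (simp add: exp_moment_def)
qed

text \<open>The radius of convergence is chosen so that the word sums below are dominated by
  \<open>\<Sum>k. k / 2 ^ k = 2\<close> when the deviations grow like \<open>fact k * (4 * L) ^ k\<close>.\<close>
definition radius :: "'l::finite itself \<Rightarrow> real" where
  "radius _ = 1 / (8 * (real CARD('l))\<^sup>2)"

lemma radius_bounds: "0 < radius TYPE('l::finite)" "radius TYPE('l) \<le> 1 / 8"
proof -
  have "1 \<le> real CARD('l)" using zero_less_card_finite[where 'a='l] by linarith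
  then show "0 < radius TYPE('l)" "radius TYPE('l) \<le> 1 / 8"
    by (simp_all add: radius_def field_simps)
qed

lemma sums_k_half_power: "(\<lambda>k. real k * (1 / 2) ^ k) sums 2"
proof -
  have "(\<lambda>n. real (Suc n) * (1 / 2) ^ n) sums (1 / (1 - 1 / 2)\<^sup>2)"
    using geometric_deriv_sums[of "1 / 2 :: real"] by simp
  from sums_mult[OF this, of "1 / 2"] have "(\<lambda>n. real (Suc n) * (1 / 2) ^ Suc n) sums 2"
    by (simp add: power2_eq_square)
  from sums_Suc[OF this] show ?thesis by simp
qed

lemma k_radius_le: "real k * radius TYPE('l::finite) ^ k \<le> 1"
proof -
  have "real k \<le> 2 ^ k" by (rule less_imp_le[OF of_nat_less_two_power])
  then have "real k * radius TYPE('l) ^ k \<le> 2 ^ k * (1 / 8) ^ k"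
    using radius_bounds[where 'l='l] by (intro mult_mono power_mono) auto
  also have "\<dots> \<le> 1" by (simp add: power_mult_distrib[symmetric] power_le_one)
  finally show ?thesis .
qed

lemma exp_sums: "(\<lambda>k. x ^ k / fact k) sums exp (x::real)"
  using exp_converges[of x] by (simp add: divide_inverse mult.commute)

text \<open>Both signals are already divided by \<sigma>, and \<open>T\<close> is their distance in
  terms of moments. The hypothesis \<open>moment_diff\<close> extends the control by
  \<open>T\<close> to words of every length with geometric decay; its factor \<open>length w\<close>
  is the one from \<open>wprod_diff_le\<close>. The hypothesis \<open>moment2_diff\<close> controls
  the norms. \<open>close_pair_moment_gap\<close> supplies all of this for signals of the
  class.\<close>

locale close_pair =
  fixes u v :: "real ^ 'l::finite mod_ring" and K T :: real
  assumes l1_u: "l1 u \<le> 1" and l1_v: "l1 v \<le> 1" and K: "1 \<le> K" and T: "0 \<le> T"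
    and moment_diff: "\<And>w. \<bar>moment w u - moment w v\<bar> \<le> K * length w * radius TYPE('l) ^ length w * T"
    and moment2_diff: "\<And>i. \<bar>moment [i, i] u - moment [i, i] v\<bar> \<le> T"
begin

definition layer :: "nat \<Rightarrow> real ^ 'l mod_ring \<Rightarrow> real" where
  "layer k z = (\<Sum>w\<in>words k. wprod w z * (moment w u - moment w v)) / fact k"

lemma layer_sums: "(\<lambda>k. layer k z) sums (shift_mgf u z - shift_mgf v z)"
proof -
  have "layer k z = (\<Sum>w\<in>words k. wprod w z * moment w u) / fact k - (\<Sum>w\<in>words k. wprod w z * moment w v) / fact k" for k
    by (simp add: layer_def right_diff_distrib sum_subtractf diff_divide_distrib)
  then show ?thesis
    using sums_diff[OF shift_mgf_sums[of z u] shift_mgf_sums[of z v]] by simp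
qed

lemma abs_layer_le: "\<bar>layer k z\<bar> \<le> T * K * (k * radius TYPE('l) ^ k) * (l1 z ^ k / fact k)"
proof -
  have "\<bar>\<Sum>w\<in>words k. wprod w z * (moment w u - moment w v)\<bar>
    \<le> (\<Sum>w\<in>words k. \<bar>wprod w z\<bar> * (K * k * radius TYPE('l) ^ k * T))"
  proof (rule order.trans[OF sum_abs], rule sum_mono)
    fix w :: "'l mod_ring list" assume "w \<in> words k"
    then show "\<bar>wprod w z * (moment w u - moment w v)\<bar> \<le> \<bar>wprod w z\<bar> * (K * k * radius TYPE('l) ^ k * T)"
      using moment_diff[of w] by (auto simp: abs_mult words_def intro: mult_left_mono)
  qed
  then have "\<bar>\<Sum>w\<in>words k. wprod w z * (moment w u - moment w v)\<bar> / fact k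
    \<le> l1 z ^ k * (K * k * radius TYPE('l) ^ k * T) / fact k"
    by (intro divide_right_mono) (auto simp: l1_power sum_distrib_right)
  then show ?thesis by (simp add: layer_def mult_ac)
qed

lemma abs_layer_le': "\<bar>layer k z\<bar> \<le> T * K * (l1 z ^ k / fact k)"
proof (rule order.trans[OF abs_layer_le])
  have "T * K * (real k * radius TYPE('l) ^ k) \<le> T * K * 1"
    using T K by (intro mult_left_mono k_radius_le) auto
  then show "T * K * (k * radius TYPE('l) ^ k) * (l1 z ^ k / fact k) \<le> T * K * (l1 z ^ k / fact k)"
    by (intro mult_right_mono) auto
qed

lemma summable_layer: "summable (\<lambda>k. \<bar>layer k z\<bar>)"
proof (rule summable_comparison_test')
  show "summable (\<lambda>k. T * K * (l1 z ^ k / fact k))"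
    using exp_sums by (intro summable_mult) (rule sums_summable)
qed (use abs_layer_le' in simp)

lemma abs_shift_mgf_diff_le: "\<bar>shift_mgf u z - shift_mgf v z\<bar> \<le> T * K * exp (l1 z)"
proof -
  have "\<bar>shift_mgf u z - shift_mgf v z\<bar> = \<bar>\<Sum>k. layer k z\<bar>"
    using layer_sums[of z] by (simp add: sums_iff)
  also have "\<dots> \<le> (\<Sum>k. \<bar>layer k z\<bar>)"
    by (rule summable_rabs[OF summable_layer])
  also have "\<dots> \<le> T * K * exp (l1 z)"
  proof (rule sums_le[OF _ summable_sums[OF summable_layer]])
    show "(\<lambda>k. T * K * (l1 z ^ k / fact k)) sums (T * K * exp (l1 z))"
      by (intro sums_mult exp_sums)
  qed (rule abs_layer_le')
  finally show ?thesis .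
qed

definition ratio :: real where "ratio = exp (- (norm u)\<^sup>2 / 2) / exp (- (norm v)\<^sup>2 / 2)"

text \<open>The squared norm is L times the moment of \<open>[0, 0]\<close>, so the ratio is
  \<open>exp t\<close> with \<open>t\<close> of order \<open>T\<close>. Norms at most 1 give
  \<open>\<bar>t\<bar> \<le> 1 / 2\<close>, the range where \<open>exp\<close> admits the linear
  bound used.\<close>

lemma abs_ratio_le: "\<bar>ratio - 1\<bar> \<le> real CARD('l) * T"
proof -
  have n: "(norm x)\<^sup>2 = real CARD('l) * moment [0, 0] x" for x :: "real ^ 'l mod_ring"
    unfolding power2_norm_eq_inner by (simp add: moment_def inner_vec_def)
  define t where "t = ((norm v)\<^sup>2 - (norm u)\<^sup>2) / 2"
  have "\<bar>t\<bar> = real CARD('l) * \<bar>moment [0, 0] u - moment [0, 0] v\<bar> / 2"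
    unfolding t_def n by (simp add: abs_minus_commute flip: right_diff_distrib) (simp add: abs_mult)
  also have "\<dots> \<le> real CARD('l) * T / 2"
    using moment2_diff[of 0] by (intro divide_right_mono mult_left_mono) auto
  finally have t: "2 * \<bar>t\<bar> \<le> real CARD('l) * T" by simp
  have "(norm u)\<^sup>2 \<le> 1" "(norm v)\<^sup>2 \<le> 1"
    using norm_le_l1[of u] l1_u norm_le_l1[of v] l1_v by (simp_all add: power_le_one)
  moreover have "\<bar>(y - x) / 2\<bar> \<le> 1 / 2" if "0 \<le> x" "x \<le> 1" "0 \<le> y" "y \<le> 1" for x y :: real
    using that by auto
  ultimately have "\<bar>t\<bar> \<le> 1 / 2" by (simp add: t_def)
  then have "exp t \<le> 1 + 2 * \<bar>t\<bar>" using exp_bound_lemma[of t] by simp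
  then have "\<bar>exp t - 1\<bar> \<le> 2 * \<bar>t\<bar>" using exp_ge_add_one_self[of t] by linarith
  moreover have "ratio = exp t"
    by (simp add: ratio_def t_def exp_diff[symmetric] diff_divide_distrib)
  ultimately show ?thesis using t by simp
qed

text \<open>The centred likelihood ratio: its mean under \<open>tilt v\<close> is zero.\<close>

definition score :: "real ^ 'l mod_ring \<Rightarrow> real" where
  "score z = dens u z / dens v z - 1"

text \<open>Separates the difference of generating functions, which expands into words, from the
  change of normalisation, which is a constant of order \<open>T\<close>.\<close>

lemma score_eq:
  "score z = exp (- (norm u)\<^sup>2 / 2) * ((shift_mgf u z - shift_mgf v z) / dens v z) + (ratio - 1)"
  unfolding score_def ratio_def dens_def using shift_mgf_pos[of v z]
  by (simp add: field_simps)

lemma borel_measurable_score [measurable]: "score \<in> borel_measurable borel"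
  unfolding score_def by measurable

text \<open>One factor \<open>exp (l1 z)\<close> bounds the difference of generating functions, the
  other bounds \<open>1 / dens v z\<close>.\<close>

lemma abs_score_le: "\<bar>score z\<bar> \<le> T * (3 * K + real CARD('l)) * exp (2 * l1 z)"
proof -
  note inv = one_div_dens_le[OF l1_v, of z]
  have "\<bar>exp (- (norm u)\<^sup>2 / 2) * ((shift_mgf u z - shift_mgf v z) / dens v z)\<bar>
    = exp (- (norm u)\<^sup>2 / 2) * (\<bar>shift_mgf u z - shift_mgf v z\<bar> * (1 / dens v z))"
    using dens_pos[of v z] by (simp add: abs_mult)
  also have "\<dots> \<le> 1 * ((T * K * exp (l1 z)) * (3 * exp (l1 z)))"
    using abs_shift_mgf_diff_le[of z] inv T K dens_pos[of v z] by (intro mult_mono) auto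
  finally have 1: "\<bar>exp (- (norm u)\<^sup>2 / 2) * ((shift_mgf u z - shift_mgf v z) / dens v z)\<bar>
      \<le> T * (3 * K) * exp (2 * l1 z)"
    by (simp add: mult_ac flip: exp_add)
  have "real CARD('l) * T * 1 \<le> real CARD('l) * T * exp (2 * l1 z)"
    using T by (intro mult_left_mono) auto
  then have 2: "\<bar>ratio - 1\<bar> \<le> T * real CARD('l) * exp (2 * l1 z)"
    using abs_ratio_le by (simp add: mult_ac)
  show ?thesis
    unfolding score_eq using order.trans[OF abs_triangle_ineq add_mono[OF 1 2]]
    by (simp add: algebra_simps)
qed

end

section \<open>Deviations uniform in the competing signal, and the likelihood inequality\<close>

lemma exp_double: "exp (2 * x) = (exp x)\<^sup>2" for x :: real
  by (simp add: power2_eq_square flip: exp_add)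

lemma fact_short_word_le: "w \<in> short_words \<Longrightarrow> fact (length w) \<le> (6::real)"
  by (erule short_word_cases) (simp_all add: fact_numeral)

lemma abs_wprod_short_le: "w \<in> short_words \<Longrightarrow> \<bar>wprod w z\<bar> \<le> 6 * exp (l1 z)"
  by (rule order.trans[OF abs_wprod_le_exp mult_right_mono[OF fact_short_word_le]]) auto

text \<open>A deterministic description of a sample: the averaged functions involve \<open>v\<close>
  and words but not \<open>u\<close>, so a single \<open>N\<close> serves every competitor. The
  weight \<open>fact (length w) * (4 * L) ^ length w\<close> allows for the growth of the variance
  with the degree, yet stays summable against the coefficients of the exponential series.\<close>

locale good_sample = close_pair u v K T for u v :: "real ^ 'l::finite mod_ring" and K T :: real +
  fixes Z :: "nat \<Rightarrow> real ^ 'l mod_ring" and n :: nat and N :: real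
  assumes n: "0 < n" and N: "0 \<le> N"
    and word_dev: "\<And>w w'. w' \<in> short_words \<Longrightarrow>
      \<bar>deviation Z n (tilt v) (\<lambda>z. wprod w z * wprod w' z / dens v z)\<bar> \<le> N * fact (length w) * (4 * real CARD('l)) ^ length w"
    and short_dev: "\<And>w'. w' \<in> short_words \<Longrightarrow> \<bar>deviation Z n (tilt v) (wprod w')\<bar> \<le> N"
    and exp_dev: "\<bar>deviation Z n (tilt v) (\<lambda>z. exp (6 * l1 z))\<bar> \<le> N"
begin

abbreviation "dev \<equiv> deviation Z n (tilt v)"

lemma dens_nz [simp]: "dens x z \<noteq> 0"
  using dens_pos[of x z] by simp

lemma borel_measurable_layer [measurable]: "layer k \<in> borel_measurable borel"
  unfolding layer_def by measurable

lemma integrable_wprod2: "integrable std_gaussian (\<lambda>z. wprod w z * wprod w' z :: real)"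
  using integrable_wprod_shift[of "w @ w'" 0] by (simp add: wprod_append)

lemma integrable_wprod2_tilt: "integrable (tilt v) (\<lambda>z. wprod w z * wprod w' z / dens v z)"
  by (simp add: integrable_tilt_iff integrable_wprod2)

lemma integrable_wprod_tilt: "integrable (tilt v) (wprod w)"
  by (rule integrable_tilt[OF _ l1_v, where K = "fact (length w)" and c = 1])
    (use abs_wprod_le_exp in auto)

lemma abs_layer_wprod_le:
  assumes "w' \<in> short_words"
  shows "\<bar>layer k z * wprod w' z\<bar> \<le> (6 * T * K * (k * (1 / 2) ^ k)) * exp (2 * l1 z)"
proof -
  have r: "k * radius TYPE('l) ^ k \<le> k * (1 / 2) ^ k"
    using radius_bounds[where 'l='l] by (intro mult_left_mono power_mono) auto
  have "\<bar>layer k z\<bar> \<le> T * K * (k * radius TYPE('l) ^ k) * (l1 z ^ k / fact k)"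
    by (rule abs_layer_le)
  also have "\<dots> \<le> T * K * (k * (1 / 2) ^ k) * exp (l1 z)"
  proof (rule mult_mono)
    show "T * K * (k * radius TYPE('l) ^ k) \<le> T * K * (k * (1 / 2) ^ k)"
      by (rule mult_left_mono[OF r]) (use T K in auto)
    show "l1 z ^ k / fact k \<le> exp (l1 z)"
      using power_le_fact_exp[of "l1 z" k] by (simp add: field_simps)
  qed (use T K in auto)
  finally have "\<bar>layer k z\<bar> \<le> T * K * (k * (1 / 2) ^ k) * exp (l1 z)" .
  then have "\<bar>layer k z * wprod w' z\<bar> \<le> (T * K * (k * (1 / 2) ^ k) * exp (l1 z)) * (6 * exp (l1 z))"
    unfolding abs_mult using abs_wprod_short_le[OF assms, of z] T K by (intro mult_mono) auto
  then show ?thesis unfolding exp_double by (simp add: power2_eq_square mult_ac)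
qed

text \<open>Termwise integration is justified by domination: the integrals of the absolute layers
  are at most a multiple of \<open>k / 2 ^ k\<close>.\<close>

lemma layer_integral_sums:
  assumes w': "w' \<in> short_words"
  shows "(\<lambda>k. \<integral>z. layer k z * wprod w' z \<partial>std_gaussian)
    sums (\<integral>z. (shift_mgf u z - shift_mgf v z) * wprod w' z \<partial>std_gaussian)"
proof -
  have int: "integrable std_gaussian (\<lambda>z. layer k z * wprod w' z)" for k
    by (rule integrable_std_gaussian[OF _ abs_layer_wprod_le[OF w']]) measurable
  have "(\<lambda>k. \<integral>z. layer k z * wprod w' z \<partial>std_gaussian) sums (\<integral>z. (\<Sum>k. layer k z * wprod w' z) \<partial>std_gaussian)"
  proof (rule sums_integral[OF int])
    show "AE z in std_gaussian. summable (\<lambda>k. norm (layer k z * wprod w' z))"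
      unfolding real_norm_def abs_mult by (intro AE_I2 summable_mult2 summable_layer)
    show "summable (\<lambda>k. \<integral>z. norm (layer k z * wprod w' z) \<partial>std_gaussian)"
    proof (rule summable_comparison_test')
      show "summable (\<lambda>k. 6 * T * K * (k * (1 / 2) ^ k) * exp_moment TYPE('l) 2)"
        using sums_k_half_power by (intro summable_mult summable_mult2) (rule sums_summable)
      fix k
      have "\<bar>\<integral>z. \<bar>layer k z * wprod w' z\<bar> \<partial>std_gaussian\<bar> \<le> 6 * T * K * (k * (1 / 2) ^ k) * exp_moment TYPE('l) 2"
        by (rule integral_std_gaussian_le) (use abs_layer_wprod_le[OF w'] in auto)
      then show "norm (\<integral>z. norm (layer k z * wprod w' z) \<partial>std_gaussian)
        \<le> 6 * T * K * (k * (1 / 2) ^ k) * exp_moment TYPE('l) 2"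
        by simp
    qed
  qed
  moreover have "(\<Sum>k. layer k z * wprod w' z) = (shift_mgf u z - shift_mgf v z) * wprod w' z" for z
    using sums_mult2[OF layer_sums[of z], of "wprod w' z"] by (simp add: sums_iff)
  ultimately show ?thesis by simp
qed

text \<open>Dividing by \<open>dens v\<close> cancels the density of \<open>tilt v\<close>, so the
  expectations become Gaussian integrals of layers, while the empirical part is a finite sum of
  convergent series.\<close>

lemma layer_dev_sums:
  assumes w': "w' \<in> short_words"
  shows "(\<lambda>k. dev (\<lambda>z. layer k z * wprod w' z / dens v z))
    sums dev (\<lambda>z. (shift_mgf u z - shift_mgf v z) * wprod w' z / dens v z)"
proof -
  have [measurable]: "shift_mgf x \<in> borel_measurable borel" for x :: "real ^ 'l mod_ring"
    unfolding shift_mgf_def by measurable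
  have "(\<lambda>k. \<Sum>i=1..n. layer k (Z i) * wprod w' (Z i) / dens v (Z i))
    sums (\<Sum>i=1..n. (shift_mgf u (Z i) - shift_mgf v (Z i)) * wprod w' (Z i) / dens v (Z i))"
    by (intro sums_sum sums_divide sums_mult2 layer_sums)
  then show ?thesis
    unfolding deviation_def using layer_integral_sums[OF w']
    by (intro sums_diff sums_divide) (auto simp: integral_tilt)
qed

lemma abs_layer_dev_le:
  assumes w': "w' \<in> short_words"
  shows "\<bar>dev (\<lambda>z. layer k z * wprod w' z / dens v z)\<bar> \<le> T * K * N * (k * (1 / 2) ^ k)"
proof -
  let ?D = "\<lambda>w. dev (\<lambda>z. wprod w z * wprod w' z / dens v z)"
  let ?r = "radius TYPE('l)"
  have "dev (\<lambda>z. layer k z * wprod w' z / dens v z)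
    = dev (\<lambda>z. \<Sum>w\<in>words k. (moment w u - moment w v) / fact k * (wprod w z * wprod w' z / dens v z))"
    unfolding layer_def sum_divide_distrib sum_distrib_right
    by (intro arg_cong[of _ _ dev] ext sum.cong) simp_all
  also have "\<dots> = (\<Sum>w\<in>words k. (moment w u - moment w v) / fact k * ?D w)"
    by (subst deviation_sum) (auto simp only: deviation_cmult intro!: integrable_mult_right integrable_wprod2_tilt)
  also have "\<bar>\<dots>\<bar> \<le> (\<Sum>w\<in>(words k :: 'l mod_ring list set). K * k * ?r ^ k * T / fact k * (N * fact k * (4 * real CARD('l)) ^ k))"
  proof (rule order.trans[OF sum_abs], rule sum_mono)
    fix w :: "'l mod_ring list" assume w: "w \<in> words k"
    have "\<bar>moment w u - moment w v\<bar> / fact k \<le> K * k * ?r ^ k * T / fact k"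
      using moment_diff[of w] w by (intro divide_right_mono) (auto simp: words_def)
    moreover have "\<bar>?D w\<bar> \<le> N * fact k * (4 * real CARD('l)) ^ k"
      using word_dev[OF w', of w] w by (auto simp: words_def)
    moreover have "0 \<le> K * k * ?r ^ k * T / fact k"
      using K T radius_bounds[where 'l='l] by simp
    ultimately show "\<bar>(moment w u - moment w v) / fact k * ?D w\<bar>
      \<le> K * k * ?r ^ k * T / fact k * (N * fact k * (4 * real CARD('l)) ^ k)"
      unfolding abs_mult abs_divide by (intro mult_mono) auto
  qed
  also have "\<dots> = T * K * N * (k * (real CARD('l) * ?r * (4 * real CARD('l))) ^ k)"
    by (simp add: card_words power_mult_distrib mult_ac)
  \<comment> \<open>The three factors come from the number of words of length k, the decay of the
    moment differences and the growth allowed to the deviations. The radius was chosen to make their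
    product 1/2.\<close>
  also have "real CARD('l) * ?r * (4 * real CARD('l)) = 1 / 2"
    by (simp add: radius_def power2_eq_square)
  finally show ?thesis .
qed

lemma abs_mgf_dev_le:
  assumes "w' \<in> short_words"
  shows "\<bar>dev (\<lambda>z. (shift_mgf u z - shift_mgf v z) * wprod w' z / dens v z)\<bar> \<le> 2 * (T * K * N)"
proof -
  let ?d = "\<lambda>k. dev (\<lambda>z. layer k z * wprod w' z / dens v z)"
  have s: "(\<lambda>k. T * K * N * (k * (1 / 2) ^ k)) sums (T * K * N * 2)"
    by (intro sums_mult sums_k_half_power)
  have summable: "summable (\<lambda>k. \<bar>?d k\<bar>)"
    by (rule summable_comparison_test'[OF sums_summable[OF s]]) (use abs_layer_dev_le[OF assms] in simp)
  have "\<bar>dev (\<lambda>z. (shift_mgf u z - shift_mgf v z) * wprod w' z / dens v z)\<bar> = \<bar>\<Sum>k. ?d k\<bar>"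
    using layer_dev_sums[OF assms] by (simp add: sums_iff)
  also have "\<dots> \<le> (\<Sum>k. \<bar>?d k\<bar>)"
    by (rule summable_rabs[OF summable])
  also have "\<dots> \<le> T * K * N * 2"
    by (rule sums_le[OF _ summable_sums[OF summable] s]) (rule abs_layer_dev_le[OF assms])
  finally show ?thesis by simp
qed

text \<open>The score is a series in fixed functions whose coefficients are of order
  \<open>T\<close>. Bounding the deviations of those functions by \<open>N\<close> therefore bounds
  that of the score for all \<open>u\<close> at once, and the bound shrinks with
  \<open>T\<close>.\<close>

lemma abs_score_dev_le:
  assumes w': "w' \<in> short_words"
  shows "\<bar>dev (\<lambda>z. score z * wprod w' z)\<bar> \<le> T * (2 * K + real CARD('l)) * N"
proof -
  have [measurable]: "shift_mgf x \<in> borel_measurable borel" for x :: "real ^ 'l mod_ring"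
    unfolding shift_mgf_def by measurable
  let ?a = "exp (- (norm u)\<^sup>2 / 2)"
  let ?F = "\<lambda>z. (shift_mgf u z - shift_mgf v z) * wprod w' z / dens v z"
  have int: "integrable (tilt v) ?F"
  proof -
    have "integrable std_gaussian (\<lambda>z. (shift_mgf u z - shift_mgf v z) * wprod w' z)"
    proof (rule integrable_std_gaussian)
      fix z
      have "\<bar>(shift_mgf u z - shift_mgf v z) * wprod w' z\<bar> \<le> (T * K * exp (l1 z)) * (6 * exp (l1 z))"
        unfolding abs_mult using abs_shift_mgf_diff_le[of z] abs_wprod_short_le[OF w', of z] T K
        by (intro mult_mono) auto
      then show "\<bar>(shift_mgf u z - shift_mgf v z) * wprod w' z\<bar> \<le> 6 * T * K * exp (2 * l1 z)"
        unfolding exp_double by (simp add: power2_eq_square mult_ac)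
    qed measurable
    then show ?thesis by (simp add: integrable_tilt_iff)
  qed
  have "dev (\<lambda>z. score z * wprod w' z) = dev (\<lambda>z. ?a * ?F z + (ratio - 1) * wprod w' z)"
    by (simp add: score_eq algebra_simps)
  also have "\<dots> = ?a * dev ?F + (ratio - 1) * dev (wprod w')"
    by (subst deviation_add) (auto simp only: deviation_cmult intro!: integrable_mult_right int integrable_wprod_tilt)
  also have "\<bar>\<dots>\<bar> \<le> 1 * (2 * (T * K * N)) + (real CARD('l) * T) * N"
    using abs_mgf_dev_le[OF w'] short_dev[OF w'] abs_ratio_le T
    by (intro order.trans[OF abs_triangle_ineq] add_mono) (auto simp only: abs_mult intro!: mult_mono, auto)
  finally show ?thesis by (simp add: algebra_simps)
qed

lemma integral_score:
  "(\<integral>z. score z * wprod w' z \<partial>tilt v)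
    = (\<integral>z. wprod w' z * dens u z \<partial>std_gaussian) - (\<integral>z. wprod w' z * dens v z \<partial>std_gaussian)"
proof -
  have "(\<integral>z. score z * wprod w' z \<partial>tilt v) = (\<integral>z. wprod w' z * dens u z - wprod w' z * dens v z \<partial>std_gaussian)"
    by (simp add: integral_tilt) (simp add: score_def algebra_simps)
  also have "\<dots> = (\<integral>z. wprod w' z * dens u z \<partial>std_gaussian) - (\<integral>z. wprod w' z * dens v z \<partial>std_gaussian)"
    by (rule Bochner_Integration.integral_diff) (rule integral_wprod_dens(1))+
  finally show ?thesis .
qed

text \<open>The weight \<open>exp (6 * l1 z)\<close> dominates, up to constants, both the cube of
  the score and the squares of short monomials. The exponent 7 adds one \<open>l1 z\<close> for
  \<open>dens v\<close>.\<close>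

lemma empirical_exp_le:
  assumes "N \<le> 1"
  shows "(\<Sum>i=1..n. exp (6 * l1 (Z i))) \<le> n * (exp_moment TYPE('l) 7 + 1)"
proof -
  have "(\<integral>z. exp (6 * l1 z) \<partial>tilt v) \<le> exp_moment TYPE('l) 7"
  proof -
    have "\<bar>\<integral>z. exp (6 * l1 z) * dens v z \<partial>std_gaussian\<bar> \<le> 1 * exp_moment TYPE('l) 7"
    proof (rule integral_std_gaussian_le)
      fix z
      have "exp (6 * l1 z) * dens v z \<le> exp (6 * l1 z) * exp (l1 z)"
        using dens_le[OF l1_v, of z] by (intro mult_left_mono) auto
      then show "\<bar>exp (6 * l1 z) * dens v z\<bar> \<le> 1 * exp (7 * l1 z)"
        using dens_pos[of v z] by (simp add: abs_mult flip: exp_add)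
    qed measurable
    then show ?thesis by (simp add: integral_tilt)
  qed
  then have "(\<Sum>i=1..n. exp (6 * l1 (Z i))) / n \<le> exp_moment TYPE('l) 7 + 1"
    using exp_dev assms unfolding deviation_def by linarith
  then show ?thesis using n by (simp add: field_simps)
qed

text \<open>The quadratic term of the likelihood expansion has size at least
  \<open>c2 * T\<^sup>2 / 2\<close>. The hypothesis \<open>N2\<close> keeps the fluctuation of the
  relevant empirical mean below half of its expectation, and \<open>T2\<close> keeps the cubic term
  below half of the quadratic one. Optimality then leaves
  \<open>0 \<le> T * (k1 * N - c2 * T / 4)\<close>, from which \<open>T\<close> is
  cancelled.\<close>

lemma moment_gap_le:
  assumes attained: "w\<^sub>0 \<in> short_words" "\<bar>moment w\<^sub>0 u - moment w\<^sub>0 v\<bar> = T"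
    and likelihood: "0 \<le> (\<Sum>i=1..n. ln (dens u (Z i) / dens v (Z i)))"
    and N1: "N \<le> 1"
    and c1: "c1 = 1 / (2 * moment_stability TYPE('l))"
    and b: "b = exp_moment TYPE('l) 7 + 1"
    and c2: "c2 = c1\<^sup>2 / (144 * b)"
    and N2: "(2 * K + real CARD('l)) * N \<le> c1 / 2"
    and T2: "(3 * K + real CARD('l)) ^ 3 * b * T \<le> 3 * c2 / 4"
  shows "T \<le> 4 * (2 * K + real CARD('l)) / c2 * N"
proof (cases "T = 0")
  case True
  have "0 \<le> c2" using exp_moment_nonneg[where 'l='l, of 7] by (simp add: c2 b)
  then show ?thesis using True N K by (auto intro!: mult_nonneg_nonneg divide_nonneg_nonneg)
next
  case False
  then have T: "0 < T" using T by simp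
  have c1p: "0 < c1" using moment_stability_ge_1[where 'l='l] by (simp add: c1)
  have bp: "1 \<le> b" using exp_moment_nonneg[where 'l='l, of 7] by (simp add: b)
  have c2p: "0 < c2" using c1p bp by (simp add: c2)
  define k1 where "k1 = 2 * K + real CARD('l)"
  define S where "S F = (\<Sum>i=1..n. F (Z i))" for F :: "real ^ 'l mod_ring \<Rightarrow> real"
  have S_exp: "S (\<lambda>z. exp (6 * l1 z)) \<le> n * b"
    using empirical_exp_le[OF N1] by (simp add: S_def b)
  have dev_S: "S F / n = dev F + (\<integral>z. F z \<partial>tilt v)" for F
    by (simp add: S_def deviation_def)
  \<comment> \<open>If no short monomial were this strongly correlated with the score, moment
    stability would bound the gap by \<open>T / 2\<close>, contradicting that
    \<open>w\<^sub>0\<close> attains \<open>T\<close>.\<close>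
  obtain w' where w': "w' \<in> short_words" and big: "c1 * T < \<bar>\<integral>z. score z * wprod w' z \<partial>tilt v\<bar>"
  proof (rule ccontr)
    assume "\<not> thesis"
    with that have "\<bar>\<integral>z. score z * wprod w z \<partial>tilt v\<bar> \<le> c1 * T" if "w \<in> short_words" for w
      using that by force
    then have "\<bar>moment w\<^sub>0 u - moment w\<^sub>0 v\<bar> \<le> moment_stability TYPE('l) * (c1 * T)"
      by (intro moment_diff_le_dens_moment_diff[OF _ attained(1)]) (simp add: integral_score)
    also have "\<dots> = T / 2" using moment_stability_ge_1[where 'l='l] by (simp add: c1)
    finally show False using attained(2) T by simp
  qed
  have "c1 * T / 2 \<le> \<bar>S (\<lambda>z. score z * wprod w' z) / n\<bar>"
  proof -
    have "\<bar>dev (\<lambda>z. score z * wprod w' z)\<bar> \<le> T * (k1 * N)"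
      using abs_score_dev_le[OF w'] by (simp add: k1_def mult_ac)
    also have "\<dots> \<le> T * (c1 / 2)"
      using N2 T by (intro mult_left_mono) (auto simp: k1_def)
    finally have "\<bar>dev (\<lambda>z. score z * wprod w' z)\<bar> \<le> c1 * T / 2" by (simp add: mult.commute)
    moreover have "c1 * T \<le> x + c1 * T / 2 \<Longrightarrow> c1 * T / 2 \<le> x" for x by simp
    ultimately show ?thesis
      using big abs_triangle_ineq4[of "dev (\<lambda>z. score z * wprod w' z) + (\<integral>z. score z * wprod w' z \<partial>tilt v)"
          "dev (\<lambda>z. score z * wprod w' z)"]
      unfolding dev_S by fastforce
  qed
  then have "(c1 * T / 2)\<^sup>2 \<le> (S (\<lambda>z. score z * wprod w' z) / n)\<^sup>2"
    using c1p T by (intro abs_le_square_iff[THEN iffD1]) auto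
  \<comment> \<open>Cauchy-Schwarz converts a large empirical correlation with one monomial into a
    lower bound on the sum of squared scores.\<close>
  also have "\<dots> \<le> S (\<lambda>z. (score z)\<^sup>2) * (n * 36 * b) / n\<^sup>2"
  proof -
    have "(S (\<lambda>z. score z * wprod w' z))\<^sup>2 \<le> S (\<lambda>z. (score z)\<^sup>2) * S (\<lambda>z. (wprod w' z)\<^sup>2)"
      unfolding S_def by (rule Cauchy_Schwarz_ineq_sum)
    moreover have "S (\<lambda>z. (wprod w' z)\<^sup>2) \<le> 36 * S (\<lambda>z. exp (6 * l1 z))"
      unfolding S_def sum_distrib_left
    proof (rule sum_mono)
      fix i
      have "(wprod w' (Z i))\<^sup>2 \<le> (6 * exp (l1 (Z i)))\<^sup>2"
        using abs_wprod_short_le[OF w', of "Z i"] by (intro abs_le_square_iff[THEN iffD1]) auto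
      also have "\<dots> = 36 * exp (2 * l1 (Z i))" by (simp add: exp_double power_mult_distrib)
      finally show "(wprod w' (Z i))\<^sup>2 \<le> 36 * exp (6 * l1 (Z i))"
        by (rule order.trans) simp
    qed
    then have "S (\<lambda>z. (score z)\<^sup>2) * S (\<lambda>z. (wprod w' z)\<^sup>2) \<le> S (\<lambda>z. (score z)\<^sup>2) * (n * 36 * b)"
      using S_exp by (intro mult_left_mono) (auto simp: S_def sum_nonneg)
    ultimately show ?thesis
      unfolding power_divide of_nat_power by (rule divide_right_mono[OF order.trans]) auto
  qed
  finally have "(c1 * T / 2)\<^sup>2 \<le> S (\<lambda>z. (score z)\<^sup>2) * (n * 36 * b) / n\<^sup>2" .
  \<comment> \<open>The 144 in \<open>c2\<close> is 4, from squaring the half in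
    \<open>c1 * T / 2\<close>, times 36, from the bound on squared monomials.\<close>
  then have sq: "n * (c2 * T\<^sup>2) \<le> S (\<lambda>z. (score z)\<^sup>2)"
    using n bp by (simp add: c2 power_divide power_mult_distrib power2_eq_square field_simps)
  have cube: "S (\<lambda>z. score z ^ 3) \<le> n * (T ^ 3 * ((3 * K + real CARD('l)) ^ 3 * b))"
  proof -
    have "S (\<lambda>z. score z ^ 3) \<le> (T * (3 * K + real CARD('l))) ^ 3 * S (\<lambda>z. exp (6 * l1 z))"
      unfolding S_def sum_distrib_left
    proof (rule sum_mono)
      fix i
      have "score (Z i) ^ 3 \<le> \<bar>score (Z i)\<bar> ^ 3" by (simp add: power_abs[symmetric])
      also have "\<dots> \<le> (T * (3 * K + real CARD('l)) * exp (2 * l1 (Z i))) ^ 3"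
        by (intro power_mono abs_score_le) auto
      also have "\<dots> = (T * (3 * K + real CARD('l))) ^ 3 * exp (6 * l1 (Z i))"
        by (simp add: power_mult_distrib exp_of_nat_mult[symmetric])
      finally show "score (Z i) ^ 3 \<le> (T * (3 * K + real CARD('l))) ^ 3 * exp (6 * l1 (Z i))" .
    qed
    also have "\<dots> \<le> (T * (3 * K + real CARD('l))) ^ 3 * (n * b)"
      using T K by (intro mult_left_mono S_exp) auto
    finally show ?thesis by (simp add: power_mult_distrib mult_ac)
  qed
  have lin: "S score \<le> n * (T * k1 * N)"
  proof -
    \<comment> \<open>Both \<open>dens u\<close> and \<open>dens v\<close> integrate to the Gaussian
      total mass, so the linear term consists of its fluctuation alone.\<close>
    have "(\<integral>z. score z * wprod [] z \<partial>tilt v) = 0"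
      unfolding integral_score
      by (subst (1 2) integral_wprod_dens(2)) simp
    then have "S score / n = dev score" unfolding dev_S by simp
    also have "\<dots> \<le> T * k1 * N"
      using abs_score_dev_le[of "[]"] by (simp add: short_words_def k1_def)
    finally show ?thesis using n by (simp add: field_simps)
  qed
  have "0 \<le> S (\<lambda>z. ln (1 + score z))"
    using likelihood by (simp add: S_def score_def)
  also have "\<dots> \<le> S (\<lambda>z. score z - (score z)\<^sup>2 / 2 + score z ^ 3 / 3)"
    unfolding S_def by (intro sum_mono ln_1_plus_le_cubic) (simp add: score_def dens_pos)
  also have "\<dots> = S score - S (\<lambda>z. (score z)\<^sup>2) / 2 + S (\<lambda>z. score z ^ 3) / 3"
    by (simp add: S_def sum.distrib sum_subtractf sum_divide_distrib)
  also have "\<dots> \<le> n * (T * k1 * N) - n * (c2 * T\<^sup>2) / 2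
      + n * (T ^ 3 * ((3 * K + real CARD('l)) ^ 3 * b)) / 3"
    using sq cube lin by (intro add_mono diff_mono divide_right_mono) auto
  also have "\<dots> \<le> n * (T * k1 * N) - n * (c2 * T\<^sup>2) / 2 + n * (c2 * T\<^sup>2) / 4"
  proof -
    have "T\<^sup>2 * ((3 * K + real CARD('l)) ^ 3 * b * T) \<le> T\<^sup>2 * (3 * c2 / 4)"
      by (intro mult_left_mono T2) auto
    then have "T ^ 3 * ((3 * K + real CARD('l)) ^ 3 * b) / 3 \<le> c2 * T\<^sup>2 / 4"
      by (simp add: power2_eq_square power3_eq_cube mult_ac)
    then have "n * (T ^ 3 * ((3 * K + real CARD('l)) ^ 3 * b) / 3) \<le> n * (c2 * T\<^sup>2 / 4)"
      by (intro mult_left_mono) auto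
    then show ?thesis unfolding times_divide_eq_right by (rule add_left_mono)
  qed
  also have "\<dots> = (n * T) * (k1 * N - c2 * T / 4)"
    by (simp add: power2_eq_square algebra_simps)
  finally have "0 \<le> (n * T) * (k1 * N - c2 * T / 4)" .
  moreover have "0 < n * T" using n T by simp
  ultimately have "0 \<le> k1 * N - c2 * T / 4"
    by (metis not_le zero_le_mult_iff)
  then show ?thesis using c2p by (simp add: k1_def field_simps)
qed

end

subsection \<open>Second moments of the deviations\<close>

definition rescale :: "real \<Rightarrow> (nat \<Rightarrow> real ^ 'l::finite mod_ring) \<Rightarrow> nat \<Rightarrow> real ^ 'l mod_ring" where
  "rescale \<sigma> X i = (1 / \<sigma>) *\<^sub>R X i"

lemma mra_law_tilt: "0 < \<sigma> \<Longrightarrow> mra_law \<sigma> \<theta> = distr (tilt ((1 / \<sigma>) *\<^sub>R \<theta>)) borel (\<lambda>z. \<sigma> *\<^sub>R z)"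
  by (simp add: mra_law_eq tilt_def)

lemma sets_mra_law [simp, measurable_cong]: "sets (mra_law \<sigma> \<theta>) = sets borel"
  by (simp add: mra_law_def)

lemma borel_measurable_deviation_rescale [measurable]:
  fixes F :: "real ^ 'l::finite mod_ring \<Rightarrow> real"
  assumes [measurable]: "F \<in> borel_measurable borel"
  shows "(\<lambda>X. deviation (rescale \<sigma> X) n Q F) \<in> borel_measurable (\<Pi>\<^sub>M i\<in>{1..n}. mra_law \<sigma> \<theta>)"
  unfolding deviation_def rescale_def by measurable

text \<open>The variance bound for empirical means, with the second moment under
  \<open>tilt v\<close> rewritten as a Gaussian integral and dominated by an exponential
  moment.\<close>

lemma nn_integral_deviation_sq_le:
  fixes \<theta> :: "real ^ 'l::finite mod_ring"
  assumes "0 < \<sigma>" "0 < n" and v: "v = (1 / \<sigma>) *\<^sub>R \<theta>"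
    and F [measurable]: "F \<in> borel_measurable borel"
    and bound: "\<And>z. (F z)\<^sup>2 * dens v z \<le> K * exp (c * l1 z)"
  shows "(\<integral>\<^sup>+X. ennreal ((deviation (rescale \<sigma> X) n (tilt v) F)\<^sup>2) \<partial>(\<Pi>\<^sub>M i\<in>{1..n}. mra_law \<sigma> \<theta>))
    \<le> ennreal (K * exp_moment TYPE('l) c / n)"
proof -
  have [measurable]: "(\<lambda>x. F ((1 / \<sigma>) *\<^sub>R x)) \<in> borel_measurable borel" by measurable
  have mean: "(\<integral>x. F ((1 / \<sigma>) *\<^sub>R x) \<partial>mra_law \<sigma> \<theta>) = (\<integral>z. F z \<partial>tilt v)"
    using \<open>0 < \<sigma>\<close> by (simp add: mra_law_tilt integral_distr v)
  have int: "integrable std_gaussian (\<lambda>z. (F z)\<^sup>2 * dens v z)"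
    by (rule integrable_std_gaussian[where K = K and c = c])
      (measurable, use bound dens_pos[of v] in \<open>simp add: abs_of_pos less_imp_le\<close>)
  have "(\<integral>\<^sup>+x. ennreal ((F ((1 / \<sigma>) *\<^sub>R x))\<^sup>2) \<partial>mra_law \<sigma> \<theta>) = (\<integral>\<^sup>+z. ennreal ((F z)\<^sup>2) \<partial>tilt v)"
    using \<open>0 < \<sigma>\<close> by (simp add: mra_law_tilt nn_integral_distr v)
  also have "\<dots> = (\<integral>\<^sup>+z. ennreal ((F z)\<^sup>2 * dens v z) \<partial>std_gaussian)"
    unfolding tilt_def
    by (subst nn_integral_density) (auto simp: ennreal_mult less_imp_le[OF dens_pos] mult.commute)
  also have "\<dots> = ennreal (\<integral>z. (F z)\<^sup>2 * dens v z \<partial>std_gaussian)"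
    by (rule nn_integral_eq_integral[OF int]) (simp add: less_imp_le[OF dens_pos])
  also have "\<dots> \<le> ennreal (K * exp_moment TYPE('l) c)"
    using integral_std_gaussian_le[of "\<lambda>z. (F z)\<^sup>2 * dens v z" K c] bound dens_pos[of v]
    by (intro ennreal_leI) (simp add: abs_of_pos less_imp_le)
  finally have sq: "(\<integral>\<^sup>+x. ennreal ((F ((1 / \<sigma>) *\<^sub>R x))\<^sup>2) \<partial>mra_law \<sigma> \<theta>) \<le> ennreal (K * exp_moment TYPE('l) c)" .
  have K: "0 \<le> K"
  proof -
    have "0 \<le> (F 0)\<^sup>2 * dens v 0" using dens_pos[of v 0] by simp
    with bound[of 0] have "0 \<le> K * exp (c * l1 (0 :: real ^ 'l mod_ring))" by linarith
    then show ?thesis by (simp add: zero_le_mult_iff)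
  qed
  have "(\<integral>\<^sup>+X. ennreal ((deviation (rescale \<sigma> X) n (tilt v) F)\<^sup>2) \<partial>(\<Pi>\<^sub>M i\<in>{1..n}. mra_law \<sigma> \<theta>))
    \<le> (\<integral>\<^sup>+x. ennreal ((F ((1 / \<sigma>) *\<^sub>R x))\<^sup>2) \<partial>mra_law \<sigma> \<theta>) / ennreal n"
    unfolding deviation_def rescale_def mean[symmetric]
    by (rule nn_integral_empirical_deviation[OF prob_space_mra_law _ \<open>0 < n\<close>]) measurable
  also have "\<dots> \<le> ennreal (K * exp_moment TYPE('l) c) / ennreal n"
    by (rule divide_right_mono_ennreal[OF sq])
  also have "\<dots> = ennreal (K * exp_moment TYPE('l) c / n)"
    using K exp_moment_nonneg[where 'l='l] \<open>0 < n\<close> by (simp add: divide_ennreal)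
  finally show ?thesis .
qed

text \<open>Squares of monomials of degree k are controlled by \<open>fact (2 * k)\<close>, whereas
  squared deviations are normalised by \<open>(fact k)\<^sup>2\<close>; this compares the
  two.\<close>

lemma fact_double_le: "fact (2 * k) \<le> (4::real) ^ k * (fact k)\<^sup>2"
proof (induction k)
  case (Suc k)
  have "fact (2 * Suc k) = (real (2 * k + 2) * real (2 * k + 1)) * fact (2 * k)"
    by (simp add: algebra_simps)
  also have "\<dots> \<le> (4 * (real k + 1)\<^sup>2) * (4 ^ k * (fact k)\<^sup>2)"
  proof (rule mult_mono[OF _ Suc])
    show "real (2 * k + 2) * real (2 * k + 1) \<le> 4 * (real k + 1)\<^sup>2"
      by (simp add: power2_eq_square algebra_simps)
  qed auto
  also have "\<dots> = 4 ^ Suc k * (fact (Suc k))\<^sup>2"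
    by (simp add: power_mult_distrib add.commute)
  finally show ?case .
qed simp

definition word_deviation :: "(nat \<Rightarrow> real ^ 'l::finite mod_ring) \<Rightarrow> nat \<Rightarrow> real ^ 'l mod_ring \<Rightarrow> 'l mod_ring list \<Rightarrow> 'l mod_ring list \<Rightarrow> real" where
  "word_deviation Z n v w w' = deviation Z n (tilt v) (\<lambda>z. wprod w z * wprod w' z / dens v z)
     / (fact (length w) * (4 * real CARD('l)) ^ length w)"

text \<open>The random variable whose square root serves as \<open>N\<close>. It takes values in
  \<open>ennreal\<close> because the series over all word lengths may diverge for individual
  samples, although its expectation is of order \<open>1 / n\<close>.\<close>

definition total_deviation :: "(nat \<Rightarrow> real ^ 'l::finite mod_ring) \<Rightarrow> nat \<Rightarrow> real ^ 'l mod_ring \<Rightarrow> ennreal" where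
  "total_deviation Z n v =
     (\<Sum>k. \<Sum>w\<in>words k. \<Sum>w'\<in>short_words. ennreal ((word_deviation Z n v w w')\<^sup>2))
     + (\<Sum>w'\<in>short_words. ennreal ((deviation Z n (tilt v) (wprod w'))\<^sup>2))
     + ennreal ((deviation Z n (tilt v) (\<lambda>z. exp (6 * l1 z)))\<^sup>2)"

lemma borel_measurable_word_deviation [measurable]:
  "(\<lambda>X. word_deviation (rescale \<sigma> X) n v w w') \<in> borel_measurable (\<Pi>\<^sub>M i\<in>{1..n}. mra_law \<sigma> \<theta>)"
  unfolding word_deviation_def by measurable

lemma borel_measurable_total_deviation [measurable]:
  "(\<lambda>X. total_deviation (rescale \<sigma> X) n v) \<in> borel_measurable (\<Pi>\<^sub>M i\<in>{1..n}. mra_law \<sigma> \<theta>)"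
  unfolding total_deviation_def by measurable

text \<open>The second moment is at most \<open>108 * fact (2 * k)\<close> times an exponential
  moment, where 108 is \<open>6\<^sup>2 * 3\<close>, from the short monomial and from
  \<open>1 / dens v\<close>. After normalisation the factor \<open>1 / (4 * L\<^sup>2)\<close> per
  letter remains, which outweighs the \<open>L ^ k\<close> words of length k.\<close>

lemma nn_integral_word_deviation_le:
  fixes \<theta> :: "real ^ 'l::finite mod_ring"
  assumes "0 < \<sigma>" "0 < n" and v: "v = (1 / \<sigma>) *\<^sub>R \<theta>" and "l1 v \<le> 1"
    and w: "w \<in> words k" and w': "w' \<in> short_words"
  shows "(\<integral>\<^sup>+X. ennreal ((word_deviation (rescale \<sigma> X) n v w w')\<^sup>2) \<partial>(\<Pi>\<^sub>M i\<in>{1..n}. mra_law \<sigma> \<theta>))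
    \<le> ennreal (108 * exp_moment TYPE('l) 4 / n * (1 / (4 * (real CARD('l))\<^sup>2)) ^ k)"
proof -
  let ?F = "\<lambda>z. wprod w z * wprod w' z / dens v z"
  let ?c = "(fact k * (4 * real CARD('l)) ^ k)\<^sup>2 :: real"
  let ?P = "\<Pi>\<^sub>M i\<in>{1..n}. mra_law \<sigma> \<theta>"
  have k: "length w = k" using w by (simp add: words_def)
  have bound: "(?F z)\<^sup>2 * dens v z \<le> (108 * fact (2 * k)) * exp (4 * l1 z)" for z
  proof -
    have "(?F z)\<^sup>2 * dens v z = \<bar>wprod w z\<bar>\<^sup>2 * \<bar>wprod w' z\<bar>\<^sup>2 * (1 / dens v z)"
      using dens_pos[of v z] by (simp add: power_mult_distrib power_divide power2_eq_square)
    also have "\<dots> \<le> (l1 z ^ k)\<^sup>2 * (6 * exp (l1 z))\<^sup>2 * (3 * exp (l1 z))"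
      using abs_wprod_le[of w z] abs_wprod_short_le[OF w', of z] one_div_dens_le[OF assms(4), of z]
        dens_pos[of v z] unfolding k
      by (intro mult_mono power_mono) auto
    also have "\<dots> = l1 z ^ (2 * k) * (108 * exp (3 * l1 z))"
    proof -
      have "(l1 z ^ k)\<^sup>2 = l1 z ^ (2 * k)" by (simp add: mult.commute flip: power_mult)
      moreover have "exp (3 * l1 z) = exp (l1 z) * exp (l1 z) * exp (l1 z)" by (simp flip: exp_add)
      ultimately show ?thesis by (simp add: power2_eq_square)
    qed
    also have "\<dots> \<le> (fact (2 * k) * exp (l1 z)) * (108 * exp (3 * l1 z))"
      by (intro mult_right_mono power_le_fact_exp) auto
    also have "\<dots> = (108 * fact (2 * k)) * exp (4 * l1 z)"
      by (simp add: mult_ac flip: exp_add)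
    finally show ?thesis .
  qed
  have [measurable]: "?F \<in> borel_measurable borel" by measurable
  have "(\<integral>\<^sup>+X. ennreal ((word_deviation (rescale \<sigma> X) n v w w')\<^sup>2) \<partial>?P)
    = (\<integral>\<^sup>+X. ennreal (1 / ?c) * ennreal ((deviation (rescale \<sigma> X) n (tilt v) ?F)\<^sup>2) \<partial>?P)"
    by (intro nn_integral_cong) (simp add: word_deviation_def k power_divide flip: ennreal_mult)
  also have "\<dots> = ennreal (1 / ?c) * (\<integral>\<^sup>+X. ennreal ((deviation (rescale \<sigma> X) n (tilt v) ?F)\<^sup>2) \<partial>?P)"
    by (rule nn_integral_cmult) measurable
  also have "\<dots> \<le> ennreal (1 / ?c) * ennreal (108 * fact (2 * k) * exp_moment TYPE('l) 4 / n)"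
    by (intro mult_left_mono nn_integral_deviation_sq_le assms bound) auto
  also have "\<dots> = ennreal (1 / ?c * (108 * fact (2 * k) * exp_moment TYPE('l) 4 / n))"
    using exp_moment_nonneg[where 'l='l] by (simp add: ennreal_mult[symmetric])
  also have "\<dots> \<le> ennreal (108 * exp_moment TYPE('l) 4 / n * (1 / (4 * (real CARD('l))\<^sup>2)) ^ k)"
  proof (rule ennreal_leI)
    have "1 / ?c * fact (2 * k) \<le> 1 / ?c * (4 ^ k * (fact k)\<^sup>2)"
      by (intro mult_left_mono fact_double_le) auto
    also have "\<dots> = 4 ^ k / ((4 * real CARD('l)) ^ k)\<^sup>2"
      unfolding power_mult_distrib[of "fact k"] by simp
    also have "\<dots> = (4 / (4 * real CARD('l))\<^sup>2) ^ k"
      unfolding power_divide by (simp only: mult.commute flip: power_mult)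
    also have "4 / (4 * real CARD('l))\<^sup>2 = 1 / (4 * (real CARD('l))\<^sup>2)"
      by (simp add: power2_eq_square)
    finally have "108 * exp_moment TYPE('l) 4 / n * (1 / ?c * fact (2 * k))
      \<le> 108 * exp_moment TYPE('l) 4 / n * (1 / (4 * (real CARD('l))\<^sup>2)) ^ k"
      using exp_moment_nonneg[where 'l='l] by (intro mult_left_mono) auto
    then show "1 / ?c * (108 * fact (2 * k) * exp_moment TYPE('l) 4 / n)
      \<le> 108 * exp_moment TYPE('l) 4 / n * (1 / (4 * (real CARD('l))\<^sup>2)) ^ k"
      by (simp add: mult_ac)
  qed
  finally show ?thesis .
qed

text \<open>One summand for each group of terms in \<open>total_deviation\<close>; the factor 2 is
  the geometric series over word lengths, and 13 is twice the exponent 6 plus 1 for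
  \<open>dens v\<close>.\<close>

definition deviation_const :: "'l::finite itself \<Rightarrow> real" where
  "deviation_const _ = (let q = real (card (short_words :: 'l mod_ring list set)) in
     2 * (q * (108 * exp_moment TYPE('l) 4)) + q * (36 * exp_moment TYPE('l) 3) + exp_moment TYPE('l) 13)"

lemma deviation_const_nonneg: "0 \<le> deviation_const TYPE('l::finite)"
  by (simp add: deviation_const_def Let_def exp_moment_nonneg)

lemma nn_integral_total_deviation_le:
  fixes \<theta> :: "real ^ 'l::finite mod_ring"
  assumes "0 < \<sigma>" "0 < n" and v: "v = (1 / \<sigma>) *\<^sub>R \<theta>" and "l1 v \<le> 1"
  shows "(\<integral>\<^sup>+X. total_deviation (rescale \<sigma> X) n v \<partial>(\<Pi>\<^sub>M i\<in>{1..n}. mra_law \<sigma> \<theta>))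
    \<le> ennreal (deviation_const TYPE('l) / n)"
proof -
  let ?P = "\<Pi>\<^sub>M i\<in>{1..n}. mra_law \<sigma> \<theta>"
  let ?S = "short_words :: 'l mod_ring list set"
  let ?q = "real (card ?S)"
  let ?A = "108 * exp_moment TYPE('l) 4 / n"
  note nonneg = exp_moment_nonneg[where 'l='l]
  have layer: "(\<integral>\<^sup>+X. (\<Sum>w\<in>words k. \<Sum>w'\<in>?S. ennreal ((word_deviation (rescale \<sigma> X) n v w w')\<^sup>2)) \<partial>?P)
    \<le> ennreal (?q * ?A * (1 / 2) ^ k)" for k
  proof -
    have "(\<integral>\<^sup>+X. (\<Sum>w\<in>words k. \<Sum>w'\<in>?S. ennreal ((word_deviation (rescale \<sigma> X) n v w w')\<^sup>2)) \<partial>?P)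
      = (\<Sum>w\<in>words k. \<integral>\<^sup>+X. (\<Sum>w'\<in>?S. ennreal ((word_deviation (rescale \<sigma> X) n v w w')\<^sup>2)) \<partial>?P)"
      by (rule nn_integral_sum) measurable
    also have "\<dots> = (\<Sum>w\<in>words k. \<Sum>w'\<in>?S. \<integral>\<^sup>+X. ennreal ((word_deviation (rescale \<sigma> X) n v w w')\<^sup>2) \<partial>?P)"
      by (intro sum.cong refl nn_integral_sum) measurable
    also have "\<dots> \<le> (\<Sum>w\<in>(words k :: 'l mod_ring list set). \<Sum>w'\<in>?S. ennreal (?A * (1 / (4 * (real CARD('l))\<^sup>2)) ^ k))"
      by (intro sum_mono nn_integral_word_deviation_le assms)
    also have "\<dots> = ennreal (real CARD('l) ^ k * (?q * (?A * (1 / (4 * (real CARD('l))\<^sup>2)) ^ k)))"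
      using nonneg by (simp add: card_words ennreal_of_nat_eq_real_of_nat ennreal_mult[symmetric] flip: of_nat_power)
    also have "\<dots> \<le> ennreal (?q * ?A * (1 / 2) ^ k)"
    proof (rule ennreal_leI)
      have "1 \<le> real CARD('l)" using zero_less_card_finite[where 'a='l] by linarith
      moreover have "x * (1 / (4 * x\<^sup>2)) \<le> 1 / 2" if "1 \<le> x" for x :: real
        using that by (simp add: field_simps power2_eq_square)
      ultimately have "real CARD('l) * (1 / (4 * (real CARD('l))\<^sup>2)) \<le> 1 / 2" by blast
      then have "(real CARD('l) * (1 / (4 * (real CARD('l))\<^sup>2))) ^ k \<le> (1 / 2) ^ k"
        by (intro power_mono) auto
      then have "?q * ?A * (real CARD('l) * (1 / (4 * (real CARD('l))\<^sup>2))) ^ k \<le> ?q * ?A * (1 / 2) ^ k"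
        using nonneg by (intro mult_left_mono) auto
      then show "real CARD('l) ^ k * (?q * (?A * (1 / (4 * (real CARD('l))\<^sup>2)) ^ k)) \<le> ?q * ?A * (1 / 2) ^ k"
        unfolding power_mult_distrib by (simp add: mult_ac)
    qed
    finally show ?thesis .
  qed
  have 1: "(\<integral>\<^sup>+X. (\<Sum>k. \<Sum>w\<in>words k. \<Sum>w'\<in>?S. ennreal ((word_deviation (rescale \<sigma> X) n v w w')\<^sup>2)) \<partial>?P)
    \<le> ennreal (?q * ?A * 2)"
  proof -
    have "(\<integral>\<^sup>+X. (\<Sum>k. \<Sum>w\<in>words k. \<Sum>w'\<in>?S. ennreal ((word_deviation (rescale \<sigma> X) n v w w')\<^sup>2)) \<partial>?P)
      = (\<Sum>k. \<integral>\<^sup>+X. (\<Sum>w\<in>words k. \<Sum>w'\<in>?S. ennreal ((word_deviation (rescale \<sigma> X) n v w w')\<^sup>2)) \<partial>?P)"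
      by (rule nn_integral_suminf) measurable
    also have "\<dots> \<le> (\<Sum>k. ennreal (?q * ?A * (1 / 2) ^ k))"
      by (intro suminf_le layer) auto
    also have "\<dots> = ennreal (?q * ?A * 2)"
    proof (rule suminf_ennreal_eq)
      have "(\<lambda>k. (1 / 2) ^ k) sums (2 :: real)" using geometric_sums[of "1 / 2 :: real"] by simp
      then show "(\<lambda>k. ?q * ?A * (1 / 2) ^ k) sums (?q * ?A * 2)" by (rule sums_mult)
    qed (use nonneg in simp)
    finally show ?thesis .
  qed
  have 2: "(\<integral>\<^sup>+X. (\<Sum>w'\<in>?S. ennreal ((deviation (rescale \<sigma> X) n (tilt v) (wprod w'))\<^sup>2)) \<partial>?P)
    \<le> ennreal (?q * (36 * exp_moment TYPE('l) 3 / n))"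
  proof -
    have "(\<integral>\<^sup>+X. (\<Sum>w'\<in>?S. ennreal ((deviation (rescale \<sigma> X) n (tilt v) (wprod w'))\<^sup>2)) \<partial>?P)
      = (\<Sum>w'\<in>?S. \<integral>\<^sup>+X. ennreal ((deviation (rescale \<sigma> X) n (tilt v) (wprod w'))\<^sup>2) \<partial>?P)"
      by (rule nn_integral_sum) measurable
    also have "\<dots> \<le> (\<Sum>w'\<in>?S. ennreal (36 * exp_moment TYPE('l) 3 / n))"
    proof (intro sum_mono nn_integral_deviation_sq_le assms(1-3) borel_measurable_wprod)
      fix w' z assume "w' \<in> ?S"
      then have "(wprod w' z)\<^sup>2 * dens v z \<le> (6 * exp (l1 z))\<^sup>2 * exp (l1 z)"
        using abs_wprod_short_le[of w' z] dens_le[OF assms(4), of z] dens_pos[of v z]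
        by (intro mult_mono abs_le_square_iff[THEN iffD1]) auto
      then show "(wprod w' z)\<^sup>2 * dens v z \<le> 36 * exp (3 * l1 z)"
        using exp_of_nat_mult[of 3 "l1 z"] by (simp add: power_mult_distrib power2_eq_square power3_eq_cube)
    qed
    also have "\<dots> = ennreal (?q * (36 * exp_moment TYPE('l) 3 / n))"
      using nonneg by (simp add: ennreal_of_nat_eq_real_of_nat ennreal_mult[symmetric])
    finally show ?thesis .
  qed
  have 3: "(\<integral>\<^sup>+X. ennreal ((deviation (rescale \<sigma> X) n (tilt v) (\<lambda>z. exp (6 * l1 z)))\<^sup>2) \<partial>?P)
    \<le> ennreal (1 * exp_moment TYPE('l) 13 / n)"
  proof (intro nn_integral_deviation_sq_le assms(1-3))
    fix z
    have "(exp (6 * l1 z))\<^sup>2 * dens v z \<le> (exp (6 * l1 z))\<^sup>2 * exp (l1 z)"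
      using dens_le[OF assms(4), of z] by (intro mult_left_mono) auto
    then show "(exp (6 * l1 z))\<^sup>2 * dens v z \<le> 1 * exp (13 * l1 z)"
      by (simp add: power2_eq_square flip: exp_add)
  qed measurable
  have "(\<integral>\<^sup>+X. total_deviation (rescale \<sigma> X) n v \<partial>?P)
    \<le> ennreal (?q * ?A * 2) + ennreal (?q * (36 * exp_moment TYPE('l) 3 / n)) + ennreal (1 * exp_moment TYPE('l) 13 / n)"
  proof -
    let ?f = "\<lambda>X. \<Sum>k. \<Sum>w\<in>words k. \<Sum>w'\<in>?S. ennreal ((word_deviation (rescale \<sigma> X) n v w w')\<^sup>2)"
    let ?g = "\<lambda>X. \<Sum>w'\<in>?S. ennreal ((deviation (rescale \<sigma> X) n (tilt v) (wprod w'))\<^sup>2)"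
    let ?h = "\<lambda>X. ennreal ((deviation (rescale \<sigma> X) n (tilt v) (\<lambda>z. exp (6 * l1 z)))\<^sup>2)"
    have "(\<integral>\<^sup>+X. total_deviation (rescale \<sigma> X) n v \<partial>?P) = (\<integral>\<^sup>+X. ?f X + ?g X \<partial>?P) + (\<integral>\<^sup>+X. ?h X \<partial>?P)"
      unfolding total_deviation_def by (rule nn_integral_add) measurable
    also have "(\<integral>\<^sup>+X. ?f X + ?g X \<partial>?P) = (\<integral>\<^sup>+X. ?f X \<partial>?P) + (\<integral>\<^sup>+X. ?g X \<partial>?P)"
      by (rule nn_integral_add) measurable
    finally show ?thesis using add_mono[OF add_mono[OF 1 2] 3] by (simp only:)
  qed
  also have "\<dots> = ennreal (deviation_const TYPE('l) / n)"
    using nonneg by (simp add: ennreal_plus[symmetric] deviation_const_def Let_def add_divide_distrib mult_ac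
        del: ennreal_plus)
  finally show ?thesis .
qed

text \<open>Every squared deviation, suitably normalised, is at most one of the nonnegative summands
  of the total.\<close>

lemma good_sample_total_deviation:
  fixes u v :: "real ^ 'l::finite mod_ring"
  assumes "close_pair u v K T" and "0 < n" and fin: "total_deviation Z n v < \<infinity>"
  shows "good_sample u v K T Z n (sqrt (enn2real (total_deviation Z n v)))"
proof -
  interpret close_pair u v K T by fact
  define N where "N = sqrt (enn2real (total_deviation Z n v))"
  have N: "0 \<le> N" "ennreal (N\<^sup>2) = total_deviation Z n v"
    using fin by (auto simp: N_def)
  have le: "\<bar>x\<bar> \<le> N" if "ennreal (x\<^sup>2) \<le> total_deviation Z n v" for x
  proof -
    have "x\<^sup>2 \<le> N\<^sup>2" using that unfolding N(2)[symmetric] by (simp add: ennreal_le_iff)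
    then show ?thesis using N(1) by (metis abs_le_square_iff abs_of_nonneg)
  qed
  have word: "\<bar>word_deviation Z n v w w'\<bar> \<le> N" if w': "w' \<in> short_words" for w w'
  proof (rule le)
    let ?f = "\<lambda>k. \<Sum>w\<in>words k. \<Sum>w'\<in>short_words. ennreal ((word_deviation Z n v w w')\<^sup>2)"
    have "ennreal ((word_deviation Z n v w w')\<^sup>2) \<le> (\<Sum>w'\<in>short_words. ennreal ((word_deviation Z n v w w')\<^sup>2))"
      by (rule member_le_sum[OF w']) auto
    also have "\<dots> \<le> ?f (length w)"
      by (rule member_le_sum[OF in_words_length]) auto
    also have "\<dots> \<le> (\<Sum>k. ?f k)"
      using sum_le_suminf[of ?f "{length w}"] by simp
    also have "\<dots> \<le> total_deviation Z n v"
      by (simp add: total_deviation_def add.assoc)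
    finally show "ennreal ((word_deviation Z n v w w')\<^sup>2) \<le> total_deviation Z n v" .
  qed
  show ?thesis unfolding N_def[symmetric]
  proof unfold_locales
    fix w w' :: "'l mod_ring list" assume w': "w' \<in> short_words"
    have c: "0 < fact (length w) * (4 * real CARD('l)) ^ length w" by simp
    show "\<bar>deviation Z n (tilt v) (\<lambda>z. wprod w z * wprod w' z / dens v z)\<bar> \<le> N * fact (length w) * (4 * real CARD('l)) ^ length w"
      using word[OF w', of w] c unfolding word_deviation_def abs_divide
      by (simp add: pos_divide_le_eq mult.assoc)
    show "\<bar>deviation Z n (tilt v) (wprod w')\<bar> \<le> N"
    proof (rule le)
      have "ennreal ((deviation Z n (tilt v) (wprod w'))\<^sup>2) \<le> (\<Sum>w'\<in>short_words. ennreal ((deviation Z n (tilt v) (wprod w'))\<^sup>2))"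
        by (rule member_le_sum[OF w']) auto
      then show "ennreal ((deviation Z n (tilt v) (wprod w'))\<^sup>2) \<le> total_deviation Z n v"
        unfolding total_deviation_def by (simp add: add_increasing add_increasing2)
    qed
  next
    show "\<bar>deviation Z n (tilt v) (\<lambda>z. exp (6 * l1 z))\<bar> \<le> N"
      by (rule le) (simp add: total_deviation_def)
  qed (use assms N in auto)
qed

subsection \<open>The maximum likelihood estimator\<close>

text \<open>Expanding the squared norm splits off the Gaussian factor of the observation, which does
  not involve \<phi>, so maximising the likelihood maximises the sum of
  \<open>ln (dens u)\<close>.\<close>

lemma log_likelihood_eq:
  fixes \<phi> :: "real ^ 'l::finite mod_ring"
  assumes "0 < \<sigma>"
  shows "log_likelihood \<sigma> n X \<phi>
    = (\<Sum>i=1..n. ln (dens ((1 / \<sigma>) *\<^sub>R \<phi>) (rescale \<sigma> X i))) - (\<Sum>i=1..n. (norm (rescale \<sigma> X i))\<^sup>2 / 2)"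
proof -
  let ?u = "(1 / \<sigma>) *\<^sub>R \<phi>"
  have "ln (measure_pmf.expectation (pmf_of_set UNIV)
        (\<lambda>l. exp (- (1 / (2 * \<sigma>\<^sup>2)) * (norm (x - cyclic_shift l \<phi>))\<^sup>2)))
    = ln (dens ?u z) - (norm z)\<^sup>2 / 2" if x: "x = \<sigma> *\<^sub>R z" for x z
  proof -
    have "exp (- (1 / (2 * \<sigma>\<^sup>2)) * (norm (x - cyclic_shift l \<phi>))\<^sup>2)
      = exp (- (norm z)\<^sup>2 / 2) * exp (z \<bullet> cyclic_shift l ?u - (norm ?u)\<^sup>2 / 2)" for l
    proof -
      have "x - cyclic_shift l \<phi> = \<sigma> *\<^sub>R (z - cyclic_shift l ?u)"
        using assms by (simp add: x cyclic_shift_scaleR scaleR_diff_right)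
      then have "- (1 / (2 * \<sigma>\<^sup>2)) * (norm (x - cyclic_shift l \<phi>))\<^sup>2 = - (norm (z - cyclic_shift l ?u))\<^sup>2 / 2"
        using assms by (simp add: power_mult_distrib)
      also have "(norm (z - cyclic_shift l ?u))\<^sup>2 = (norm z)\<^sup>2 - 2 * (z \<bullet> cyclic_shift l ?u) + (norm ?u)\<^sup>2"
      proof -
        have "(norm (a - b))\<^sup>2 = (norm a)\<^sup>2 - 2 * (a \<bullet> b) + (norm b)\<^sup>2" for a b :: "real ^ 'l mod_ring"
          by (simp add: power2_norm_eq_inner inner_diff inner_commute)
        from this[of z "cyclic_shift l ?u"] show ?thesis by (simp only: norm_cyclic_shift)
      qed
      also have "- \<dots> / 2 = - (norm z)\<^sup>2 / 2 + (z \<bullet> cyclic_shift l ?u - (norm ?u)\<^sup>2 / 2)"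
        by (simp add: field_simps)
      finally show ?thesis by (simp only: exp_add)
    qed
    then have "measure_pmf.expectation (pmf_of_set UNIV)
        (\<lambda>l. exp (- (1 / (2 * \<sigma>\<^sup>2)) * (norm (x - cyclic_shift l \<phi>))\<^sup>2)) = exp (- (norm z)\<^sup>2 / 2) * dens ?u z"
      by (simp add: integral_pmf_of_set dens_eq sum_distrib_left)
    then show ?thesis using dens_pos[of ?u z] by (simp add: ln_mult)
  qed
  from this[of "X _" "rescale \<sigma> X _"] show ?thesis
    using assms by (simp add: log_likelihood_def rescale_def sum_subtractf)
qed

lemma signal_class_admissible: "\<theta> \<in> signal_class m M \<epsilon> \<sigma> \<Longrightarrow> admissible m M \<theta>"
  and signal_class_card: "\<theta> \<in> signal_class m M \<epsilon> \<sigma> \<Longrightarrow> 7 \<le> card (supp \<theta>)"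
  by (auto simp: signal_class_def admissible_def)

text \<open>The true signal lies in the class and competes with the maximizer; the terms free of
  \<phi> cancel in the comparison.\<close>

lemma restricted_mle_likelihood:
  fixes \<theta> :: "real ^ 'l::finite mod_ring"
  assumes "restricted_mle m M \<epsilon> \<sigma> n est" "X \<in> space (\<Pi>\<^sub>M i\<in>{1..n}. borel)"
    and \<theta>: "\<theta> \<in> signal_class m M \<epsilon> \<sigma>" and "0 < \<sigma>"
  shows "est X \<in> signal_class m M \<epsilon> \<sigma>"
    and "0 \<le> (\<Sum>i=1..n. ln (dens ((1 / \<sigma>) *\<^sub>R est X) (rescale \<sigma> X i) / dens ((1 / \<sigma>) *\<^sub>R \<theta>) (rescale \<sigma> X i)))"
proof -
  have "is_arg_max (log_likelihood \<sigma> n X) (\<lambda>\<phi>. \<phi> \<in> signal_class m M \<epsilon> \<sigma>) (est X)"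
    using assms by (auto simp: restricted_mle_def)
  then show "est X \<in> signal_class m M \<epsilon> \<sigma>" and "0 \<le> (\<Sum>i=1..n. ln (dens ((1 / \<sigma>) *\<^sub>R est X) (rescale \<sigma> X i) / dens ((1 / \<sigma>) *\<^sub>R \<theta>) (rescale \<sigma> X i)))"
    using \<theta> by (auto simp: is_arg_max_def not_less log_likelihood_eq[OF \<open>0 < \<sigma>\<close>] ln_div
        dens_pos[THEN less_imp_neq, THEN not_sym] dens_pos sum_subtractf)
qed

section \<open>Shift invariance of the signal conditions\<close>

lemma supp_cyclic_shift: "supp (cyclic_shift l \<theta>) = (\<lambda>i. i - l) ` supp \<theta>"
proof -
  have "i \<in> (\<lambda>i. i - l) ` supp \<theta>" if "i + l \<in> supp \<theta>" for i
    by (rule image_eqI[OF _ that]) simp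
  then show ?thesis by (auto simp: supp_def)
qed

lemma differences_cyclic_shift: "differences (cyclic_shift l \<theta>) = differences \<theta>"
proof -
  define A where "A = {(i, j). i \<in> supp \<theta> \<and> j \<in> supp \<theta> \<and> i \<noteq> j}"
  define f where "f = (\<lambda>(i, j). (i - l, j - l))"
  have inj: "inj_on f A" by (auto simp: f_def inj_on_def)
  have "{(i, j). i \<in> supp (cyclic_shift l \<theta>) \<and> j \<in> supp (cyclic_shift l \<theta>) \<and> i \<noteq> j} = f ` A"
  proof (intro equalityI subsetI; clarify)
    fix i j assume "i \<in> supp (cyclic_shift l \<theta>)" "j \<in> supp (cyclic_shift l \<theta>)" "i \<noteq> j"
    then have "(i + l, j + l) \<in> A" by (simp add: A_def supp_def)
    then show "(i, j) \<in> f ` A" by (intro image_eqI[of _ _ "(i + l, j + l)"]) (simp add: f_def)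
  next
    fix i j a b assume "(i, j) = f (a, b)" "(a, b) \<in> A"
    then show "i \<in> supp (cyclic_shift l \<theta>) \<and> j \<in> supp (cyclic_shift l \<theta>) \<and> i \<noteq> j"
      by (auto simp: A_def f_def supp_def)
  qed
  then have "differences (cyclic_shift l \<theta>) = image_mset (\<lambda>(i, j). i - j) (image_mset f (mset_set A))"
    by (simp add: differences_def image_mset_mset_set[OF inj])
  also have "\<dots> = differences \<theta>"
    unfolding differences_def A_def[symmetric] image_mset.compositionality
    by (intro image_mset_cong) (auto simp: f_def)
  finally show ?thesis .
qed

lemma admissible_cyclic_shift: "admissible m M \<theta> \<Longrightarrow> admissible m M (cyclic_shift l \<theta>)"
  by (auto simp: admissible_def collision_free_def differences_cyclic_shift supp_cyclic_shift)

lemma card_supp_cyclic_shift: "card (supp (cyclic_shift l \<theta>)) = card (supp \<theta>)"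
  unfolding supp_cyclic_shift by (rule card_image) (auto simp: inj_on_def)

section \<open>Orbit distance and the gap between low-order moments\<close>

lemma orbit_dist_le: "orbit_dist \<phi> \<theta> \<le> norm (\<phi> - cyclic_shift l \<theta>)"
  unfolding orbit_dist_def by (rule Min_le) auto

lemma norm_le_card_bound:
  fixes x :: "real ^ 'n::finite" and c :: real
  assumes "\<And>j. \<bar>x $ j\<bar> \<le> c"
  shows "norm x \<le> CARD('n) * c"
proof -
  have "l1 x \<le> (\<Sum>j\<in>(UNIV :: 'n set). c)" unfolding l1_def by (intro sum_mono assms)
  then show ?thesis using norm_le_l1[of x] by simp
qed

definition moment_gap :: "real ^ 'l::finite mod_ring \<Rightarrow> real ^ 'l mod_ring \<Rightarrow> real" where
  "moment_gap u v = (MAX w\<in>short_words. \<bar>moment w u - moment w v\<bar>)"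

lemma short_words_nonempty [simp]: "short_words \<noteq> {}"
  by (auto simp: short_words_def intro: exI[of _ "[]"])

lemma moment_gap_ge: "w \<in> short_words \<Longrightarrow> \<bar>moment w u - moment w v\<bar> \<le> moment_gap u v"
  unfolding moment_gap_def by (rule Max_ge) auto

lemma moment_gap_attained:
  obtains w where "w \<in> short_words" "\<bar>moment w u - moment w v\<bar> = moment_gap u v"
proof -
  have "moment_gap u v \<in> (\<lambda>w. \<bar>moment w u - moment w v\<bar>) ` short_words"
    unfolding moment_gap_def by (rule Max_in) auto
  then obtain w where "moment_gap u v = \<bar>moment w u - moment w v\<bar>" "w \<in> short_words"
    by (rule imageE)
  then show ?thesis by (intro that[of w]) simp_all
qed

lemma moment_gap_nonneg: "0 \<le> moment_gap u v"
  by (rule order.trans[OF abs_ge_zero moment_gap_ge[of "[]"]]) (simp add: short_words_def)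

text \<open>Here \<theta> is the true signal and \<phi> a competitor; \<open>c\<^sub>0\<close> and
  \<open>c\<^sub>1\<close> are the constants of global recovery from third moments and of local
  recovery from second moments. The bounds on \<sigma> make the rescaled entries at most
  \<open>radius\<close> and the rescaled \<open>l1\<close> at most 1.\<close>

locale signal_pair =
  fixes m M \<sigma> c\<^sub>0 c\<^sub>1 :: real and \<theta> \<phi> :: "real ^ 'l::finite mod_ring"
  assumes c0: "c\<^sub>0 = real CARD('l) * (4 * M + 1) / m\<^sup>2" and c1: "c\<^sub>1 = 3 * M\<^sup>2 * real CARD('l) / m ^ 3"
    and m: "0 < m" and M: "0 < M" and \<sigma>1: "1 \<le> \<sigma>"
    and \<sigma>_radius: "M / radius TYPE('l) \<le> \<sigma>" and \<sigma>_l1: "real CARD('l) * M \<le> \<sigma>"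
    and \<theta>: "admissible m M \<theta>" and \<phi>: "admissible m M \<phi>" and card_\<theta>: "3 \<le> card (supp \<theta>)"
begin

abbreviation "u \<equiv> (1 / \<sigma>) *\<^sub>R \<phi>"
abbreviation "v \<equiv> (1 / \<sigma>) *\<^sub>R \<theta>"
abbreviation "T \<equiv> moment_gap u v"

lemma \<sigma>_pos: "0 < \<sigma>" using \<sigma>1 by linarith

lemma c0_nonneg: "0 \<le> c\<^sub>0" and c1_nonneg: "0 \<le> c\<^sub>1"
  using M m by (simp_all add: c0 c1)

lemma moment_unscale: "moment w \<phi> - moment w \<theta> = \<sigma> ^ length w * (moment w u - moment w v)"
  using \<sigma>_pos by (simp add: moment_scaleR power_divide algebra_simps)

lemma raw_moment_diff_le:
  assumes "w \<in> short_words"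
  shows "\<bar>moment w \<phi> - moment w \<theta>\<bar> \<le> \<sigma> ^ length w * T"
  unfolding moment_unscale abs_mult using moment_gap_ge[OF assms, of u v] \<sigma>_pos
  by (auto intro: mult_left_mono)

lemma raw_moment_diff_le_cube:
  assumes "w \<in> short_words"
  shows "\<bar>moment w \<phi> - moment w \<theta>\<bar> \<le> \<sigma> ^ 3 * T"
proof (rule order.trans[OF raw_moment_diff_le[OF assms] mult_right_mono[OF _ moment_gap_nonneg]])
  show "\<sigma> ^ length w \<le> \<sigma> ^ 3"
    using assms \<sigma>1 by (intro power_increasing) (auto simp: short_words_def)
qed

lemma orbit_representative:
  "\<exists>l. \<forall>j. \<bar>\<phi> $ j - cyclic_shift l \<theta> $ j\<bar> \<le> c\<^sub>0 * (\<sigma> ^ 3 * T)"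
  using moments_determine_orbit[OF \<theta> \<phi> m M, of "\<sigma> ^ 3 * T"] card_\<theta> raw_moment_diff_le_cube
  by (auto simp: short_words_def c0[symmetric])

lemma l1_scaled_le: "admissible m M x \<Longrightarrow> l1 ((1 / \<sigma>) *\<^sub>R x) \<le> 1"
  for x :: "real ^ 'l mod_ring"
proof -
  assume x: "admissible m M x"
  have "l1 x \<le> (\<Sum>j\<in>(UNIV :: 'l mod_ring set). M)"
    unfolding l1_def using admissible_abs_le[OF x] M by (intro sum_mono) auto
  then have "l1 x \<le> \<sigma>" using \<sigma>_l1 by simp
  moreover have "l1 ((1 / \<sigma>) *\<^sub>R x) = l1 x / \<sigma>"
    using \<sigma>_pos by (simp add: l1_def sum_divide_distrib)
  ultimately show ?thesis using \<sigma>_pos by simp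
qed

text \<open>Up to order 3 the gap bounds the differences directly, and \<open>radius ^ 3\<close> in
  the denominator of the constant compensates the required decay. For a word of length k above 3,
  third moments place \<phi> within \<open>c\<^sub>0 * \<sigma> ^ 3 * T\<close> of a shift of
  \<theta>, which changes the moment by at most \<open>k * M ^ (k - 1)\<close> times that. Dividing
  by \<open>\<sigma> ^ k\<close> leaves \<open>(M / \<sigma>) ^ (k - 3)\<close>, at most
  \<open>radius ^ (k - 3)\<close>.\<close>

lemma close_pair_moment_gap: "close_pair u v ((1 + c\<^sub>0 * M\<^sup>2) / radius TYPE('l) ^ 3) T"
proof
  let ?r = "radius TYPE('l)"
  let ?K = "(1 + c\<^sub>0 * M\<^sup>2) / ?r ^ 3"
  have r: "0 < ?r" "?r \<le> 1" using radius_bounds[where 'l='l] by auto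
  have c: "0 \<le> c\<^sub>0 * M\<^sup>2" using c0_nonneg by simp
  show "l1 u \<le> 1" "l1 v \<le> 1" by (rule l1_scaled_le[OF \<phi>], rule l1_scaled_le[OF \<theta>])
  have "?r ^ 3 \<le> 1" using r by (intro power_le_one) auto
  then show K1: "1 \<le> ?K" using c r by (simp add: pos_le_divide_eq)
  show "0 \<le> T" by (rule moment_gap_nonneg)
  show "\<bar>moment [i, i] u - moment [i, i] v\<bar> \<le> T" for i
    by (rule moment_gap_ge) (simp add: short_words_def)
  fix w :: "'l mod_ring list"
  show "\<bar>moment w u - moment w v\<bar> \<le> ?K * length w * ?r ^ length w * T"
  proof (cases "length w \<le> 3")
    case True
    show ?thesis
    \<comment> \<open>The empty word must match exactly, since the factor \<open>length w\<close> is
      then zero; its moment is 1 for every signal.\<close>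
    proof (cases "w = []")
      case False
      have "?r ^ 3 \<le> ?r ^ length w" using True r by (intro power_decreasing) auto
      then have "1 \<le> ?r ^ length w / ?r ^ 3" using r by simp
      moreover have "1 \<le> (1 + c\<^sub>0 * M\<^sup>2) * real (length w)"
        using mult_mono[of 1 "1 + c\<^sub>0 * M\<^sup>2" 1 "real (length w)"] c False by (cases w) auto
      ultimately have "1 * 1 \<le> ((1 + c\<^sub>0 * M\<^sup>2) * real (length w)) * (?r ^ length w / ?r ^ 3)"
        by (intro mult_mono) auto
      then have "1 * T \<le> (?K * length w * ?r ^ length w) * T"
        by (intro mult_right_mono moment_gap_nonneg) (simp add: mult_ac)
      then show ?thesis
        using moment_gap_ge[of w u v] True by (simp add: short_words_def)
    qed (simp add: moment_def)
  next
    case False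
    define j where "j = length w - 3"
    have k: "length w = j + 3" using False by (simp add: j_def)
    obtain l where l: "\<And>j. \<bar>\<phi> $ j - cyclic_shift l \<theta> $ j\<bar> \<le> c\<^sub>0 * (\<sigma> ^ 3 * T)"
      using orbit_representative by blast
    have "\<bar>moment w \<phi> - moment w (cyclic_shift l \<theta>)\<bar> \<le> length w * M ^ (length w - 1) * (c\<^sub>0 * (\<sigma> ^ 3 * T))"
      using M by (intro moment_diff_le l) (auto intro: admissible_abs_le[OF \<phi>] admissible_abs_le[OF \<theta>])
    then have "\<sigma> ^ length w * \<bar>moment w u - moment w v\<bar> \<le> length w * M ^ (j + 2) * (c\<^sub>0 * (\<sigma> ^ 3 * T))"
      using moment_unscale[of w] \<sigma>_pos by (simp add: abs_mult k)
    then have "\<sigma> ^ 3 * (\<sigma> ^ j * \<bar>moment w u - moment w v\<bar>) \<le> \<sigma> ^ 3 * (length w * M ^ (j + 2) * c\<^sub>0 * T)"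
      by (simp only: k power_add mult_ac)
    then have "\<sigma> ^ j * \<bar>moment w u - moment w v\<bar> \<le> length w * M ^ (j + 2) * c\<^sub>0 * T"
      using \<sigma>_pos by (simp only: mult_le_cancel_left_pos zero_less_power)
    then have "\<bar>moment w u - moment w v\<bar> \<le> length w * M ^ (j + 2) * c\<^sub>0 * T / \<sigma> ^ j"
      using \<sigma>_pos by (simp add: pos_le_divide_eq mult.commute)
    also have "\<dots> = length w * (M / \<sigma>) ^ j * (c\<^sub>0 * M\<^sup>2) * T"
      by (simp add: power_add power_divide power2_eq_square mult_ac)
    also have "\<dots> \<le> length w * ?r ^ j * (1 + c\<^sub>0 * M\<^sup>2) * T"
    proof -
      have "M / \<sigma> \<le> ?r" using \<sigma>_radius \<sigma>_pos r by (simp add: field_simps)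
      then show ?thesis
        using M \<sigma>_pos c r by (intro mult_right_mono mult_mono mult_left_mono power_mono moment_gap_nonneg) auto
    qed
    also have "\<dots> = ?K * length w * ?r ^ length w * T"
      using r by (simp add: k power_add mult_ac)
    finally show ?thesis .
  qed
qed

text \<open>The gap is attained at a word which is either empty, giving 0, or has at least one
  letter, so that both moments are at most \<open>M / \<sigma>\<close>. For large \<sigma> this
  makes the cubic likelihood term negligible.\<close>

lemma moment_gap_small: "T \<le> 2 * M / \<sigma>"
proof -
  have r: "M / \<sigma> \<le> 1"
  proof -
    have "M / \<sigma> \<le> radius TYPE('l)" using \<sigma>_radius \<sigma>_pos radius_bounds(1)[where 'l='l] by (simp add: field_simps)
    then show ?thesis using radius_bounds(2)[where 'l='l] by simp
  qed
  obtain w where w: "\<bar>moment w u - moment w v\<bar> = T" using moment_gap_attained by metis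
  show ?thesis
  proof (cases w)
    case Nil
    then have "T = 0" using w by (simp add: moment_def)
    then show ?thesis using M \<sigma>_pos by simp
  next
    case (Cons i w')
    have b: "\<bar>moment w ((1 / \<sigma>) *\<^sub>R x)\<bar> \<le> M / \<sigma>" if x: "admissible m M x" for x :: "real ^ 'l mod_ring"
    proof -
      have "\<bar>moment w ((1 / \<sigma>) *\<^sub>R x)\<bar> \<le> (M / \<sigma>) ^ length w"
        using admissible_abs_le[OF x] M \<sigma>_pos by (intro abs_moment_le) (simp add: abs_mult divide_right_mono)
      also have "\<dots> \<le> (M / \<sigma>) ^ 1"
        using r M \<sigma>_pos Cons by (intro power_decreasing) auto
      finally show ?thesis by simp
    qed
    show ?thesis using b[OF \<phi>] b[OF \<theta>] w by simp
  qed
qed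

lemma orbit_dist_bound: "orbit_dist \<phi> \<theta> \<le> real CARD('l) * (2 * M)"
proof (rule order.trans[OF orbit_dist_le[of _ _ 0]])
  have "norm (\<phi> - cyclic_shift 0 \<theta>) \<le> CARD('l mod_ring) * (2 * M)"
  proof (rule norm_le_card_bound)
    fix j
    show "\<bar>(\<phi> - cyclic_shift 0 \<theta>) $ j\<bar> \<le> 2 * M"
      using admissible_abs_le[OF \<theta>, of j] admissible_abs_le[OF \<phi>, of j] M by simp
  qed
  then show "norm (\<phi> - cyclic_shift 0 \<theta>) \<le> real CARD('l) * (2 * M)" by simp
qed

text \<open>If the global bound \<open>c\<^sub>0 * \<sigma> ^ 3 * T\<close> is below
  \<open>m\<close>, local recovery applies and gives the rate \<open>\<sigma>\<^sup>2 * T\<close>.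
  Otherwise that bound divided by \<open>m\<close> is at least 1, and the trivial distance bound may
  be multiplied by its square; squaring makes this contribution second order in \<open>T\<close>,
  hence of order \<open>1 / n\<close>.\<close>

lemma orbit_dist_le_moment_gap:
  "orbit_dist \<phi> \<theta> \<le> real CARD('l) * (c\<^sub>1 * (\<sigma>\<^sup>2 * T) + 2 * M * (c\<^sub>0 / m)\<^sup>2 * (\<sigma> ^ 6 * T\<^sup>2))"
proof -
  obtain l where l: "\<And>j. \<bar>\<phi> $ j - cyclic_shift l \<theta> $ j\<bar> \<le> c\<^sub>0 * (\<sigma> ^ 3 * T)"
    using orbit_representative by blast
  show ?thesis
  proof (cases "c\<^sub>0 * (\<sigma> ^ 3 * T) < m")
    case True
    have "\<bar>\<phi> $ j - cyclic_shift l \<theta> $ j\<bar> \<le> c\<^sub>1 * (\<sigma>\<^sup>2 * T)" for j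
      unfolding c1
    proof (rule second_moments_determine_locally[OF admissible_cyclic_shift[OF \<theta>] \<phi> m M])
      show "3 \<le> card (supp (cyclic_shift l \<theta>))" using card_\<theta> by (simp add: card_supp_cyclic_shift)
      show "\<bar>\<phi> $ j - cyclic_shift l \<theta> $ j\<bar> < m" for j using l True by (rule le_less_trans)
      show "\<bar>moment [0, a] \<phi> - moment [0, a] (cyclic_shift l \<theta>)\<bar> \<le> \<sigma>\<^sup>2 * T" for a
        using raw_moment_diff_le[of "[0, a]"] by (simp add: short_words_def power2_eq_square)
    qed
    then have "norm (\<phi> - cyclic_shift l \<theta>) \<le> CARD('l mod_ring) * (c\<^sub>1 * (\<sigma>\<^sup>2 * T))"
      by (intro norm_le_card_bound) simp
    then have "orbit_dist \<phi> \<theta> \<le> real CARD('l) * (c\<^sub>1 * (\<sigma>\<^sup>2 * T))"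
      using orbit_dist_le[of \<phi> \<theta> l] by simp
    also have "\<dots> \<le> real CARD('l) * (c\<^sub>1 * (\<sigma>\<^sup>2 * T) + 2 * M * (c\<^sub>0 / m)\<^sup>2 * (\<sigma> ^ 6 * T\<^sup>2))"
      using M by (intro mult_left_mono) auto
    finally show ?thesis .
  next
    case False
    then have "1 \<le> c\<^sub>0 / m * (\<sigma> ^ 3 * T)" using m by (simp add: pos_le_divide_eq)
    then have "1 \<le> (c\<^sub>0 / m * (\<sigma> ^ 3 * T))\<^sup>2" by (rule one_le_power)
    also have "\<dots> = (c\<^sub>0 / m)\<^sup>2 * (\<sigma> ^ 6 * T\<^sup>2)"
      unfolding power_mult_distrib by (simp flip: power_mult)
    finally have "2 * M * 1 \<le> 2 * M * ((c\<^sub>0 / m)\<^sup>2 * (\<sigma> ^ 6 * T\<^sup>2))"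
      using M by (intro mult_left_mono) auto
    moreover have "0 \<le> c\<^sub>1 * (\<sigma>\<^sup>2 * T)" using c1_nonneg moment_gap_nonneg[of u v] by simp
    ultimately have "2 * M \<le> c\<^sub>1 * (\<sigma>\<^sup>2 * T) + 2 * M * (c\<^sub>0 / m)\<^sup>2 * (\<sigma> ^ 6 * T\<^sup>2)"
      by (simp add: mult.assoc)
    then show ?thesis
      by (intro order.trans[OF orbit_dist_bound] mult_left_mono) auto
  qed
qed

end

context signal_pair
begin

text \<open>The threshold \<eta> is the largest \<open>N\<close> allowed by the smallness conditions
  of \<open>moment_gap_le\<close>. Beyond it the trivial distance bound is multiplied by
  \<open>N\<^sup>2 / \<eta>\<^sup>2\<close>, which is at least 1.\<close>

lemma orbit_dist_le_total_deviation:
  assumes n: "0 < n" and fin: "total_deviation Z n v < \<infinity>"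
    and likelihood: "0 \<le> (\<Sum>i=1..n. ln (dens u (Z i) / dens v (Z i)))"
    and K: "K = (1 + c\<^sub>0 * M\<^sup>2) / radius TYPE('l) ^ 3"
    and a: "a = 1 / (2 * moment_stability TYPE('l))" and b: "b = exp_moment TYPE('l) 7 + 1"
    and c2: "c2 = a\<^sup>2 / (144 * b)" and D: "D = 4 * (2 * K + real CARD('l)) / c2"
    and \<eta>: "\<eta> = min 1 (a / (2 * (2 * K + real CARD('l))))"
    and C: "C = real CARD('l) * (c\<^sub>1 * D + 2 * M * (c\<^sub>0 / m)\<^sup>2 * D\<^sup>2 + 2 * M / \<eta>\<^sup>2)"
    and \<sigma>_large: "(3 * K + real CARD('l)) ^ 3 * b * (2 * M) / (3 * c2 / 4) \<le> \<sigma>"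
  shows "orbit_dist \<phi> \<theta> \<le> C * (\<sigma>\<^sup>2 * sqrt (enn2real (total_deviation Z n v)) + \<sigma> ^ 6 * enn2real (total_deviation Z n v))"
proof -
  define N where "N = sqrt (enn2real (total_deviation Z n v))"
  have N_sq: "N\<^sup>2 = enn2real (total_deviation Z n v)" by (simp add: N_def)
  have cp: "close_pair u v K T" unfolding K by (rule close_pair_moment_gap)
  note K1 = close_pair.K[OF cp]
  interpret good_sample u v K T Z n N
    unfolding N_def by (rule good_sample_total_deviation[OF cp n fin])
  have ap: "0 < a" using moment_stability_ge_1[where 'l='l] by (simp add: a)
  have bp: "1 \<le> b" using exp_moment_nonneg[where 'l='l, of 7] by (simp add: b)
  have c2p: "0 < c2" using ap bp by (simp add: c2)
  have k1: "0 < 2 * K + real CARD('l)" using K1 by (simp add: add_pos_pos)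
  have Dp: "0 \<le> D" using k1 c2p by (simp add: D)
  have \<eta>p: "0 < \<eta>" using ap k1 by (simp add: \<eta>)
  let ?L = "real CARD('l)"
  let ?A = "c\<^sub>1 * D" and ?B = "2 * M * (c\<^sub>0 / m)\<^sup>2 * D\<^sup>2" and ?E = "2 * M / \<eta>\<^sup>2"
  have nonneg: "0 \<le> ?A" "0 \<le> ?B" "0 \<le> ?E" using c1_nonneg Dp M by simp_all
  have X: "0 \<le> \<sigma>\<^sup>2 * N" "0 \<le> \<sigma> ^ 6 * N\<^sup>2" using N by simp_all
  have "orbit_dist \<phi> \<theta> \<le> ?L * ((?A + ?B + ?E) * (\<sigma>\<^sup>2 * N + \<sigma> ^ 6 * N\<^sup>2))"
  proof (cases "N \<le> \<eta>")
    case True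
    obtain w where w: "w \<in> short_words" "\<bar>moment w u - moment w v\<bar> = T" by (rule moment_gap_attained)
    have "T \<le> D * N"
      unfolding D
    proof (rule moment_gap_le[OF w likelihood _ a b c2])
      show "N \<le> 1" using True by (simp add: \<eta>)
      have "N \<le> a / (2 * (2 * K + ?L))" using True by (simp add: \<eta>)
      then show "(2 * K + ?L) * N \<le> a / 2" using k1 by (simp add: field_simps)
      \<comment> \<open>The a priori bound \<open>2 * M / \<sigma>\<close> on the gap and the lower
        bound on \<sigma> give the smallness of \<open>T\<close> without any condition on the
        sample.\<close>
      have "(3 * K + ?L) ^ 3 * b * T \<le> (3 * K + ?L) ^ 3 * b * (2 * M / \<sigma>)"
        using moment_gap_small bp K1 by (intro mult_left_mono) auto
      also have "\<dots> \<le> 3 * c2 / 4"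
        using \<sigma>_large \<sigma>_pos c2p by (simp add: field_simps)
      finally show "(3 * K + ?L) ^ 3 * b * T \<le> 3 * c2 / 4" .
    qed
    then have T: "T \<le> D * N" "T\<^sup>2 \<le> D\<^sup>2 * N\<^sup>2"
      using moment_gap_nonneg[of u v] by (auto simp: power_mono simp flip: power_mult_distrib)
    have "c\<^sub>1 * (\<sigma>\<^sup>2 * T) \<le> c\<^sub>1 * (\<sigma>\<^sup>2 * (D * N))"
      using T c1_nonneg by (intro mult_left_mono) auto
    moreover have "2 * M * (c\<^sub>0 / m)\<^sup>2 * (\<sigma> ^ 6 * T\<^sup>2) \<le> 2 * M * (c\<^sub>0 / m)\<^sup>2 * (\<sigma> ^ 6 * (D\<^sup>2 * N\<^sup>2))"
      using T M by (intro mult_left_mono) auto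
    ultimately have "c\<^sub>1 * (\<sigma>\<^sup>2 * T) + 2 * M * (c\<^sub>0 / m)\<^sup>2 * (\<sigma> ^ 6 * T\<^sup>2)
      \<le> ?A * (\<sigma>\<^sup>2 * N) + ?B * (\<sigma> ^ 6 * N\<^sup>2)"
      by (simp add: mult_ac)
    also have "\<dots> \<le> (?A + ?B + ?E) * (\<sigma>\<^sup>2 * N) + (?A + ?B + ?E) * (\<sigma> ^ 6 * N\<^sup>2)"
      using nonneg X by (intro add_mono mult_right_mono) auto
    finally show ?thesis
      by (intro order.trans[OF orbit_dist_le_moment_gap] mult_left_mono) (auto simp: distrib_left)
  next
    case False
    have "\<eta>\<^sup>2 \<le> N\<^sup>2" using False \<eta>p by (intro power_mono) auto
    then have "2 * M * 1 \<le> 2 * M * (N\<^sup>2 / \<eta>\<^sup>2)" using M \<eta>p by (intro mult_left_mono) auto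
    also have "\<dots> = ?E * (1 * N\<^sup>2)" by simp
    also have "\<dots> \<le> ?E * (\<sigma> ^ 6 * N\<^sup>2)"
      using nonneg \<sigma>1 by (intro mult_left_mono mult_right_mono) auto
    also have "\<dots> \<le> (?A + ?B + ?E) * (\<sigma>\<^sup>2 * N + \<sigma> ^ 6 * N\<^sup>2)"
      using nonneg X by (intro mult_mono) auto
    finally show ?thesis
      by (intro order.trans[OF orbit_dist_bound] mult_left_mono) auto
  qed
  then show ?thesis
    unfolding C N_def[symmetric] unfolding N_sq[symmetric] by (simp only: mult.assoc)
qed

end

section \<open>Taking expectations and fixing the constants\<close>

lemma integral_le_total_deviation:
  fixes \<theta> :: "real ^ 'l::finite mod_ring" and R :: "(nat \<Rightarrow> real ^ 'l mod_ring) \<Rightarrow> real"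
  assumes "0 < \<sigma>" and n: "0 < n" and v: "v = (1 / \<sigma>) *\<^sub>R \<theta>" and "l1 v \<le> 1" and C: "0 < C"
    and R: "\<And>X. X \<in> space (\<Pi>\<^sub>M i\<in>{1..n}. borel) \<Longrightarrow> total_deviation (rescale \<sigma> X) n v < \<infinity> \<Longrightarrow>
      R X \<le> C * (\<sigma>\<^sup>2 * sqrt (enn2real (total_deviation (rescale \<sigma> X) n v))
        + \<sigma> ^ 6 * enn2real (total_deviation (rescale \<sigma> X) n v))"
  shows "(\<integral>X. R X \<partial>(\<Pi>\<^sub>M i\<in>{1..n}. mra_law \<sigma> \<theta>))
    \<le> C * (deviation_const TYPE('l) + 1) * (\<sigma>\<^sup>2 / sqrt n + \<sigma> ^ 6 / n)"
proof (rule integral_real_bounded)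
  let ?P = "\<Pi>\<^sub>M i\<in>{1..n}. mra_law \<sigma> \<theta>"
  let ?B = "deviation_const TYPE('l)"
  let ?V = "\<lambda>X. total_deviation (rescale \<sigma> X) n v"
  interpret P: prob_space ?P by (rule prob_space_PiM) (rule prob_space_mra_law)
  \<comment> \<open>The integrand will be dominated by the affine function \<open>a * V + d\<close>
    of the total deviation \<open>V\<close>, whose expectation is known to be of order
    \<open>1 / n\<close>.\<close>
  define a where "a = C * (\<sigma>\<^sup>2 * sqrt n + \<sigma> ^ 6)"
  define d where "d = C * \<sigma>\<^sup>2 / sqrt n"
  have a: "0 < a" using C \<open>0 < \<sigma>\<close> by (simp add: a_def add_nonneg_pos)
  have d: "0 \<le> d" using C by (simp add: d_def)
  have B: "0 \<le> ?B" by (rule deviation_const_nonneg)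
  have sq: "0 < sqrt n" using n by simp
  have "(\<integral>\<^sup>+X. ennreal (R X) \<partial>?P) \<le> (\<integral>\<^sup>+X. ennreal a * ?V X + ennreal d \<partial>?P)"
  proof (rule nn_integral_mono)
    fix X assume "X \<in> space ?P"
    then have X: "X \<in> space (\<Pi>\<^sub>M i\<in>{1..n}. borel)" by (simp add: space_PiM mra_law_def)
    show "ennreal (R X) \<le> ennreal a * ?V X + ennreal d"
    proof (cases "?V X < \<infinity>")
      case False
      \<comment> \<open>On samples with infinite total deviation the positive slope \<open>a\<close>
        makes the right-hand side infinite.\<close>
      then show ?thesis using a by (simp add: ennreal_mult_top less_top[symmetric])
    next
      case True
      define V where "V = enn2real (?V X)"
      have V: "0 \<le> V" "?V X = ennreal V" using True by (auto simp: V_def)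
      \<comment> \<open>Arithmetic-geometric mean with weight \<open>sqrt n\<close>: since
        \<open>V\<close> has mean of order \<open>1 / n\<close>, both terms on the right are of
        order \<open>1 / sqrt n\<close> in expectation.\<close>
      have "sqrt V \<le> sqrt n * V + 1 / sqrt n"
      proof -
        have "0 \<le> (sqrt n * sqrt V - 1)\<^sup>2" by simp
        also have "\<dots> = n * V - 2 * (sqrt n * sqrt V) + 1"
          using V(1) by (simp add: power2_diff power_mult_distrib)
        finally have "2 * (sqrt n * sqrt V) \<le> n * V + 1" by simp
        moreover have "0 \<le> sqrt n * sqrt V" using V(1) by simp
        ultimately have "sqrt n * sqrt V \<le> n * V + 1" by linarith
        also have "\<dots> = sqrt n * (sqrt n * V + 1 / sqrt n)"
          using sq by (simp add: distrib_left mult.assoc[symmetric])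
        finally show ?thesis using sq by (simp only: mult_le_cancel_left_pos)
      qed
      then have "C * (\<sigma>\<^sup>2 * sqrt V + \<sigma> ^ 6 * V) \<le> C * (\<sigma>\<^sup>2 * (sqrt n * V + 1 / sqrt n) + \<sigma> ^ 6 * V)"
        using C by (intro mult_left_mono add_right_mono) auto
      also have "\<dots> = a * V + d" by (simp add: a_def d_def algebra_simps)
      finally have "R X \<le> a * V + d" using R[OF X True] by (simp add: V_def)
      then have "ennreal (R X) \<le> ennreal (a * V + d)" by (rule ennreal_leI)
      then show ?thesis using a d V by (simp add: ennreal_mult)
    qed
  qed
  also have "\<dots> = ennreal a * (\<integral>\<^sup>+X. ?V X \<partial>?P) + ennreal d"
  proof -
    have "(\<integral>\<^sup>+X. ennreal a * ?V X + ennreal d \<partial>?P) = (\<integral>\<^sup>+X. ennreal a * ?V X \<partial>?P) + (\<integral>\<^sup>+X. ennreal d \<partial>?P)"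
      by (rule nn_integral_add) measurable
    also have "(\<integral>\<^sup>+X. ennreal a * ?V X \<partial>?P) = ennreal a * (\<integral>\<^sup>+X. ?V X \<partial>?P)"
      by (rule nn_integral_cmult) measurable
    finally show ?thesis by (simp add: P.emeasure_space_1 del: One_nat_def)
  qed
  also have "\<dots> \<le> ennreal a * ennreal (?B / n) + ennreal d"
    by (intro add_right_mono mult_left_mono nn_integral_total_deviation_le assms) auto
  also have "\<dots> = ennreal (a * (?B / n) + d)"
    using a B d by (simp add: ennreal_mult[symmetric])
  also have "\<dots> \<le> ennreal (C * (?B + 1) * (\<sigma>\<^sup>2 / sqrt n + \<sigma> ^ 6 / n))"
  proof (rule ennreal_leI)
    have "sqrt n / n = 1 / sqrt n" using n by (simp add: real_div_sqrt field_simps)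
    then have "a * (?B / n) + d = C * ?B * (\<sigma>\<^sup>2 / sqrt n + \<sigma> ^ 6 / n) + C * (\<sigma>\<^sup>2 / sqrt n)"
      unfolding a_def d_def using n by (simp add: field_simps)
    also have "\<dots> \<le> C * ?B * (\<sigma>\<^sup>2 / sqrt n + \<sigma> ^ 6 / n) + C * (\<sigma>\<^sup>2 / sqrt n + \<sigma> ^ 6 / n)"
      using C by (intro add_left_mono mult_left_mono) auto
    also have "\<dots> = C * (?B + 1) * (\<sigma>\<^sup>2 / sqrt n + \<sigma> ^ 6 / n)"
    proof -
      have "C * ?B * w + C * w = C * (?B + 1) * w" for w by (simp add: algebra_simps)
      then show ?thesis .
    qed
    finally show "a * (?B / n) + d \<le> C * (?B + 1) * (\<sigma>\<^sup>2 / sqrt n + \<sigma> ^ 6 / n)" .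
  qed
  finally show "(\<integral>\<^sup>+X. ennreal (R X) \<partial>?P) \<le> ennreal (C * (?B + 1) * (\<sigma>\<^sup>2 / sqrt n + \<sigma> ^ 6 / n))" .
  show "0 \<le> C * (?B + 1) * (\<sigma>\<^sup>2 / sqrt n + \<sigma> ^ 6 / n)" using C B by simp
qed

theorem theorem1p4p3:
  fixes m M \<epsilon> :: real
  assumes "m > 0" and "M > 0" and "\<epsilon> > 0"
  shows "\<exists>(C::real) (C\<^sub>s :: nat \<Rightarrow> real). C > 0 \<and> (\<forall>s. C\<^sub>s s > 0) \<and>
    (\<forall>\<^sub>F \<sigma> in at_top. \<forall>n\<ge>1. \<forall>\<theta> \<in> (signal_class m M \<epsilon> \<sigma> :: (real ^ 'l::finite mod_ring) set).
       \<forall>est. restricted_mle m M \<epsilon> \<sigma> n est \<longrightarrow>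
         (let s = card (supp \<theta>) in
          (\<integral>X. orbit_dist (est X) \<theta> \<partial>(\<Pi>\<^sub>M i\<in>{1..n}. mra_law \<sigma> \<theta>))
            \<le> C * \<sigma>\<^sup>2 / sqrt (real n)
              + C * \<sigma> ^ 3 * ln (real n) / (real s * real n)
              + C\<^sub>s s * \<sigma> ^ 11 / real n))"
proof -
  let ?L = "real CARD('l)"
  define c\<^sub>0 where "c\<^sub>0 = ?L * (4 * M + 1) / m\<^sup>2"
  define c\<^sub>1 where "c\<^sub>1 = 3 * M\<^sup>2 * ?L / m ^ 3"
  define K where "K = (1 + c\<^sub>0 * M\<^sup>2) / radius TYPE('l) ^ 3"
  define a where "a = 1 / (2 * moment_stability TYPE('l))"
  define b where "b = exp_moment TYPE('l) 7 + 1"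
  define c2 where "c2 = a\<^sup>2 / (144 * b)"
  define D where "D = 4 * (2 * K + ?L) / c2"
  define \<eta> where "\<eta> = min 1 (a / (2 * (2 * K + ?L)))"
  define C' where "C' = ?L * (c\<^sub>1 * D + 2 * M * (c\<^sub>0 / m)\<^sup>2 * D\<^sup>2 + 2 * M / \<eta>\<^sup>2)"
  \<comment> \<open>The threshold collects the three lower bounds on \<sigma> in
    \<open>signal_pair\<close> and the one that absorbs the cubic likelihood term. It depends only
    on \<open>m\<close>, \<open>M\<close> and L, so it is uniform in \<open>n\<close> and
    \<theta>.\<close>
  define \<sigma>\<^sub>0 where "\<sigma>\<^sub>0 = Max {1, M / radius TYPE('l), ?L * M, (3 * K + ?L) ^ 3 * b * (2 * M) / (3 * c2 / 4)}"
  define C where "C = C' * (deviation_const TYPE('l) + 1)"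
  have C': "0 < C'"
  proof -
    have "0 \<le> c\<^sub>0" "0 \<le> c\<^sub>1" using assms by (simp_all add: c\<^sub>0_def c\<^sub>1_def)
    moreover from this have "0 < K" using radius_bounds(1)[where 'l='l] by (simp add: K_def add_pos_nonneg)
    moreover have "0 < a" using moment_stability_ge_1[where 'l='l] by (simp add: a_def)
    moreover have "0 < b" using exp_moment_nonneg[where 'l='l, of 7] by (simp add: b_def)
    ultimately have "0 \<le> c\<^sub>1 * D" "0 < \<eta>"
      by (simp_all add: D_def c2_def \<eta>_def add_pos_nonneg)
    moreover have "0 \<le> 2 * M * (c\<^sub>0 / m)\<^sup>2 * D\<^sup>2" using assms by simp
    moreover have "0 < 2 * M / \<eta>\<^sup>2" using assms \<open>0 < \<eta>\<close> by simp
    ultimately show ?thesis by (simp add: C'_def add_nonneg_pos)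
  qed
  have C: "0 < C" using C' deviation_const_nonneg[where 'l='l] by (simp add: C_def)
  have "\<forall>\<^sub>F \<sigma> in at_top. \<forall>n\<ge>1. \<forall>\<theta> \<in> (signal_class m M \<epsilon> \<sigma> :: (real ^ 'l mod_ring) set).
       \<forall>est. restricted_mle m M \<epsilon> \<sigma> n est \<longrightarrow>
         (let s = card (supp \<theta>) in
          (\<integral>X. orbit_dist (est X) \<theta> \<partial>(\<Pi>\<^sub>M i\<in>{1..n}. mra_law \<sigma> \<theta>))
            \<le> C * \<sigma>\<^sup>2 / sqrt (real n) + C * \<sigma> ^ 3 * ln (real n) / (real s * real n) + C * \<sigma> ^ 11 / real n)"
    using eventually_ge_at_top[of \<sigma>\<^sub>0]
  proof (eventually_elim, intro allI impI ballI)
    fix \<sigma> n and \<theta> :: "real ^ 'l mod_ring" and est :: "(nat \<Rightarrow> real ^ 'l mod_ring) \<Rightarrow> real ^ 'l mod_ring"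
    assume \<sigma>: "\<sigma>\<^sub>0 \<le> \<sigma>" and n: "(1::nat) \<le> n" and \<theta>: "\<theta> \<in> signal_class m M \<epsilon> \<sigma>"
      and est: "restricted_mle m M \<epsilon> \<sigma> n est"
    have \<sigma>': "1 \<le> \<sigma>" "M / radius TYPE('l) \<le> \<sigma>" "?L * M \<le> \<sigma>"
      "(3 * K + ?L) ^ 3 * b * (2 * M) / (3 * c2 / 4) \<le> \<sigma>"
      using \<sigma> by (simp_all add: \<sigma>\<^sub>0_def)
    define v where "v = (1 / \<sigma>) *\<^sub>R \<theta>"
    have pair: "signal_pair m M \<sigma> c\<^sub>0 c\<^sub>1 \<theta> \<phi>" if "\<phi> \<in> signal_class m M \<epsilon> \<sigma>" for \<phi>
      using assms \<sigma>' signal_class_admissible[OF \<theta>] signal_class_admissible[OF that] signal_class_card[OF \<theta>]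
      by unfold_locales (simp_all add: c\<^sub>0_def c\<^sub>1_def)
    have "(\<integral>X. orbit_dist (est X) \<theta> \<partial>(\<Pi>\<^sub>M i\<in>{1..n}. mra_law \<sigma> \<theta>))
      \<le> C' * (deviation_const TYPE('l) + 1) * (\<sigma>\<^sup>2 / sqrt n + \<sigma> ^ 6 / n)"
    proof (rule integral_le_total_deviation[OF _ _ v_def _ C'])
      show "0 < \<sigma>" "0 < n" using \<sigma>' n by simp_all
      show "l1 v \<le> 1"
        unfolding v_def by (rule signal_pair.l1_scaled_le[OF pair[OF \<theta>] signal_class_admissible[OF \<theta>]])
      fix X :: "nat \<Rightarrow> real ^ 'l mod_ring"
      assume X: "X \<in> space (\<Pi>\<^sub>M i\<in>{1..n}. borel)" and fin: "total_deviation (rescale \<sigma> X) n v < \<infinity>"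
      note mle = restricted_mle_likelihood[OF est X \<theta> \<open>0 < \<sigma>\<close>]
      show "orbit_dist (est X) \<theta> \<le> C' * (\<sigma>\<^sup>2 * sqrt (enn2real (total_deviation (rescale \<sigma> X) n v))
          + \<sigma> ^ 6 * enn2real (total_deviation (rescale \<sigma> X) n v))"
        unfolding v_def
        by (rule signal_pair.orbit_dist_le_total_deviation[OF pair[OF mle(1)] \<open>0 < n\<close> fin[unfolded v_def] mle(2)
              K_def a_def b_def c2_def D_def \<eta>_def C'_def \<sigma>'(4)])
    qed
    also have "\<dots> = C * \<sigma>\<^sup>2 / sqrt n + C * \<sigma> ^ 6 / n"
      by (simp add: C_def distrib_left)
    \<comment> \<open>From \<open>1 \<le> \<sigma>\<close> one gets
      \<open>\<sigma> ^ 6 \<le> \<sigma> ^ 11\<close>; the logarithmic term added next is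
      nonnegative because \<open>1 \<le> n\<close>.\<close>
    also have "\<dots> \<le> C * \<sigma>\<^sup>2 / sqrt n + C * \<sigma> ^ 11 / n"
      using C \<sigma>' by (intro add_left_mono divide_right_mono mult_left_mono power_increasing) auto
    also have "\<dots> \<le> C * \<sigma>\<^sup>2 / sqrt n + C * \<sigma> ^ 3 * ln n / (real (card (supp \<theta>)) * n) + C * \<sigma> ^ 11 / n"
      using C \<sigma>' n by simp
    finally show "let s = card (supp \<theta>) in
          (\<integral>X. orbit_dist (est X) \<theta> \<partial>(\<Pi>\<^sub>M i\<in>{1..n}. mra_law \<sigma> \<theta>))
            \<le> C * \<sigma>\<^sup>2 / sqrt (real n) + C * \<sigma> ^ 3 * ln (real n) / (real s * real n) + C * \<sigma> ^ 11 / real n"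
      by (simp only: Let_def)
  qed
  then show ?thesis
    \<comment> \<open>The constant \<open>C\<close> depends only on \<open>m\<close>,
      \<open>M\<close> and L, so the constant function \<open>\<lambda>_. C\<close> can serve as
      \<open>C\<^sub>s\<close>.\<close>
    using C by (intro exI[of _ C] exI[of _ "\<lambda>_. C"] conjI) auto
qed

end
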